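(* Assume $\mu>0$, $K>0$, $L>0$, and that $h$ satisfies the assumption stated in the context. Let $d^*<D^*<U^*<u^*$, along with constants $A^*$ and $B^*$, be the unique constants for which there are $x_1<a<x_2$ with $d^*<x_1<D^*<U^*<x_2<u^*$ such that $g=g_{A^*,B^*}$ is decreasing on $(-\infty,x_1)$, increasing on $(x_1,x_2)$, decreasing on $(x_2,\infty)$, and $$\int_{d^*}^{D^*}[g(x)+k]\,dx=-K,\quad \int_{U^*}^{u^*}[g(x)-\ell]\,dx=L,\quad g(d^* )=g(D^* )=-k,\quad g(U^* )=g(u^* )=\ell .$$ Then the control band policy $\varphi^*=\{d^*,D^*,U^*,u^*\}$ is optimal among all feasible policies; that is, $\mathrm{AC}(x,\varphi^* )\le \mathrm{AC}(x,\varphi)$ for every feasible policy $\varphi$ and every initial inventory level $x\in\mathbb R$.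
   Context: $\mu>0$, $\sigma>0$, $K>0$, $L>0$, $k>0$, $\ell>0$ are constants and $\lambda=2\mu/\sigma^2$. $W$ is an $\{\mathcal F_t\}$-standard Brownian motion on a filtered probability space and $X(t)=x+\mu t+\sigma W(t)$. Assumption on $h:\mathbb R\to[0,\infty)$: $h$ is continuous and convex; there is $a\in\mathbb R$ such that $h$ is $C^2$ on $\mathbb R\setminus\{a\}$ and $h(a)=0$; $h'(x)<0$ for $x<a$ and $h'(x)>0$ for $x>a$; and $\int_{-\infty}^a|h'(y)|e^{\lambda(y-a)}dy<\infty$. For $A,B,x\in\mathbb R$, $g_{A,B}(x)=A-Be^{-\lambda(x-a)}-\frac{\lambda}{\mu}\int_a^x h(y)e^{-\lambda(x-y)}\,dy$. It is a known fact, usable here, that constants $A^*,B^*,d^*,D^*,U^*,u^*$ with the listed properties exist and are unique. Policies: a policy $\varphi=(Y_1,Y_2)$ is a pair of $\{\mathcal F_t\}$-adapted processes with nondecreasing right-continuous paths having left limits, with convention $Y_i(0-)=0$. The inventory process is $Z(t)=X(t)+Y_1(t)-Y_2(t)$, $Z(0-)=x$. A time $t\ge0$ is an increasing point of $Y_i$ if $Y_i(s)-Y_i(t-)>0$ for each $s>t$; $N_i(t)$ is the cardinality of the set of increasing points of $Y_i$ in $[0,t]$. A policy is feasible if $\mathbb E_x[Y_i(t)]<\infty$ and $\mathbb E_x[N_i(t)]<\infty$ for $i=1,2$ and all $t\ge0$ (recall $K,L>0$). The long-run average cost is $$\mathrm{AC}(x,\varphi)=\limsup_{t\to\infty}\frac1t\,\mathbb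 E_x\Big[\int_0^t h(Z(s))\,ds+KN_1(t)+LN_2(t)+kY_1(t)+\ell Y_2(t)\Big],$$ where $\mathbb E_x$ is expectation given $Z(0-)=x$. Control band policy $\{d,D,U,u\}$, $d<D<U<u$ (pure-jump policy): at time $T_0=0$ the inventory is adjusted by $\xi_0=D-x$ if $x\le d$, $\xi_0=0$ if $d<x<u$, $\xi_0=U-x$ if $x\ge u$. For $n\ge1$, $T_n=\inf\{t>T_{n-1}:Z(t-)\in\{d,u\}\}$, and at time $T_n$ the inventory is adjusted by $D-d$ if $Z(T_n-)=d$ and by $U-u$ if $Z(T_n-)=u$. Positive adjustments are jumps of $Y_1$, absolute values of negative adjustments are jumps of $Y_2$. *)

theory Defs
  imports "HOL-Probability.Probability"
begin

section \<open>Brownian motion on a filtered probability space\<close>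

text \<open>
  Time runs through the nonnegative reals. The library's filtrations are indexed by the whole type
  \<^typ>\<open>real\<close>; nothing is required of the entries at negative times beyond what the locale
  demands, so a filtration indexed by \<open>t \<ge> 0\<close> can be extended by its value at \<open>0\<close>.
\<close>

definition filtered_prob_space :: "'a measure \<Rightarrow> (real \<Rightarrow> 'a measure) \<Rightarrow> bool" where
  "filtered_prob_space M F \<longleftrightarrow>
     prob_space M \<and> filtration (space M) F \<and> (\<forall>t. subalgebra M (F t))"

definition adapted :: "(real \<Rightarrow> 'a measure) \<Rightarrow> (real \<Rightarrow> 'a \<Rightarrow> real) \<Rightarrow> bool" where
  "adapted F Y \<longleftrightarrow> (\<forall>t\<ge>0. Y t \<in> borel_measurable (F t))"

definition standard_brownian_motion ::
  "'a measure \<Rightarrow> (real \<Rightarrow> 'a measure) \<Rightarrow> (real \<Rightarrow> 'a \<Rightarrow> real) \<Rightarrow> bool" where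
  "standard_brownian_motion M F W \<longleftrightarrow>
     adapted F W \<and>
     (\<forall>\<omega>\<in>space M. W 0 \<omega> = 0 \<and> continuous_on {0..} (\<lambda>t. W t \<omega>)) \<and>
     (\<forall>s t. 0 \<le> s \<longrightarrow> s < t \<longrightarrow>
        distributed M lborel (\<lambda>\<omega>. W t \<omega> - W s \<omega>) (normal_density 0 (sqrt (t - s))) \<and>
        prob_space.indep_set M (sets (F s))
          (sets (vimage_algebra (space M) (\<lambda>\<omega>. W t \<omega> - W s \<omega>) borel)))"

definition netput ::
  "real \<Rightarrow> real \<Rightarrow> (real \<Rightarrow> 'a \<Rightarrow> real) \<Rightarrow> real \<Rightarrow> real \<Rightarrow> 'a \<Rightarrow> real" where
  "netput \<mu> \<sigma> W x t \<omega> = x + \<mu> * t + \<sigma> * W t \<omega>"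

section \<open>Holding cost\<close>

definition holding_cost :: "real \<Rightarrow> real \<Rightarrow> (real \<Rightarrow> real) \<Rightarrow> real \<Rightarrow> bool" where
  "holding_cost \<mu> \<sigma> h a \<longleftrightarrow>
     (\<forall>x. 0 \<le> h x) \<and> continuous_on UNIV h \<and> convex_on UNIV h \<and>
     (\<forall>x. x \<noteq> a \<longrightarrow> h differentiable (at x)) \<and>
     (\<forall>x. x \<noteq> a \<longrightarrow> deriv h differentiable (at x)) \<and>
     continuous_on (- {a}) (deriv (deriv h)) \<and>
     h a = 0 \<and>
     (\<forall>x<a. deriv h x < 0) \<and> (\<forall>x>a. 0 < deriv h x) \<and>
     set_integrable lborel {..<a} (\<lambda>y. \<bar>deriv h y\<bar> * exp (2 * \<mu> / \<sigma>\<^sup>2 * (y - a)))"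

definition g_fun ::
  "real \<Rightarrow> real \<Rightarrow> (real \<Rightarrow> real) \<Rightarrow> real \<Rightarrow> real \<Rightarrow> real \<Rightarrow> real \<Rightarrow> real" where
  "g_fun \<mu> \<sigma> h a A B x =
     (let lam = 2 * \<mu> / \<sigma>\<^sup>2 in
        A - B * exp (- lam * (x - a))
          - lam / \<mu> * (LBINT y=a..x. h y * exp (- lam * (x - y))))"

section \<open>Policies and their cost\<close>

text \<open>Left limit of a path \<open>y\<close> of a control process, with the convention \<open>y(0-) = 0\<close>.\<close>

definition left_value :: "(real \<Rightarrow> real) \<Rightarrow> real \<Rightarrow> real" where
  "left_value y t = (if t \<le> 0 then 0 else Lim (at_left t) y)"

definition increasing_point :: "(real \<Rightarrow> real) \<Rightarrow> real \<Rightarrow> bool" where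
  "increasing_point y t \<longleftrightarrow> 0 \<le> t \<and> (\<forall>s>t. y s - left_value y t > 0)"

text \<open>Counting measure, so that infinitely many increasing points count as \<open>\<infinity>\<close>.\<close>

definition num_adjustments :: "(real \<Rightarrow> real) \<Rightarrow> real \<Rightarrow> ennreal" where
  "num_adjustments y t = emeasure (count_space UNIV) {s \<in> {0..t}. increasing_point y s}"

text \<open>The condition \<open>0 \<le> Y 0 \<omega>\<close> is monotonicity at time \<open>0\<close>, since \<open>Y(0-) = 0\<close>.\<close>

definition control_process ::
  "'a measure \<Rightarrow> (real \<Rightarrow> 'a measure) \<Rightarrow> (real \<Rightarrow> 'a \<Rightarrow> real) \<Rightarrow> bool" where
  "control_process M F Y \<longleftrightarrow>
     adapted F Y \<and>
     (\<forall>\<omega>\<in>space M.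
        0 \<le> Y 0 \<omega> \<and> mono_on {0..} (\<lambda>t. Y t \<omega>) \<and>
        (\<forall>t\<ge>0. continuous (at_right t) (\<lambda>s. Y s \<omega>)) \<and>
        (\<forall>t>0. \<exists>l. ((\<lambda>s. Y s \<omega>) \<longlongrightarrow> l) (at_left t)))"

type_synonym 'a policy = "(real \<Rightarrow> 'a \<Rightarrow> real) \<times> (real \<Rightarrow> 'a \<Rightarrow> real)"

definition feasible :: "'a measure \<Rightarrow> (real \<Rightarrow> 'a measure) \<Rightarrow> 'a policy \<Rightarrow> bool" where
  "feasible M F \<phi> \<longleftrightarrow>
     (\<forall>Y\<in>{fst \<phi>, snd \<phi>}.
        control_process M F Y \<and>
        (\<forall>t\<ge>0. (\<integral>\<^sup>+\<omega>. ennreal (Y t \<omega>) \<partial>M) < \<infinity> \<and>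
               (\<integral>\<^sup>+\<omega>. num_adjustments (\<lambda>s. Y s \<omega>) t \<partial>M) < \<infinity>))"

definition inventory ::
  "real \<Rightarrow> real \<Rightarrow> (real \<Rightarrow> 'a \<Rightarrow> real) \<Rightarrow> real \<Rightarrow> 'a policy \<Rightarrow> real \<Rightarrow> 'a \<Rightarrow> real" where
  "inventory \<mu> \<sigma> W x \<phi> t \<omega> = netput \<mu> \<sigma> W x t \<omega> + fst \<phi> t \<omega> - snd \<phi> t \<omega>"

text \<open>
  All cost terms are nonnegative, so expectations are Lebesgue integrals with values in
  \<open>[0, \<infinity>]\<close>. The starting level \<open>x\<close> enters through \<^const>\<open>inventory\<close>, hence the expectation
  under \<open>Z(0-) = x\<close> is the integral over \<open>M\<close>.
\<close>

definition average_cost ::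
  "'a measure \<Rightarrow> (real \<Rightarrow> 'a \<Rightarrow> real) \<Rightarrow> real \<Rightarrow> real \<Rightarrow> (real \<Rightarrow> real) \<Rightarrow>
   real \<Rightarrow> real \<Rightarrow> real \<Rightarrow> real \<Rightarrow> real \<Rightarrow> 'a policy \<Rightarrow> ennreal" where
  "average_cost M W \<mu> \<sigma> h K L k l x \<phi> =
     Limsup at_top (\<lambda>t::real.
       (\<integral>\<^sup>+\<omega>. (\<integral>\<^sup>+s\<in>{0..t}. ennreal (h (inventory \<mu> \<sigma> W x \<phi> s \<omega>)) \<partial>lborel)
               + ennreal K * num_adjustments (\<lambda>s. fst \<phi> s \<omega>) t
               + ennreal L * num_adjustments (\<lambda>s. snd \<phi> s \<omega>) t
               + ennreal (k * fst \<phi> t \<omega>) + ennreal (l * snd \<phi> t \<omega>) \<partial>M) / ennreal t)"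

section \<open>Control band policies\<close>

text \<open>
  For a continuous path \<open>X\<close> with \<open>X 0 = x\<close>, \<open>band_seq d D U u X n\<close> is the triple of the \<open>n\<close>-th
  adjustment time, the \<open>n\<close>-th adjustment and the sum of the adjustments \<open>0, \<dots>, n\<close>.
  Up to and including the next adjustment time \<open>T'\<close>, the level just before time \<open>t > T\<close> is
  \<open>Z(t-) = X t + c\<close> with \<open>c\<close> the sum so far. If the band is never left again, then
  \<open>T' = Inf {} = \<infinity>\<close> and no further adjustment is made.
\<close>

definition initial_adjustment :: "real \<Rightarrow> real \<Rightarrow> real \<Rightarrow> real \<Rightarrow> real \<Rightarrow> real" where
  "initial_adjustment d D U u x = (if x \<le> d then D - x else if u \<le> x then U - x else 0)"

primrec band_seq ::
  "real \<Rightarrow> real \<Rightarrow> real \<Rightarrow> real \<Rightarrow> (real \<Rightarrow> real) \<Rightarrow> nat \<Rightarrow> ereal \<times> real \<times> real" where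
  "band_seq d D U u X 0 =
     (0, initial_adjustment d D U u (X 0), initial_adjustment d D U u (X 0))"
| "band_seq d D U u X (Suc n) =
     (let (T, _, c) = band_seq d D U u X n;
          T' = Inf {ereal t |t. T < ereal t \<and> X t + c \<in> {d, u}};
          z = X (real_of_ereal T') + c;
          \<xi> = (if T' = \<infinity> then 0 else if z = d then D - d else if z = u then U - u else 0)
      in (T', \<xi>, c + \<xi>))"

definition band_time ::
  "real \<Rightarrow> real \<Rightarrow> real \<Rightarrow> real \<Rightarrow> (real \<Rightarrow> real) \<Rightarrow> nat \<Rightarrow> ereal" where
  "band_time d D U u X n = fst (band_seq d D U u X n)"

definition band_adjustment ::
  "real \<Rightarrow> real \<Rightarrow> real \<Rightarrow> real \<Rightarrow> (real \<Rightarrow> real) \<Rightarrow> nat \<Rightarrow> real" where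
  "band_adjustment d D U u X n = fst (snd (band_seq d D U u X n))"

text \<open>
  The index sets of the sums are finite: on a bounded time interval a continuous path makes only
  finitely many moves from \<open>{D, U}\<close> to \<open>{d, u}\<close>.
\<close>

definition control_band_policy ::
  "real \<Rightarrow> real \<Rightarrow> (real \<Rightarrow> 'a \<Rightarrow> real) \<Rightarrow> real \<Rightarrow> real \<Rightarrow> real \<Rightarrow> real \<Rightarrow> real \<Rightarrow> 'a policy" where
  "control_band_policy \<mu> \<sigma> W d D U u x =
     ((\<lambda>t \<omega>. let X = (\<lambda>s. netput \<mu> \<sigma> W x s \<omega>) in
         \<Sum>n | band_time d D U u X n \<le> ereal t. max 0 (band_adjustment d D U u X n)),
      (\<lambda>t \<omega>. let X = (\<lambda>s. netput \<mu> \<sigma> W x s \<omega>) in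
         \<Sum>n | band_time d D U u X n \<le> ereal t. max 0 (- band_adjustment d D U u X n)))"

end

theory Submission
  imports Defs "HOL-Real_Asymp.Real_Asymp"
begin

text \<open>
  Put \<open>\<gamma> = \<mu> * A\<close> and let \<open>f\<close> be an antiderivative of \<open>g\<close> clipped to \<open>- k\<close> below \<open>d\<close> and to \<open>l\<close>
  above \<open>u\<close>. Write \<open>\<Gamma> f = \<mu> * f' + \<sigma>\<^sup>2 / 2 * f''\<close> for the generator of the netput. The equation
  satisfied by \<open>g\<close> gives \<open>\<Gamma> f + h = \<gamma>\<close> on \<open>[d, u]\<close>; since \<open>g\<close> decreases through \<open>d\<close> and \<open>u\<close> and
  \<open>h\<close> grows away from \<open>a\<close>, also \<open>\<Gamma> f + h \<ge> \<gamma>\<close> outside (\<open>generator_inside\<close>, \<open>generator_ineq\<close>).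
  The area conditions and the shape of \<open>g\<close> say that no jump changes \<open>f\<close> by less than minus its cost,
  and that the jumps \<open>d \<rightarrow> D\<close> and \<open>u \<rightarrow> U\<close> change it by exactly minus their cost (\<open>raise_costs\<close>,
  \<open>lower_costs\<close>). Hence, if \<open>f\<close> is expanded along an inventory process, the expected cost up to time
  \<open>t\<close> is at least \<open>\<gamma> * t + f x - E (f (Z t))\<close>, while for the band policy it is at most \<open>\<gamma> * t\<close> plus a
  constant. The optimal average cost is therefore \<open>\<gamma>\<close>.

  The expansion needs no stochastic integral. On a grid of mesh \<open>t / m\<close> the increment of \<open>f (Z)\<close> over a
  grid interval is split into the part due to the netput, whose expectation is given by Dynkin's
  formula for the Gaussian kernel (\<open>dynkin_heat\<close>, \<open>dynkin_increment\<close>), and the part due to the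
  adjustments. The formula evaluates \<open>\<Gamma> f\<close> along the path frozen at the left end point plus the
  netput; this differs from \<open>Z\<close> only on intervals that contain an adjustment. As \<open>\<Gamma> f\<close> is bounded, the
  total error is at most a constant times \<open>(t / m) * E (N t)\<close>, which vanishes as \<open>m \<rightarrow> \<infinity>\<close>. This
  is \<open>discrete_ito\<close>.

  For an arbitrary feasible policy the adjustment part is bounded below on every grid
  (\<open>jump_sum_ge\<close>), which gives \<open>expected_cost_ge\<close>. If the average cost were below \<open>\<gamma>\<close>, then
  \<open>E (f (Z t))\<close> would grow at least linearly, hence so would \<open>E (h (Z t))\<close> because \<open>f \<le> c1 + c2 * h\<close>, and
  the holding cost would grow quadratically (\<open>average_cost_ge\<close>).

  For the band policy the integrability of the number of adjustments is part of the claim. The policy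
  that stops after \<open>N\<close> adjustments is trivially feasible, and its paths make the grid sums converge
  to the exact jump costs (\<open>truncated_balance\<close>). Since \<open>f\<close> is bounded below, the resulting bound on
  the expected cost of \<open>N\<close> adjustments survives the limit \<open>N \<rightarrow> \<infinity>\<close> (\<open>all_stages_bound\<close>), and
  yields both feasibility (\<open>feasible_band\<close>) and the upper bound for the cost (\<open>band_cost_le\<close>).
\<close>

section \<open>Gaussian smoothing and Dynkin's formula\<close>

lemma integrable_std_normal_abs: "integrable std_normal_distribution (\<lambda>x. \<bar>x\<bar>)"
  using integrable_norm[OF integrable_std_normal_distribution_moment[of 1]] by simp

text \<open>
  Functions whose derivative is bounded and Lipschitz, with a second derivative off a finite set. This
  is the regularity of an antiderivative of a clipped smooth function.
\<close>

locale test_function =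
  fixes f p q :: "real \<Rightarrow> real" and P Q :: real and S :: "real set"
  assumes f_deriv: "\<And>x. (f has_real_derivative p x) (at x)"
    and p_cont: "continuous_on UNIV p"
    and p_bound: "\<And>x. \<bar>p x\<bar> \<le> P"
    and finite_S: "finite S"
    and p_deriv: "\<And>x. x \<notin> S \<Longrightarrow> (p has_real_derivative q x) (at x)"
    and q_bound: "\<And>x. \<bar>q x\<bar> \<le> Q"
    and q_meas [measurable]: "q \<in> borel_measurable borel"
begin

lemma P_nonneg: "0 \<le> P" using p_bound[of 0] by linarith

lemma f_cont: "continuous_on UNIV f"
  using f_deriv by (meson DERIV_continuous continuous_at_imp_continuous_on)

lemma f_meas [measurable]: "f \<in> borel_measurable borel"
  using f_cont by (rule borel_measurable_continuous_onI)

lemma p_meas [measurable]: "p \<in> borel_measurable borel"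
  using p_cont by (rule borel_measurable_continuous_onI)

lemma f_lipschitz: "\<bar>f x - f y\<bar> \<le> P * \<bar>x - y\<bar>"
proof -
  have "norm (f x - f y) \<le> P * norm (x - y)"
    by (rule field_differentiable_bound[of UNIV f p])
       (use f_deriv p_bound in \<open>auto intro: DERIV_subset\<close>)
  then show ?thesis by simp
qed

lemma f_growth: "\<bar>f x\<bar> \<le> \<bar>f 0\<bar> + P * \<bar>x\<bar>"
  using f_lipschitz[of x 0] by simp

text \<open>
  Stein's identity: the derivative of \<open>\<phi> * p\<close> is \<open>\<phi> * (p' - x * p)\<close>, and \<open>\<phi> * p\<close> vanishes at infinity.
  The kinks of \<open>p\<close> do no harm because the fundamental theorem tolerates finitely many exceptions.
\<close>

lemma stein:
  assumes "s > 0"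
  shows "(\<integral>x. x * p (c + s * x) \<partial>std_normal_distribution)
         = s * (\<integral>x. q (c + s * x) \<partial>std_normal_distribution)"
proof -
  let ?\<phi> = std_normal_density
  define r where "r x = ?\<phi> x * (s * q (c + s * x) - x * p (c + s * x))" for x
  have [measurable]: "r \<in> borel_measurable borel" unfolding r_def by measurable
  have pq_int: "integrable std_normal_distribution (\<lambda>x. x * p (c + s * x))"
      "integrable std_normal_distribution (\<lambda>x. s * q (c + s * x))"
  proof -
    show "integrable std_normal_distribution (\<lambda>x. x * p (c + s * x))"
      by (rule Bochner_Integration.integrable_bound[OF integrable_mult_right[OF integrable_std_normal_abs, of P]])
         (auto simp: abs_mult mult.commute intro!: AE_I2 mult_left_mono order_trans[OF p_bound abs_ge_self])
    show "integrable std_normal_distribution (\<lambda>x. s * q (c + s * x))"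
      by (rule finite_measure.integrable_const_bound[where B = "s * Q"])
         (use \<open>s > 0\<close> q_bound in \<open>auto simp: abs_mult intro!: AE_I2 prob_space.finite_measure prob_space_normal_density\<close>)
  qed
  have r_int: "integrable lborel r"
  proof -
    have "integrable std_normal_distribution (\<lambda>x. s * q (c + s * x) - x * p (c + s * x))"
      using pq_int by auto
    then show ?thesis
      unfolding r_def by (subst (asm) integrable_density) auto
  qed
  have part: "(LINT x:{-real n..real n}|lborel. r x)
      = ?\<phi> (real n) * p (c + s * real n) - ?\<phi> (- real n) * p (c - s * real n)" for n
  proof -
    let ?S = "(\<lambda>x. (x - c) / s) ` S"
    have "(r has_integral (?\<phi> (real n) * p (c + s * real n) - ?\<phi> (- real n) * p (c + s * (- real n))))
            {- real n..real n}"
    proof (rule fundamental_theorem_of_calculus_interior_strong[of ?S])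
      show "finite ?S" using finite_S by simp
    next
      fix x assume "x \<in> {- real n<..<real n} - ?S"
      then have "c + s * x \<notin> S"
        using \<open>s > 0\<close> by (force simp: image_iff)
      then have 1: "(p has_real_derivative q (c + s * x)) (at (c + s * x))" by (rule p_deriv)
      have "((\<lambda>x. p (c + s * x)) has_real_derivative q (c + s * x) * s) (at x)"
        by (rule DERIV_chain2[where f = p and g = "\<lambda>x. c + s * x", OF 1])
           (auto intro!: derivative_eq_intros)
      moreover have "(?\<phi> has_real_derivative (- x * ?\<phi> x)) (at x)"
      proof -
        have "((\<lambda>x. C * exp (- x\<^sup>2 / 2)) has_real_derivative (- x * (C * exp (- x\<^sup>2 / 2)))) (at x)" for C :: real
          by (auto intro!: derivative_eq_intros)
        from this[of "1 / sqrt (2 * pi)"] show ?thesis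
          by (simp add: std_normal_density_def[abs_def])
      qed
      ultimately have "((\<lambda>x. ?\<phi> x * p (c + s * x)) has_real_derivative r x) (at x)"
        by (auto intro!: derivative_eq_intros simp: r_def algebra_simps)
      then show "((\<lambda>x. ?\<phi> x * p (c + s * x)) has_vector_derivative r x) (at x)"
        by (simp add: has_real_derivative_iff_has_vector_derivative)
    next
      show "continuous_on {- real n..real n} (\<lambda>x. ?\<phi> x * p (c + s * x))"
        unfolding std_normal_density_def
        by (intro continuous_intros continuous_on_compose2[OF p_cont]) auto
    qed simp
    moreover have "(r has_integral (LINT x:{-real n..real n}|lborel. r x)) {- real n..real n}"
    proof -
      have "set_integrable lborel {-real n..real n} r"
        unfolding set_integrable_def by (rule integrable_mult_indicator) (use r_int in auto)
      from set_borel_integral_eq_integral[OF this] show ?thesis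
        by (metis integrable_integral)
    qed
    ultimately show ?thesis
      by (auto dest: has_integral_unique)
  qed
  have "(\<lambda>n. LINT x:{-real n..real n}|lborel. r x) \<longlonglongrightarrow> (LINT x|lborel. r x)"
  proof -
    have "(\<lambda>n. LINT x|lborel. indicator {-real n..real n} x *\<^sub>R r x) \<longlonglongrightarrow> (LINT x|lborel. r x)"
    proof (rule integral_dominated_convergence[where w = "\<lambda>x. \<bar>r x\<bar>"])
      show "AE x in lborel. (\<lambda>n. indicator {- real n..real n} x *\<^sub>R r x) \<longlonglongrightarrow> r x"
      proof (rule AE_I2)
        fix x :: real
        obtain N where N: "\<bar>x\<bar> \<le> real N" using real_arch_simple by blast
        have "eventually (\<lambda>n. indicator {- real n..real n} x *\<^sub>R r x = r x) sequentially"
          using eventually_ge_at_top[of N]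
          by eventually_elim (use N in \<open>auto simp: indicator_def\<close>)
        then show "(\<lambda>n. indicator {- real n..real n} x *\<^sub>R r x) \<longlonglongrightarrow> r x"
          by (rule tendsto_eventually)
      qed
    qed (use r_int in \<open>auto simp: indicator_def\<close>)
    then show ?thesis by (simp add: set_lebesgue_integral_def)
  qed
  moreover have "(\<lambda>n. LINT x:{-real n..real n}|lborel. r x) \<longlonglongrightarrow> 0"
  proof -
    have even_density: "?\<phi> (- x) = ?\<phi> x" for x
      by (simp add: std_normal_density_def)
    have t: "(\<lambda>n. ?\<phi> (real n)) \<longlonglongrightarrow> 0"
      unfolding std_normal_density_def by real_asymp
    have "(\<lambda>n. ?\<phi> (real n) * p (c + s * real n)) \<longlonglongrightarrow> 0"
      by (rule tendsto_0_le[OF t, where K = P]) (auto simp: abs_mult mult.commute[of P] intro!: always_eventually mult_left_mono p_bound)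
    moreover have "(\<lambda>n. ?\<phi> (- real n) * p (c - s * real n)) \<longlonglongrightarrow> 0"
      by (rule tendsto_0_le[OF t, where K = P])
         (auto simp: abs_mult even_density mult.commute[of P] intro!: always_eventually mult_left_mono p_bound)
    ultimately show ?thesis
      unfolding part using tendsto_diff by fastforce
  qed
  ultimately have "(LINT x|lborel. r x) = 0"
    using LIMSEQ_unique by blast
  also have "(LINT x|lborel. r x)
    = (\<integral>x. s * q (c + s * x) - x * p (c + s * x) \<partial>std_normal_distribution)"
    unfolding r_def by (subst integral_density) auto
  finally show ?thesis
    using pq_int by simp
qed


lemma integral_inverse_sqrt:
  assumes "(v::real) > 0"
  shows "set_integrable lborel {0<..<v} (\<lambda>r. 1 / sqrt r)"
    and "(LINT r:{0<..<v}|lborel. 1 / sqrt r) = 2 * sqrt v"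
proof -
  have *: "((\<lambda>x. 2 * sqrt x) has_real_derivative 1 / sqrt x) (at x)" if "0 < x" for x :: real
    using that by (auto intro!: derivative_eq_intros simp: field_simps)
  have A: "((\<lambda>x::real. 2 * sqrt x) \<longlongrightarrow> 0) (at_right 0)"
    by (rule tendsto_eq_intros | simp)+
  have B: "((\<lambda>x::real. 2 * sqrt x) \<longlongrightarrow> 2 * sqrt v) (at_left v)"
    by (rule tendsto_eq_intros | simp)+
  have AB: "(((\<lambda>x::real. 2 * sqrt x) \<circ> real_of_ereal) \<longlongrightarrow> 0) (at_right (ereal 0))"
      "(((\<lambda>x::real. 2 * sqrt x) \<circ> real_of_ereal) \<longlongrightarrow> 2 * sqrt v) (at_left (ereal v))"
    unfolding ereal_tendsto_simps1 by (fact A B)+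
  have D: "((\<lambda>x. 2 * sqrt x) has_real_derivative 1 / sqrt x) (at x)"
      "isCont (\<lambda>x. 1 / sqrt x) x" if "ereal 0 < ereal x" for x
    using that * by (auto intro!: continuous_intros)
  note F = interval_integral_FTC_nonneg[where F = "\<lambda>x. 2 * sqrt x" and f = "\<lambda>x. 1 / sqrt x"
      and a = "ereal 0" and b = "ereal v", OF _ D _ AB]
  show "set_integrable lborel {0<..<v} (\<lambda>r. 1 / sqrt r)"
    using F(1) assms by simp
  have "(LBINT r=ereal 0..ereal v. 1 / sqrt r) = 2 * sqrt v - 0"
    by (rule F(2)) (use assms in auto)
  then show "(LINT r:{0<..<v}|lborel. 1 / sqrt r) = 2 * sqrt v"
    using assms by (simp add: interval_lebesgue_integral_def)
qed

text \<open>
  The fundamental theorem along \<open>r \<mapsto> z + m * r + \<sigma> * sqrt r * x\<close>. For standard normal \<open>x\<close> the end point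
  has the law of the netput at time \<open>v\<close>. The singularity \<open>1 / sqrt r\<close> at \<open>0\<close> is integrable, and the bound,
  linear in \<open>\<bar>x\<bar>\<close>, justifies exchanging the integrals over \<open>r\<close> and \<open>x\<close>.
\<close>

lemma path_FTC:
  fixes z m x :: real
  assumes "v > 0" "\<sigma> > 0"
  defines "h \<equiv> \<lambda>r. p (z + m * r + \<sigma> * sqrt r * x) * (m + \<sigma> * x / (2 * sqrt r))"
  shows "set_integrable lborel {0<..<v} h"
    and "(LINT r:{0<..<v}|lborel. \<bar>h r\<bar>) \<le> P * (\<bar>m\<bar> * v + \<sigma> * \<bar>x\<bar> * sqrt v)"
    and "(LINT r:{0<..<v}|lborel. h r) = f (z + m * v + \<sigma> * sqrt v * x) - f z"
proof -
  let ?w = "\<lambda>r. P * (\<bar>m\<bar> + \<sigma> * \<bar>x\<bar> / 2 * (1 / sqrt r))"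
  have const: "set_integrable lborel {0<..<v} (\<lambda>_. C)" for C :: real
    using assms(1) by (simp add: set_integrable_def integrable_real_indicator)
  have w: "set_integrable lborel {0<..<v} ?w"
    by (intro set_integrable_mult_right set_integral_add(1) integral_inverse_sqrt(1) assms const)
  have hw: "\<bar>h r\<bar> \<le> ?w r" if "r \<in> {0<..<v}" for r
  proof -
    have "\<bar>m + \<sigma> * x / (2 * sqrt r)\<bar> \<le> \<bar>m\<bar> + \<bar>\<sigma> * x / (2 * sqrt r)\<bar>" by linarith
    also have "\<bar>\<sigma> * x / (2 * sqrt r)\<bar> = \<sigma> * \<bar>x\<bar> / 2 * (1 / sqrt r)"
      using that assms by (simp add: abs_mult)
    finally show ?thesis
      unfolding abs_mult h_def by (intro mult_mono p_bound) (use P_nonneg in auto)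
  qed
  show hi: "set_integrable lborel {0<..<v} h"
  proof (rule set_integrable_bound[OF w])
    show "set_borel_measurable lborel {0<..<v} h"
      unfolding set_borel_measurable_def h_def by measurable
    show "AE r in lborel. r \<in> {0<..<v} \<longrightarrow> norm (h r) \<le> norm (?w r)"
      using hw by (intro AE_I2 impI) (simp only: real_norm_def, blast intro: order_trans abs_ge_self)
  qed
  have "(LINT r:{0<..<v}|lborel. \<bar>h r\<bar>) \<le> (LINT r:{0<..<v}|lborel. ?w r)"
    by (rule set_integral_mono[OF set_integrable_abs[OF hi] w hw])
  also have "\<dots> = P * (\<bar>m\<bar> * v + \<sigma> * \<bar>x\<bar> / 2 * (2 * sqrt v))"
  proof -
    have "(LINT r:{0<..<v}|lborel. (\<bar>m\<bar> + \<sigma> * \<bar>x\<bar> / 2 * (1 / sqrt r)))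
        = (LINT r:{0<..<v}|lborel. \<bar>m\<bar>) + (LINT r:{0<..<v}|lborel. \<sigma> * \<bar>x\<bar> / 2 * (1 / sqrt r))"
      by (intro set_integral_add(2) const set_integrable_mult_right integral_inverse_sqrt(1) assms(1))
    also have "(LINT r:{0<..<v}|lborel. \<sigma> * \<bar>x\<bar> / 2 * (1 / sqrt r)) = \<sigma> * \<bar>x\<bar> / 2 * (2 * sqrt v)"
      by (simp only: set_integral_mult_right integral_inverse_sqrt(2)[OF assms(1)])
    also have "(LINT r:{0<..<v}|lborel. \<bar>m\<bar>) = \<bar>m\<bar> * v"
      using assms by (simp add: set_lebesgue_integral_def mult.commute)
    finally show ?thesis by simp
  qed
  finally show "(LINT r:{0<..<v}|lborel. \<bar>h r\<bar>) \<le> P * (\<bar>m\<bar> * v + \<sigma> * \<bar>x\<bar> * sqrt v)" by (simp add: mult.assoc)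
  let ?F = "\<lambda>r. f (z + m * r + \<sigma> * sqrt r * x)"
  have cont: "continuous_on UNIV ?F"
    by (intro continuous_on_compose2[OF f_cont] continuous_intros) auto
  have "(LBINT r=ereal 0..ereal v. h r) = ?F v - ?F 0"
  proof (rule interval_integral_FTC_integrable)
    fix r assume "ereal 0 < ereal r" "ereal r < ereal v"
    then have r: "0 < r" by simp
    have "((\<lambda>r. z + m * r + \<sigma> * sqrt r * x) has_real_derivative (m + \<sigma> * x / (2 * sqrt r))) (at r)"
      using r by (auto intro!: derivative_eq_intros simp: field_simps)
    from DERIV_chain2[where f = f, OF f_deriv this]
    show "(?F has_vector_derivative h r) (at r)"
      by (simp add: has_real_derivative_iff_has_vector_derivative h_def)
    have pc: "isCont p y" for y using p_cont by (simp add: continuous_on_eq_continuous_at)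
    have "isCont (\<lambda>r. p (z + m * r + \<sigma> * sqrt r * x)) r"
      by (rule isCont_o2[OF _ pc]) (intro continuous_intros)
    moreover have "isCont (\<lambda>r. m + \<sigma> * x / (2 * sqrt r)) r"
      using r by (intro continuous_intros) auto
    ultimately show "isCont h r"
      unfolding h_def by (rule isCont_mult)
  next
    have c: "isCont ?F r" for r using cont by (simp add: continuous_on_eq_continuous_at)
    have c: "(?F \<longlongrightarrow> ?F r) (at r within T)" for r T
      using c[of r] unfolding isCont_def by (rule tendsto_within_subset) auto
    show "((?F \<circ> real_of_ereal) \<longlongrightarrow> ?F 0) (at_right (ereal 0))"
        "((?F \<circ> real_of_ereal) \<longlongrightarrow> ?F v) (at_left (ereal v))"
      unfolding ereal_tendsto_simps1 by (fact c)+
  qed (use assms hi in auto)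
  then show "(LINT r:{0<..<v}|lborel. h r) = f (z + m * v + \<sigma> * sqrt v * x) - f z"
    using assms by (simp add: interval_lebesgue_integral_def)
qed

end

text \<open>Mean of \<open>\<phi>\<close> at time \<open>v\<close> for a Brownian motion with drift \<open>m\<close> and variance \<open>\<sigma>\<^sup>2\<close> started at \<open>z\<close>.\<close>

definition heat :: "real \<Rightarrow> real \<Rightarrow> (real \<Rightarrow> real) \<Rightarrow> real \<Rightarrow> real \<Rightarrow> real" where
  "heat m \<sigma> \<phi> v z = (\<integral>x. \<phi> (z + m * v + \<sigma> * sqrt v * x) \<partial>std_normal_distribution)"

definition generator :: "real \<Rightarrow> real \<Rightarrow> (real \<Rightarrow> real) \<Rightarrow> (real \<Rightarrow> real) \<Rightarrow> real \<Rightarrow> real" where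
  "generator m \<sigma> p q x = m * p x + \<sigma>\<^sup>2 / 2 * q x"

context test_function begin

lemma integrable_f_normal: "integrable std_normal_distribution (\<lambda>x. f (c + s * x))"
proof (rule Bochner_Integration.integrable_bound)
  show "integrable std_normal_distribution (\<lambda>x. \<bar>f c\<bar> + P * (\<bar>s\<bar> * \<bar>x\<bar>))"
    using integrable_std_normal_abs
    by (intro Bochner_Integration.integrable_add integrable_mult_right)
       (auto intro!: finite_measure.integrable_const prob_space.finite_measure prob_space_normal_density)
  show "AE x in std_normal_distribution. norm (f (c + s * x)) \<le> norm (\<bar>f c\<bar> + P * (\<bar>s\<bar> * \<bar>x\<bar>))"
  proof (rule AE_I2)
    fix x
    have "\<bar>f (c + s * x) - f c\<bar> \<le> P * (\<bar>s\<bar> * \<bar>x\<bar>)"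
      using f_lipschitz[of "c + s * x" c] by (simp add: abs_mult)
    then show "norm (f (c + s * x)) \<le> norm (\<bar>f c\<bar> + P * (\<bar>s\<bar> * \<bar>x\<bar>))"
      by simp
  qed
qed simp

text \<open>
  Dynkin's formula, by integrating \<open>path_FTC\<close> over \<open>x\<close>: Stein's identity turns the factor
  \<open>\<sigma> * x / (2 * sqrt r)\<close> in front of \<open>f'\<close> into \<open>\<sigma>\<^sup>2 / 2\<close> in front of \<open>f''\<close>.
\<close>

lemma dynkin_heat:
  assumes "v \<ge> 0" "\<sigma> > 0"
  shows "heat m \<sigma> f v z - f z = (LINT r:{0..v}|lborel. heat m \<sigma> (generator m \<sigma> p q) r z)"
proof (cases "v = 0")
  case True
  interpret N: prob_space std_normal_distribution by (rule prob_space_normal_density) simp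
  have "(LINT r:{0..0::real}|lborel. G r) = 0" for G :: "real \<Rightarrow> real"
    unfolding set_lebesgue_integral_def
    by (rule integral_eq_zero_AE) (use AE_lborel_singleton[of 0] in \<open>eventually_elim, simp\<close>)
  then show ?thesis using True by (simp add: heat_def N.prob_space[simplified])
next
  case False
  with assms have v: "v > 0" by simp
  let ?N = std_normal_distribution
  interpret N: prob_space ?N by (rule prob_space_normal_density) simp
  interpret pair_sigma_finite ?N lborel ..
  define h where "h x r = indicator {0<..<v} r *\<^sub>R (p (z + m * r + \<sigma> * sqrt r * x) * (m + \<sigma> * x / (2 * sqrt r)))" for x r
  have [measurable]: "case_prod h \<in> borel_measurable (?N \<Otimes>\<^sub>M lborel)"
    unfolding h_def by measurable
  note path = path_FTC[OF v assms(2), of z m]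
  have inner: "integrable lborel (h x)" 
      "integral\<^sup>L lborel (h x) = f (z + m * v + \<sigma> * sqrt v * x) - f z" for x
    using path(1,3)[of x] by (simp_all add: h_def[abs_def] set_integrable_def set_lebesgue_integral_def)
  have int: "integrable (?N \<Otimes>\<^sub>M lborel) (case_prod h)"
  proof (rule Fubini_integrable)
    show "integrable ?N (\<lambda>x. LINT r|lborel. norm (case_prod h (x, r)))"
    proof (rule Bochner_Integration.integrable_bound)
      show "integrable ?N (\<lambda>x. P * (\<bar>m\<bar> * v + \<sigma> * \<bar>x\<bar> * sqrt v))"
        using integrable_std_normal_abs by auto
      show "AE x in ?N. norm (LINT r|lborel. norm (case_prod h (x, r))) \<le> norm (P * (\<bar>m\<bar> * v + \<sigma> * \<bar>x\<bar> * sqrt v))"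
      proof (rule AE_I2)
        fix x
        have "(LINT r|lborel. norm (case_prod h (x, r))) \<le> P * (\<bar>m\<bar> * v + \<sigma> * \<bar>x\<bar> * sqrt v)"
          using path(2)[of x] by (simp add: h_def set_lebesgue_integral_def abs_mult)
        then show "norm (LINT r|lborel. norm (case_prod h (x, r))) \<le> norm (P * (\<bar>m\<bar> * v + \<sigma> * \<bar>x\<bar> * sqrt v))"
          by (simp add: abs_of_nonneg)
      qed
    qed measurable
  qed (use inner in auto)
  have "heat m \<sigma> f v z - f z = (\<integral>x. f (z + m * v + \<sigma> * sqrt v * x) - f z \<partial>?N)"
    unfolding heat_def by (subst Bochner_Integration.integral_diff) (auto simp: integrable_f_normal N.prob_space[simplified])
  also have "\<dots> = (\<integral>x. (\<integral>r. h x r \<partial>lborel) \<partial>?N)"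
    by (simp add: inner)
  also have "\<dots> = (\<integral>r. (\<integral>x. h x r \<partial>?N) \<partial>lborel)"
    using Fubini_integral[OF int] by simp
  also have "\<dots> = (LINT r:{0..v}|lborel. heat m \<sigma> (generator m \<sigma> p q) r z)"
    unfolding set_lebesgue_integral_def
  proof (rule integral_cong_AE)
    show "AE r in lborel. (\<integral>x. h x r \<partial>?N) = indicator {0..v} r *\<^sub>R heat m \<sigma> (generator m \<sigma> p q) r z"
      using AE_lborel_singleton[of 0] AE_lborel_singleton[of v]
    proof eventually_elim
      fix r assume r: "r \<noteq> 0" "r \<noteq> v"
      show "(\<integral>x. h x r \<partial>?N) = indicator {0..v} r *\<^sub>R heat m \<sigma> (generator m \<sigma> p q) r z"
      proof (cases "0 < r \<and> r < v")
        case False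
        then show ?thesis using r by (auto simp: h_def indicator_def)
      next
        case True
        let ?c = "z + m * r" and ?s = "\<sigma> * sqrt r"
        have s: "?s > 0" using True assms by simp
        have ip: "integrable ?N (\<lambda>x. p (?c + ?s * x))" "integrable ?N (\<lambda>x. q (?c + ?s * x))"
          by (rule N.integrable_const_bound[where B = P], use p_bound in auto)
             (rule N.integrable_const_bound[where B = Q], use q_bound in auto)
        have ix: "integrable ?N (\<lambda>x. x * p (?c + ?s * x))"
          by (rule Bochner_Integration.integrable_bound[OF integrable_mult_right[OF integrable_std_normal_abs, of P]])
             (auto simp: abs_mult mult.commute intro!: AE_I2 mult_left_mono order_trans[OF p_bound abs_ge_self])
        have "(\<integral>x. h x r \<partial>?N) = (\<integral>x. m * p (?c + ?s * x) + \<sigma> / (2 * sqrt r) * (x * p (?c + ?s * x)) \<partial>?N)"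
          using True by (intro Bochner_Integration.integral_cong) (auto simp: h_def algebra_simps)
        also have "\<dots> = m * (\<integral>x. p (?c + ?s * x) \<partial>?N) + \<sigma> / (2 * sqrt r) * (\<integral>x. x * p (?c + ?s * x) \<partial>?N)"
          using ip ix by simp
        also have "\<dots> = m * (\<integral>x. p (?c + ?s * x) \<partial>?N) + \<sigma>\<^sup>2 / 2 * (\<integral>x. q (?c + ?s * x) \<partial>?N)"
          unfolding stein[OF s] using True by (simp add: power2_eq_square field_simps)
        also have "\<dots> = heat m \<sigma> (generator m \<sigma> p q) r z"
          unfolding heat_def generator_def using ip by simp
        finally show ?thesis using True by simp
      qed
    qed
  qed (simp_all add: heat_def generator_def)
  finally show ?thesis .
qed

end

section \<open>Brownian netput\<close>

text \<open>
  A right-continuous process is the limit of its values at the grid times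
  \<open>(\<lfloor>(n + 1) * t\<rfloor> + 1) / (n + 1)\<close>, which exceed \<open>t\<close> and take countably many values. Time is cut off at
  \<open>0\<close> by \<open>max 0\<close>, because nothing is known about the process at negative times.
\<close>

lemma right_continuous_joint_measurable:
  fixes Y :: "real \<Rightarrow> 'a \<Rightarrow> real"
  assumes meas: "\<And>t. 0 \<le> t \<Longrightarrow> Y t \<in> borel_measurable M"
    and rc: "\<And>t \<omega>. \<omega> \<in> space M \<Longrightarrow> 0 \<le> t \<Longrightarrow> continuous (at_right t) (\<lambda>s. Y s \<omega>)"
  shows "(\<lambda>(t, \<omega>). Y (max 0 t) \<omega>) \<in> borel_measurable (lborel \<Otimes>\<^sub>M M)"
proof -
  define r where "r n t = (of_int \<lfloor>real (Suc n) * max 0 t\<rfloor> + 1) / real (Suc n)" for n and t :: real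
  define k where "k n t = nat \<lfloor>real (Suc n) * max 0 t\<rfloor>" for n and t :: real
  have r_eq: "r n t = (real (k n t) + 1) / real (Suc n)" for n t
    by (simp add: r_def k_def)
  have r_gt: "r n t > max 0 t" for n t
  proof -
    have "real (Suc n) * max 0 t < of_int \<lfloor>real (Suc n) * max 0 t\<rfloor> + 1" by linarith
    then show ?thesis unfolding r_def by (subst pos_less_divide_eq) (simp_all add: mult.commute del: of_nat_Suc)
  qed
  have r_le: "r n t \<le> max 0 t + 1 / real (Suc n)" for n t
  proof -
    have "of_int \<lfloor>real (Suc n) * max 0 t\<rfloor> + 1 \<le> real (Suc n) * max 0 t + 1" by linarith
    then show ?thesis unfolding r_def
      by (subst pos_divide_le_eq) (simp_all add: distrib_left mult.commute del: of_nat_Suc)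
  qed
  have r_lim: "filterlim (\<lambda>n. r n t) (at_right (max 0 t)) sequentially" for t
  proof (rule filterlim_at[THEN iffD2], intro conjI)
    show "\<forall>\<^sub>F n in sequentially. r n t \<in> {max 0 t<..} \<and> r n t \<noteq> max 0 t"
      using r_gt[of t] by (auto simp: less_imp_neq[THEN not_sym])
    show "(\<lambda>n. r n t) \<longlonglongrightarrow> max 0 t"
    proof (rule tendsto_sandwich[OF always_eventually always_eventually])
      show "\<forall>n. max 0 t \<le> r n t" using r_gt less_imp_le by blast
      show "\<forall>n. r n t \<le> max 0 t + 1 / real (Suc n)" using r_le by blast
      have "(\<lambda>n. max 0 t + 1 / real (Suc n)) \<longlonglongrightarrow> max 0 t + 0"
        by (intro tendsto_add tendsto_const LIMSEQ_Suc lim_1_over_n)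
      then show "(\<lambda>n. max 0 t + 1 / real (Suc n)) \<longlonglongrightarrow> max 0 t" by simp
    qed simp
  qed
  show ?thesis
  proof (rule borel_measurable_LIMSEQ_real)
    fix z :: "real \<times> 'a" assume "z \<in> space (lborel \<Otimes>\<^sub>M M)"
    then obtain t \<omega> where z: "z = (t, \<omega>)" "\<omega> \<in> space M" by (auto simp: space_pair_measure)
    have "((\<lambda>s. Y s \<omega>) \<longlongrightarrow> Y (max 0 t) \<omega>) (at_right (max 0 t))"
      using rc[OF z(2), of "max 0 t"] by (simp add: continuous_within)
    from filterlim_compose[OF this r_lim]
    show "(\<lambda>n. case z of (t, \<omega>) \<Rightarrow> Y (r n t) \<omega>) \<longlonglongrightarrow> (case z of (t, \<omega>) \<Rightarrow> Y (max 0 t) \<omega>)"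
      using z by simp
  next
    fix n
    have "(\<lambda>z. (\<lambda>j z. Y ((real j + 1) / real (Suc n)) (snd z)) (k n (fst z)) z)
        \<in> borel_measurable ((lborel :: real measure) \<Otimes>\<^sub>M M)"
    proof (rule measurable_compose_countable[where f = "\<lambda>j z. Y ((real j + 1) / real (Suc n)) (snd z)"
          and g = "\<lambda>z. k n (fst z)"])
      fix j
      have [measurable]: "Y ((real j + 1) / real (Suc n)) \<in> borel_measurable M"
        by (rule meas) simp
      show "(\<lambda>z. Y ((real j + 1) / real (Suc n)) (snd z)) \<in> borel_measurable ((lborel :: real measure) \<Otimes>\<^sub>M M)"
        by measurable
      show "(\<lambda>z. k n (fst z)) \<in> (lborel :: real measure) \<Otimes>\<^sub>M M \<rightarrow>\<^sub>M count_space UNIV"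
        unfolding k_def by measurable
    qed
    then show "(\<lambda>z. case z of (t, \<omega>) \<Rightarrow> Y (r n t) \<omega>) \<in> borel_measurable (lborel \<Otimes>\<^sub>M M)"
      unfolding r_eq by (simp add: case_prod_beta)
  qed
qed

lemma (in prob_space) Fubini_time:
  fixes H :: "real \<Rightarrow> 'a \<Rightarrow> real"
  assumes [measurable]: "case_prod H \<in> borel_measurable (lborel \<Otimes>\<^sub>M M)"
    and bound: "\<And>r \<omega>. \<bar>H r \<omega>\<bar> \<le> B"
  shows "integrable M (\<lambda>\<omega>. LINT r:{a..b}|lborel. H r \<omega>)"
    and "expectation (\<lambda>\<omega>. LINT r:{a..b}|lborel. H r \<omega>) = (LINT r:{a..b}|lborel. expectation (H r))"
    and "\<omega> \<in> space M \<Longrightarrow> set_integrable lborel {a..b} (\<lambda>r. H r \<omega>)"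
proof -
  interpret pair_sigma_finite lborel M ..
  have B: "0 \<le> B" using bound[of 0 undefined] by linarith
  have sec: "set_integrable lborel {a..b} (\<lambda>r. H r \<omega>)" if "\<omega> \<in> space M" for \<omega>
  proof (rule set_integrable_bound[where f = "\<lambda>_. B"])
    show "set_integrable lborel {a..b} (\<lambda>_. B)"
      by (intro borel_integrable_atLeastAtMost' continuous_intros)
    show "set_borel_measurable lborel {a..b} (\<lambda>r. H r \<omega>)"
      unfolding set_borel_measurable_def using that by measurable
    show "AE x in lborel. x \<in> {a..b} \<longrightarrow> norm (H x \<omega>) \<le> norm B"
      using bound B by (intro AE_I2) simp
  qed
  then show "\<omega> \<in> space M \<Longrightarrow> set_integrable lborel {a..b} (\<lambda>r. H r \<omega>)" .
  let ?h = "\<lambda>r \<omega>. indicator {a..b} r *\<^sub>R H r \<omega>"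
  have int: "integrable (lborel \<Otimes>\<^sub>M M) (\<lambda>(r, \<omega>). ?h r \<omega>)"
  proof (rule Fubini_integrable)
    show "integrable lborel (\<lambda>r. LINT \<omega>|M. norm (case (r, \<omega>) of (r, \<omega>) \<Rightarrow> ?h r \<omega>))"
    proof (rule Bochner_Integration.integrable_bound)
      show "integrable lborel (\<lambda>r. indicator {a..b} r * B :: real)"
        using borel_integrable_atLeastAtMost'[of a b "\<lambda>_. B"] by (simp add: set_integrable_def)
      show "AE r in lborel. norm (LINT \<omega>|M. norm (case (r, \<omega>) of (r, \<omega>) \<Rightarrow> ?h r \<omega>)) \<le> norm (indicator {a..b} r * B)"
      proof (rule AE_I2)
        fix r
        have "(LINT \<omega>|M. norm (?h r \<omega>)) \<le> (LINT \<omega>|M. indicator {a..b} r * B)"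
          by (rule integral_mono') (use bound B in \<open>auto simp: indicator_def\<close>)
        also have "\<dots> = indicator {a..b} r * B" by (simp add: prob_space)
        finally show "norm (LINT \<omega>|M. norm (case (r, \<omega>) of (r, \<omega>) \<Rightarrow> ?h r \<omega>)) \<le> norm (indicator {a..b} r * B)"
          using B by simp
      qed
    qed measurable
    show "AE r in lborel. integrable M (\<lambda>\<omega>. case (r, \<omega>) of (r, \<omega>) \<Rightarrow> ?h r \<omega>)"
    proof (rule AE_I2)
      fix r :: real
      show "integrable M (\<lambda>\<omega>. case (r, \<omega>) of (r, \<omega>) \<Rightarrow> ?h r \<omega>)"
        by (rule integrable_const_bound[where B = B]) (use bound B in \<open>auto simp: indicator_def\<close>)
    qed
  qed measurable
  show "integrable M (\<lambda>\<omega>. LINT r:{a..b}|lborel. H r \<omega>)"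
    using integrable_snd[OF int] by (simp add: set_lebesgue_integral_def)
  show "expectation (\<lambda>\<omega>. LINT r:{a..b}|lborel. H r \<omega>) = (LINT r:{a..b}|lborel. expectation (H r))"
    using Fubini_integral[OF int] by (simp add: set_lebesgue_integral_def)
qed

locale netput_space =
  fixes M :: "'a measure" and F :: "real \<Rightarrow> 'a measure" and W :: "real \<Rightarrow> 'a \<Rightarrow> real"
    and \<mu> \<sigma> :: real
  assumes filtered: "filtered_prob_space M F"
    and brownian: "standard_brownian_motion M F W"
    and \<sigma>_pos: "\<sigma> > 0"

sublocale netput_space \<subseteq> prob_space M
  using filtered by (simp add: filtered_prob_space_def)

context netput_space begin

lemma space_F [simp]: "space (F t) = space M"
  using filtered by (simp add: filtered_prob_space_def subalgebra_def)

lemma F_measurable_M: "Z \<in> borel_measurable (F t) \<Longrightarrow> Z \<in> borel_measurable M"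
  using filtered measurable_from_subalg[of M "F t" Z borel] by (simp add: filtered_prob_space_def)

lemma sets_F_mono: "s \<le> t \<Longrightarrow> sets (F s) \<subseteq> sets (F t)"
  using filtered by (auto simp: filtered_prob_space_def filtration_def)

lemma W_adapted: "0 \<le> t \<Longrightarrow> W t \<in> borel_measurable (F t)"
  using brownian by (simp add: standard_brownian_motion_def adapted_def)

lemma W_measurable: "0 \<le> t \<Longrightarrow> W t \<in> borel_measurable M"
  using W_adapted F_measurable_M by blast

lemma W_path: "\<omega> \<in> space M \<Longrightarrow> continuous_on {0..} (\<lambda>t. W t \<omega>)" "\<omega> \<in> space M \<Longrightarrow> W 0 \<omega> = 0"
  using brownian by (simp_all add: standard_brownian_motion_def)

lemma netput_adapted: "0 \<le> t \<Longrightarrow> netput \<mu> \<sigma> W x t \<in> borel_measurable (F t)"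
  using W_adapted[of t] unfolding netput_def[abs_def] by measurable

lemma netput_path: "\<omega> \<in> space M \<Longrightarrow> continuous_on {0..} (\<lambda>t. netput \<mu> \<sigma> W x t \<omega>)"
    "\<omega> \<in> space M \<Longrightarrow> netput \<mu> \<sigma> W x 0 \<omega> = x"
  unfolding netput_def by (intro continuous_intros W_path) (simp_all add: W_path)

lemma continuous_path_at_right:
  assumes "continuous_on {0..} y" "0 \<le> (t::real)"
  shows "continuous (at_right t) (y :: real \<Rightarrow> real)"
  using assms by (meson atLeast_iff continuous_on_eq_continuous_within continuous_within_subset
      greaterThan_iff less_imp_le order_trans subsetI)

lemma netput_joint [measurable]:
  "(\<lambda>(t, \<omega>). netput \<mu> \<sigma> W x (max 0 t) \<omega>) \<in> borel_measurable (lborel \<Otimes>\<^sub>M M)"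
  by (rule right_continuous_joint_measurable)
     (auto intro: F_measurable_M netput_adapted continuous_path_at_right netput_path)

lemma standardized_increment:
  assumes "0 \<le> s" "s < t"
  defines "\<zeta> \<equiv> \<lambda>\<omega>. (W t \<omega> - W s \<omega>) / sqrt (t - s)"
  shows "\<zeta> \<in> borel_measurable M" "distr M borel \<zeta> = std_normal_distribution"
    and "Z \<in> borel_measurable (F s) \<Longrightarrow> indep_var borel Z borel \<zeta>"
proof -
  have [measurable]: "W t \<in> borel_measurable M" "W s \<in> borel_measurable M"
    using assms by (auto intro: W_measurable)
  show m [measurable]: "\<zeta> \<in> borel_measurable M" unfolding \<zeta>_def by measurable
  have d: "distributed M lborel (\<lambda>\<omega>. W t \<omega> - W s \<omega>) (normal_density 0 (sqrt (t - s)))"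
    and ind: "indep_set (sets (F s))
          (sets (vimage_algebra (space M) (\<lambda>\<omega>. W t \<omega> - W s \<omega>) borel))"
    using brownian assms by (auto simp: standard_brownian_motion_def)
  have "distributed M lborel \<zeta> std_normal_density"
    using normal_standard_normal_convert[THEN iffD1, OF _ d] assms by (simp add: \<zeta>_def)
  then have "distr M lborel \<zeta> = std_normal_distribution"
    by (simp add: distributed_distr_eq_density)
  then show "distr M borel \<zeta> = std_normal_distribution"
    by (metis distr_cong sets_lborel)
  assume Z: "Z \<in> borel_measurable (F s)"
  show "indep_var borel Z borel \<zeta>"
    unfolding indep_var_eq
  proof (intro conjI)
    show "random_variable borel Z" using Z by (rule F_measurable_M)
    have "indep_sets (case_bool (sets (F s)) (sets (vimage_algebra (space M) (\<lambda>\<omega>. W t \<omega> - W s \<omega>) borel))) UNIV"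
      using ind by (simp add: indep_set_def)
    then show "indep_set (sigma_sets (space M) {Z -` A \<inter> space M |A. A \<in> sets borel})
        (sigma_sets (space M) {\<zeta> -` A \<inter> space M |A. A \<in> sets borel})"
      unfolding indep_set_def
    proof (rule indep_sets_mono)
      have 1: "sigma_sets (space M) {Z -` A \<inter> space M |A. A \<in> sets borel} \<subseteq> sets (F s)"
        using sets.sigma_sets_subset[of "{Z -` A \<inter> space M |A. A \<in> sets borel}" "F s"]
          measurable_sets[OF Z] by auto
      let ?V = "vimage_algebra (space M) (\<lambda>\<omega>. W t \<omega> - W s \<omega>) borel"
      have [measurable]: "(\<lambda>\<omega>. W t \<omega> - W s \<omega>) \<in> borel_measurable ?V"
        by (rule measurable_vimage_algebra1) simp
      have z: "\<zeta> \<in> borel_measurable ?V" unfolding \<zeta>_def by measurable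
      have 2: "sigma_sets (space M) {\<zeta> -` A \<inter> space M |A. A \<in> sets borel} \<subseteq> sets ?V"
        using sets.sigma_sets_subset[of "{\<zeta> -` A \<inter> space M |A. A \<in> sets borel}" ?V]
          measurable_sets[OF z] by auto
      show "case_bool (sigma_sets (space M) {Z -` A \<inter> space M |A. A \<in> sets borel})
         (sigma_sets (space M) {\<zeta> -` A \<inter> space M |A. A \<in> sets borel}) i
          \<subseteq> case_bool (sets (F s)) (sets ?V) i" for i
        using 1 2 by (cases i) auto
    qed simp
  qed (rule m)
qed

lemma integrable_W: "0 \<le> t \<Longrightarrow> integrable M (W t)"
proof (cases "t = 0")
  case True
  then show ?thesis
    by (subst Bochner_Integration.integrable_cong[where g = "\<lambda>_. 0"]) (auto simp: W_path)
next
  case False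
  assume "0 \<le> t"
  with False have t: "0 \<le> (0::real)" "0 < t" by auto
  let ?\<zeta> = "\<lambda>\<omega>. (W t \<omega> - W 0 \<omega>) / sqrt (t - 0)"
  have "integrable (distr M borel ?\<zeta>) (\<lambda>x. x)"
    unfolding standardized_increment(2)[OF t]
    using integrable_std_normal_distribution_moment[of 1] by simp
  then have "integrable M ?\<zeta>"
    using standardized_increment(1)[OF t] by (subst (asm) integrable_distr_eq) auto
  then have "integrable M (\<lambda>\<omega>. sqrt t * ?\<zeta> \<omega>)" by (rule integrable_mult_right)
  then show ?thesis
    by (rule Bochner_Integration.integrable_cong[THEN iffD1, rotated -1]) (use t in \<open>auto simp: W_path\<close>)
qed

lemma integrable_netput: "0 \<le> t \<Longrightarrow> integrable M (netput \<mu> \<sigma> W x t)"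
  unfolding netput_def[abs_def] using integrable_W by auto

text \<open>
  The increment is independent of \<open>F s\<close>, so the joint law of \<open>Z\<close> and the standardized increment is a
  product and the inner integral is \<open>heat\<close>.
\<close>

lemma expectation_increment:
  assumes st: "0 \<le> s" "s \<le> t" and Z: "Z \<in> borel_measurable (F s)"
    and [measurable]: "\<phi> \<in> borel_measurable borel"
    and int: "integrable M (\<lambda>\<omega>. \<phi> (Z \<omega> + (netput \<mu> \<sigma> W x t \<omega> - netput \<mu> \<sigma> W x s \<omega>)))"
  shows "expectation (\<lambda>\<omega>. \<phi> (Z \<omega> + (netput \<mu> \<sigma> W x t \<omega> - netput \<mu> \<sigma> W x s \<omega>)))
       = expectation (\<lambda>\<omega>. heat \<mu> \<sigma> \<phi> (t - s) (Z \<omega>))"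
proof (cases "s = t")
  case True
  interpret N: prob_space std_normal_distribution by (rule prob_space_normal_density) simp
  show ?thesis using True by (simp add: heat_def N.prob_space[simplified])
next
  case False
  with st have st: "0 \<le> s" "s < t" by auto
  let ?N = std_normal_distribution
  define \<zeta> where "\<zeta> = (\<lambda>\<omega>. (W t \<omega> - W s \<omega>) / sqrt (t - s))"
  note \<zeta> = standardized_increment[OF st, folded \<zeta>_def]
  have [measurable]: "\<zeta> \<in> borel_measurable M" "Z \<in> borel_measurable M"
    using \<zeta>(1) F_measurable_M[OF Z] by auto
  define G where "G = (\<lambda>(z, x). \<phi> (z + \<mu> * (t - s) + \<sigma> * sqrt (t - s) * x))"
  have [measurable]: "G \<in> borel_measurable (borel \<Otimes>\<^sub>M borel)" unfolding G_def by measurable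
  have eq: "\<phi> (Z \<omega> + (netput \<mu> \<sigma> W x t \<omega> - netput \<mu> \<sigma> W x s \<omega>)) = G (Z \<omega>, \<zeta> \<omega>)" for \<omega>
  proof -
    have "W t \<omega> - W s \<omega> = sqrt (t - s) * \<zeta> \<omega>" using st by (simp add: \<zeta>_def)
    then have "\<sigma> * W t \<omega> - \<sigma> * W s \<omega> = \<sigma> * sqrt (t - s) * \<zeta> \<omega>"
      by (simp add: right_diff_distrib[symmetric])
    then have "Z \<omega> + (netput \<mu> \<sigma> W x t \<omega> - netput \<mu> \<sigma> W x s \<omega>) = Z \<omega> + \<mu> * (t - s) + \<sigma> * sqrt (t - s) * \<zeta> \<omega>"
      by (simp add: netput_def algebra_simps)
    then show ?thesis by (simp only: G_def prod.case)
  qed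
  have law: "distr M (borel \<Otimes>\<^sub>M borel) (\<lambda>\<omega>. (Z \<omega>, \<zeta> \<omega>)) = distr M borel Z \<Otimes>\<^sub>M ?N"
    using \<zeta>(3)[OF Z] unfolding indep_var_distribution_eq \<zeta>(2) by simp
  interpret Z: prob_space "distr M borel Z" by (rule prob_space_distr) simp
  interpret N: prob_space ?N by (rule prob_space_normal_density) simp
  interpret pair_sigma_finite "distr M borel Z" ?N ..
  have "integrable (distr M (borel \<Otimes>\<^sub>M borel) (\<lambda>\<omega>. (Z \<omega>, \<zeta> \<omega>))) G"
    using int by (subst integrable_distr_eq) (auto simp: eq)
  then have G: "integrable (distr M borel Z \<Otimes>\<^sub>M ?N) G" by (simp add: law)
  have "expectation (\<lambda>\<omega>. G (Z \<omega>, \<zeta> \<omega>)) = integral\<^sup>L (distr M (borel \<Otimes>\<^sub>M borel) (\<lambda>\<omega>. (Z \<omega>, \<zeta> \<omega>))) G"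
    by (subst integral_distr) auto
  also have "\<dots> = (\<integral>z. (\<integral>x. G (z, x) \<partial>?N) \<partial>distr M borel Z)"
    unfolding law by (rule integral_fst'[OF G, symmetric])
  also have "\<dots> = expectation (\<lambda>\<omega>. heat \<mu> \<sigma> \<phi> (t - s) (Z \<omega>))"
    by (subst integral_distr) (auto simp: heat_def G_def)
  finally show ?thesis by (simp add: eq)
qed

end

locale netput_test = netput_space M F W \<mu> \<sigma> + test_function f p q P Q S
  for M :: "'a measure" and F W \<mu> \<sigma> f p q P Q S
begin

abbreviation "gen \<equiv> generator \<mu> \<sigma> p q"
definition "gen_bound = \<bar>\<mu>\<bar> * P + \<sigma>\<^sup>2 / 2 * Q"

lemma gen_meas [measurable]: "gen \<in> borel_measurable borel"
  unfolding generator_def[abs_def] by measurable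

lemma gen_bounded: "\<bar>gen x\<bar> \<le> gen_bound"
proof -
  have "\<bar>gen x\<bar> \<le> \<bar>\<mu>\<bar> * \<bar>p x\<bar> + \<sigma>\<^sup>2 / 2 * \<bar>q x\<bar>"
    unfolding generator_def by (rule order_trans[OF abs_triangle_ineq]) (simp add: abs_mult)
  also have "\<dots> \<le> gen_bound"
    unfolding gen_bound_def by (intro add_mono mult_left_mono p_bound q_bound) auto
  finally show ?thesis .
qed

lemma gen_bound_nonneg: "0 \<le> gen_bound" using gen_bounded[of 0] by linarith

lemma integrable_f: "integrable M Z \<Longrightarrow> integrable M (\<lambda>\<omega>. f (Z \<omega>))"
proof (rule Bochner_Integration.integrable_bound)
  assume [simp]: "integrable M Z"
  show "integrable M (\<lambda>\<omega>. \<bar>f 0\<bar> + P * \<bar>Z \<omega>\<bar>)" by simp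
  show "AE \<omega> in M. norm (f (Z \<omega>)) \<le> norm (\<bar>f 0\<bar> + P * \<bar>Z \<omega>\<bar>)"
    using f_growth by (intro AE_I2) (simp add: order_trans[OF _ abs_ge_self])
qed auto

text \<open>
  Dynkin's formula for a netput restarted at time \<open>s\<close> from a random level known at time \<open>s\<close>: the pointwise
  formula is integrated over that level, and each smoothed value is unfolded again by
  \<open>expectation_increment\<close>.
\<close>

lemma dynkin_increment:
  assumes st: "0 \<le> s" "s \<le> t" and Z: "Z \<in> borel_measurable (F s)" and iZ: "integrable M Z"
  shows "expectation (\<lambda>\<omega>. f (Z \<omega> + (netput \<mu> \<sigma> W x t \<omega> - netput \<mu> \<sigma> W x s \<omega>))) - expectation (\<lambda>\<omega>. f (Z \<omega>))
     = expectation (\<lambda>\<omega>. LINT r:{s..t}|lborel. gen (Z \<omega> + (netput \<mu> \<sigma> W x (max 0 r) \<omega> - netput \<mu> \<sigma> W x s \<omega>)))"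
proof -
  let ?X = "netput \<mu> \<sigma> W x"
  have [measurable]: "Z \<in> borel_measurable M" "?X s \<in> borel_measurable M"
    using F_measurable_M Z netput_adapted st by auto
  define H where "H r \<omega> = gen (Z \<omega> + (?X (max 0 r) \<omega> - ?X s \<omega>))" for r \<omega>
  have [measurable]: "case_prod H \<in> borel_measurable (lborel \<Otimes>\<^sub>M M)"
  proof -
    have "(\<lambda>z. gen (Z (snd z) + ((\<lambda>(t, \<omega>). ?X (max 0 t) \<omega>) z - ?X s (snd z)))) \<in> borel_measurable (lborel \<Otimes>\<^sub>M M)"
      by measurable
    then show ?thesis by (simp add: H_def[abs_def] case_prod_beta)
  qed
  have Hb: "\<bar>H r \<omega>\<bar> \<le> gen_bound" for r \<omega> unfolding H_def by (rule gen_bounded)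
  interpret N: prob_space std_normal_distribution by (rule prob_space_normal_density) simp
  have hm: "(\<lambda>(r, \<omega>). heat \<mu> \<sigma> gen r (Z \<omega>)) \<in> borel_measurable (lborel \<Otimes>\<^sub>M M)"
    unfolding heat_def by measurable
  have hb: "\<bar>heat \<mu> \<sigma> gen r z\<bar> \<le> gen_bound" for r z
  proof -
    have i: "integrable std_normal_distribution (\<lambda>x. gen (z + \<mu> * r + \<sigma> * sqrt r * x))"
      by (rule N.integrable_const_bound[where B = gen_bound]) (use gen_bounded in auto)
    have "\<bar>heat \<mu> \<sigma> gen r z\<bar> \<le> (\<integral>x. \<bar>gen (z + \<mu> * r + \<sigma> * sqrt r * x)\<bar> \<partial>std_normal_distribution)"
      unfolding heat_def by (rule integral_abs_bound)
    also have "\<dots> \<le> (\<integral>x. gen_bound \<partial>std_normal_distribution)"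
      using i by (intro integral_mono gen_bounded) auto
    finally show ?thesis by (simp add: N.prob_space[simplified])
  qed
  have iI: "integrable M (\<lambda>\<omega>. f (Z \<omega> + (?X t \<omega> - ?X s \<omega>)))"
    using st iZ by (intro integrable_f Bochner_Integration.integrable_add Bochner_Integration.integrable_diff integrable_netput) auto
  have ih: "integrable M (\<lambda>\<omega>. LINT r:{0..t - s}|lborel. heat \<mu> \<sigma> gen r (Z \<omega>))"
    using Fubini_time(1)[OF hm hb] by simp
  have "expectation (\<lambda>\<omega>. f (Z \<omega> + (?X t \<omega> - ?X s \<omega>))) = expectation (\<lambda>\<omega>. heat \<mu> \<sigma> f (t - s) (Z \<omega>))"
    by (rule expectation_increment[OF st Z f_meas iI])
  also have "\<dots> = expectation (\<lambda>\<omega>. f (Z \<omega>) + (LINT r:{0..t - s}|lborel. heat \<mu> \<sigma> gen r (Z \<omega>)))"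
    using dynkin_heat[of "t - s" \<sigma> \<mu>] st \<sigma>_pos by (intro Bochner_Integration.integral_cong) (auto simp: algebra_simps)
  also have "\<dots> = expectation (\<lambda>\<omega>. f (Z \<omega>)) + expectation (\<lambda>\<omega>. LINT r:{0..t - s}|lborel. heat \<mu> \<sigma> gen r (Z \<omega>))"
    using ih integrable_f[OF iZ] by simp
  also have "expectation (\<lambda>\<omega>. LINT r:{0..t - s}|lborel. heat \<mu> \<sigma> gen r (Z \<omega>))
      = (LINT r:{0..t - s}|lborel. expectation (\<lambda>\<omega>. heat \<mu> \<sigma> gen r (Z \<omega>)))"
    using Fubini_time(2)[OF hm hb] by simp
  also have "\<dots> = (LINT r:{0..t - s}|lborel. expectation (H (s + r)))"
  proof (rule set_lebesgue_integral_cong)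
    show "\<forall>r. r \<in> {0..t - s} \<longrightarrow> expectation (\<lambda>\<omega>. heat \<mu> \<sigma> gen r (Z \<omega>)) = expectation (H (s + r))"
    proof (intro allI impI)
      fix r assume r: "r \<in> {0..t - s}"
      have [measurable]: "?X (s + r) \<in> borel_measurable M"
        using r st by (intro F_measurable_M[OF netput_adapted]) auto
      have "expectation (H (s + r)) = expectation (\<lambda>\<omega>. gen (Z \<omega> + (?X (s + r) \<omega> - ?X s \<omega>)))"
        using r st by (simp add: H_def[abs_def] max_def)
      also have "\<dots> = expectation (\<lambda>\<omega>. heat \<mu> \<sigma> gen (s + r - s) (Z \<omega>))"
        by (rule expectation_increment)
           (use r st Z gen_bounded in \<open>auto intro!: integrable_const_bound[where B = gen_bound]\<close>)
      finally show "expectation (\<lambda>\<omega>. heat \<mu> \<sigma> gen r (Z \<omega>)) = expectation (H (s + r))" by simp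
    qed
  qed simp
  also have "\<dots> = (LINT r:{s..t}|lborel. expectation (H r))"
    unfolding set_lebesgue_integral_def
    by (subst lborel_integral_real_affine[where c = 1 and t = s, symmetric, simplified] |
        subst lborel_integral_real_affine[where c = 1 and t = s])
       (auto intro!: Bochner_Integration.integral_cong simp: indicator_def)
  also have "\<dots> = expectation (\<lambda>\<omega>. LINT r:{s..t}|lborel. H r \<omega>)"
    by (rule Fubini_time(2)[symmetric, OF _ Hb]) measurable
  finally show ?thesis by (simp add: H_def)
qed

end

section \<open>Feasible policies on a time grid\<close>

definition control_path :: "(real \<Rightarrow> real) \<Rightarrow> bool" where
  "control_path y \<longleftrightarrow> 0 \<le> y 0 \<and> mono_on {0..} y \<and> (\<forall>t\<ge>0. continuous (at_right t) y) \<and>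
     (\<forall>t>0. \<exists>l. (y \<longlongrightarrow> l) (at_left t))"

lemma control_path_mono: "control_path y \<Longrightarrow> 0 \<le> a \<Longrightarrow> a \<le> b \<Longrightarrow> y a \<le> y b"
  by (auto simp: control_path_def mono_on_def)

lemma control_path_nonneg: "control_path y \<Longrightarrow> 0 \<le> a \<Longrightarrow> 0 \<le> y a"
  using control_path_mono[of y 0 a] by (auto simp: control_path_def)

text \<open>
  The half-open interval matters: adjacent grid intervals must get different increasing points.
  Right-continuity at \<open>a\<close> allows to start the search at some \<open>a' > a\<close> that is still below the level \<open>y b\<close>;
  the infimum of the times after \<open>a'\<close> at which \<open>y\<close> exceeds \<open>y a'\<close> is the point.
\<close>

lemma increasing_point_between:
  assumes y: "control_path y" and ab: "0 \<le> a" "a < b" and inc: "y a < y b"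
  shows "\<exists>s. a < s \<and> s \<le> b \<and> increasing_point y s"
proof -
  note mono = control_path_mono[OF y]
  have "(y \<longlongrightarrow> y a) (at_right a)"
    using y ab by (auto simp: control_path_def continuous_within)
  then have "eventually (\<lambda>r. y r < y b) (at_right a)"
    using inc by (rule order_tendstoD)
  then obtain e where e: "e > a" "\<And>r. a < r \<Longrightarrow> r < e \<Longrightarrow> y r < y b"
    by (auto simp: eventually_at_right_field)
  (* strictly after a, but early enough that y has not yet reached y b *)
  define a' where "a' = (a + min e b) / 2"
  have a': "a < a'" "a' < b" "y a' < y b"
    using e ab by (auto simp: a'_def min_def intro!: e(2))
  define I where "I = {r. a' \<le> r \<and> y a' < y r}"
  have I: "b \<in> I" "bdd_below I" using a' by (auto simp: I_def intro!: bdd_belowI[of _ a'])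
  define s where "s = Inf I"
  have s: "a' \<le> s" "s \<le> b"
    unfolding s_def using I by (auto intro!: cInf_greatest cInf_lower simp: I_def)
  have s0: "0 < s" using s a' ab by simp
  have above: "y a' < y r" if sr: "s < r" for r
  proof -
    obtain r' where r': "r' \<in> I" "r' < r"
      using sr I cInf_less_iff[of I r] unfolding s_def by blast
    then have "y r' \<le> y r" using mono[of r' r] a' ab by (auto simp: I_def)
    then show ?thesis using r' by (auto simp: I_def)
  qed
  have below: "y r \<le> y a'" if "0 \<le> r" "r < s" for r
  proof (cases "a' \<le> r")
    case True
    then have "r \<notin> I" using that(2) cInf_lower[OF _ I(2), of r] by (auto simp: s_def)
    then show ?thesis using True by (auto simp: I_def)
  next
    case False
    then show ?thesis using mono[of r a'] that by simp
  qed
  have "left_value y s \<le> y a'"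
  proof -
    obtain l where l: "(y \<longlongrightarrow> l) (at_left s)" using y s0 by (auto simp: control_path_def)
    have "eventually (\<lambda>r. y r \<le> y a') (at_left s)"
      by (rule eventually_at_leftI[of 0]) (use s0 below in auto)
    then have "l \<le> y a'" using l by (intro tendsto_upperbound) auto
    moreover have "left_value y s = l"
      using s0 tendsto_Lim[OF _ l] by (simp add: left_value_def)
    ultimately show ?thesis by simp
  qed
  then have "increasing_point y s"
    using above s0 unfolding increasing_point_def by (auto intro: less_le_trans le_less_trans)
  then show ?thesis using s a' by (intro exI[of _ s]) auto
qed

definition grid :: "real \<Rightarrow> nat \<Rightarrow> nat \<Rightarrow> real" where
  "grid t m i = t * real i / real m"

lemma grid_0 [simp]: "grid t m 0 = 0" by (simp add: grid_def)
lemma grid_end [simp]: "m > 0 \<Longrightarrow> grid t m m = t" by (simp add: grid_def)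
lemma grid_mono: "0 \<le> t \<Longrightarrow> i \<le> j \<Longrightarrow> grid t m i \<le> grid t m j"
  by (auto simp: grid_def divide_right_mono mult_left_mono)
lemma grid_nonneg [simp]: "0 \<le> t \<Longrightarrow> 0 \<le> grid t m i" by (simp add: grid_def)
lemma grid_diff: "grid t m (Suc i) - grid t m i = t / real m"
  by (simp add: grid_def diff_divide_distrib[symmetric] algebra_simps)
lemma grid_strict: "0 < t \<Longrightarrow> m > 0 \<Longrightarrow> grid t m i < grid t m (Suc i)"
  using grid_diff[of t m i] divide_pos_pos[of t "real m"] by linarith

definition grid_changes :: "real \<Rightarrow> nat \<Rightarrow> (real \<Rightarrow> real) \<Rightarrow> real" where
  "grid_changes t m y = (\<Sum>i<m. of_bool (y (grid t m i) \<noteq> y (grid t m (Suc i))))"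

text \<open>
  Only this inequality links the number of increasing points to the grid. The summand for time \<open>0\<close> counts
  the initial adjustment, since \<open>y (0-) = 0\<close>.
\<close>

lemma grid_changes_le_num_adjustments:
  assumes y: "control_path y" and t: "0 < t" "m > 0"
  shows "ennreal (grid_changes t m y + of_bool (0 < y 0)) \<le> num_adjustments y t"
proof -
  let ?g = "grid t m"
  define J where "J = {i \<in> {..<m}. y (?g i) \<noteq> y (?g (Suc i))}"
  have "\<forall>i\<in>J. \<exists>s. ?g i < s \<and> s \<le> ?g (Suc i) \<and> increasing_point y s"
  proof
    fix i assume "i \<in> J"
    then have "y (?g i) < y (?g (Suc i))"
      using control_path_mono[OF y, of "?g i" "?g (Suc i)"] t by (auto simp: J_def grid_mono)
    then show "\<exists>s. ?g i < s \<and> s \<le> ?g (Suc i) \<and> increasing_point y s"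
      using increasing_point_between[OF y _ grid_strict] t by auto
  qed
  then obtain s where s: "\<And>i. i \<in> J \<Longrightarrow> ?g i < s i \<and> s i \<le> ?g (Suc i) \<and> increasing_point y (s i)"
    by metis
  have lt: "s i < s j" if "i \<in> J" "j \<in> J" "i < j" for i j
    using s[OF that(1)] s[OF that(2)] grid_mono[of t "Suc i" j m] that t by simp
  have inj: "inj_on s J"
    by (rule inj_onI) (metis lt less_irrefl linorder_neqE_nat)
  have pos: "0 < s i" if "i \<in> J" for i
    using s[OF that] t by (intro le_less_trans[OF grid_nonneg[of t m i]]) auto
  define A where "A = s ` J \<union> (if 0 < y 0 then {0} else {})"
  have fin: "finite J" "finite A" by (auto simp: J_def A_def)
  have "card A = card (s ` J) + card (if 0 < y 0 then {0::real} else {})"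
    unfolding A_def using fin pos by (intro card_Un_disjoint) (auto simp: less_irrefl dest: pos)
  moreover have changes: "grid_changes t m y = real (card J)"
    by (simp add: grid_changes_def J_def sum_of_bool_eq Int_def conj_commute)
  ultimately have "real (card A) = grid_changes t m y + of_bool (0 < y 0)"
    using changes by (simp add: card_image[OF inj])
  moreover have "ennreal (real (card A)) = emeasure (count_space UNIV) A"
    using fin by (simp add: emeasure_count_space_finite ennreal_of_nat_eq_real_of_nat)
  moreover have "A \<subseteq> {s \<in> {0..t}. increasing_point y s}"
  proof -
    have "s i \<le> t" if "i \<in> J" for i
      using s[OF that] grid_mono[of t "Suc i" m m] t that by (auto simp: J_def)
    moreover have "increasing_point y 0" if "0 < y 0"
      using that control_path_mono[OF y, of 0] 
      by (auto simp: increasing_point_def left_value_def intro: less_le_trans)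
    ultimately show ?thesis
      using s pos t by (auto simp: A_def less_imp_le split: if_splits)
  qed
  then have "emeasure (count_space UNIV) A \<le> num_adjustments y t"
    unfolding num_adjustments_def by (rule emeasure_mono) simp
  ultimately show ?thesis by simp
qed

lemma abs_set_integral_le:
  fixes h :: "real \<Rightarrow> real"
  assumes h: "set_integrable lborel {a..b} h" and B: "\<And>r. \<bar>h r\<bar> \<le> B" and ab: "a \<le> b"
  shows "\<bar>LINT r:{a..b}|lborel. h r\<bar> \<le> B * (b - a)"
proof -
  have "\<bar>LINT r:{a..b}|lborel. h r\<bar> \<le> (LINT r:{a..b}|lborel. \<bar>h r\<bar>)"
    using set_integral_norm_bound[OF h] by simp
  also have "\<dots> \<le> (LINT r:{a..b}|lborel. B)"
    by (rule set_integral_mono[OF set_integrable_abs[OF h]])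
       (auto intro!: borel_integrable_atLeastAtMost' B)
  also have "\<dots> = B * (b - a)"
    using ab by (simp add: set_lebesgue_integral_def mult.commute)
  finally show ?thesis .
qed

lemma set_integral_grid_split:
  fixes h :: "real \<Rightarrow> real"
  assumes h: "\<And>a b. set_integrable lborel {a..b} h" and t: "0 < t" "m > 0"
  shows "(LINT r:{0..t}|lborel. h r) = (\<Sum>i<m. LINT r:{grid t m i..grid t m (Suc i)}|lborel. h r)"
proof -
  have "(LINT r:{0..grid t m n}|lborel. h r) = (\<Sum>i<n. LINT r:{grid t m i..grid t m (Suc i)}|lborel. h r)" for n
  proof (induction n)
    case 0
    have "(LINT r:{0..0::real}|lborel. h r) = 0"
      unfolding set_lebesgue_integral_def
      by (rule integral_eq_zero_AE) (use AE_lborel_singleton[of 0] in \<open>eventually_elim, simp\<close>)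
    then show ?case by simp
  next
    case (Suc n)
    have "{0..grid t m (Suc n)} = {0..grid t m n} \<union> {grid t m n..grid t m (Suc n)}"
      using grid_strict[OF t, of n] t by (intro ivl_disj_un_two_touch(4)[symmetric]) auto
    moreover have "AE r in lborel. \<not> (r \<in> {0..grid t m n} \<and> r \<in> {grid t m n..grid t m (Suc n)})"
      using AE_lborel_singleton[of "grid t m n"] by eventually_elim auto
    ultimately show ?case
      using set_integral_Un_AE[OF _ _ _ h h] Suc by simp
  qed
  from this[of m] show ?thesis using t by simp
qed

locale controlled = netput_test M F W \<mu> \<sigma> f p q P Q S
  for M :: "'a measure" and F W \<mu> \<sigma> f p q P Q S +
  fixes \<phi> :: "'a policy" and x :: real
  assumes feasible: "feasible M F \<phi>"
begin

abbreviation "X \<equiv> netput \<mu> \<sigma> W x"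
abbreviation "Z \<equiv> inventory \<mu> \<sigma> W x \<phi>"

lemma Z_eq: "Z t \<omega> = X t \<omega> + fst \<phi> t \<omega> - snd \<phi> t \<omega>"
  by (simp add: inventory_def)

context
  fixes Y assumes Y: "Y \<in> {fst \<phi>, snd \<phi>}"
begin

lemma Y_adapted: "0 \<le> t \<Longrightarrow> Y t \<in> borel_measurable (F t)"
  using feasible Y by (auto simp: feasible_def control_process_def adapted_def)

lemma Y_path: "\<omega> \<in> space M \<Longrightarrow> control_path (\<lambda>t. Y t \<omega>)"
  using feasible Y by (auto simp: feasible_def control_process_def control_path_def)

lemma Y_integrable: "0 \<le> t \<Longrightarrow> integrable M (Y t)"
proof (rule integrableI_nonneg)
  assume t: "0 \<le> t"
  show "random_variable borel (Y t)" using Y_adapted[OF t] by (rule F_measurable_M)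
  show "AE \<omega> in M. 0 \<le> Y t \<omega>" using Y_path control_path_nonneg t by (intro AE_I2) blast
  show "(\<integral>\<^sup>+ \<omega>. ennreal (Y t \<omega>) \<partial>M) < \<infinity>" using feasible Y t by (auto simp: feasible_def)
qed

lemma grid_changes_measurable:
  "0 \<le> t \<Longrightarrow> (\<lambda>\<omega>. grid_changes t m (\<lambda>s. Y s \<omega>)) \<in> borel_measurable M"
proof -
  assume t: "0 \<le> t"
  have [measurable]: "Y (grid t m i) \<in> borel_measurable M" for i
    using t by (intro F_measurable_M[OF Y_adapted]) simp
  show ?thesis unfolding grid_changes_def by measurable
qed

lemma grid_changes_integrable:
  assumes "0 \<le> t"
  shows "integrable M (\<lambda>\<omega>. grid_changes t m (\<lambda>s. Y s \<omega>))"
proof (rule integrable_const_bound[where B = "real m"])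
  have "\<bar>grid_changes t m y\<bar> \<le> real m" for y
    unfolding grid_changes_def
    using sum_bounded_above[of "{..<m}" "\<lambda>i. of_bool (y (grid t m i) \<noteq> y (grid t m (Suc i))) :: real" 1]
    by (simp add: sum_nonneg)
  then show "AE \<omega> in M. norm (grid_changes t m (\<lambda>s. Y s \<omega>)) \<le> real m" by simp
qed (rule grid_changes_measurable[OF assms])

lemma expected_grid_changes:
  assumes t: "0 < t"
  shows "\<exists>c. \<forall>m>0. expectation (\<lambda>\<omega>. grid_changes t m (\<lambda>s. Y s \<omega>)) \<le> c"
proof -
  define c where "c = enn2real (\<integral>\<^sup>+\<omega>. num_adjustments (\<lambda>s. Y s \<omega>) t \<partial>M)"
  have fin: "(\<integral>\<^sup>+\<omega>. num_adjustments (\<lambda>s. Y s \<omega>) t \<partial>M) < \<infinity>"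
    using feasible Y t by (auto simp: feasible_def)
  have nn: "0 \<le> grid_changes t m y" for m y by (simp add: grid_changes_def sum_nonneg)
  have "expectation (\<lambda>\<omega>. grid_changes t m (\<lambda>s. Y s \<omega>)) \<le> c" if m: "m > 0" for m
  proof -
    have "ennreal (expectation (\<lambda>\<omega>. grid_changes t m (\<lambda>s. Y s \<omega>)))
        = (\<integral>\<^sup>+\<omega>. ennreal (grid_changes t m (\<lambda>s. Y s \<omega>)) \<partial>M)"
      using t by (intro nn_integral_eq_integral[symmetric] grid_changes_integrable AE_I2 nn) simp
    also have "\<dots> \<le> (\<integral>\<^sup>+\<omega>. num_adjustments (\<lambda>s. Y s \<omega>) t \<partial>M)"
      by (intro nn_integral_mono order_trans[OF _ grid_changes_le_num_adjustments[OF Y_path t m]])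
         (auto intro!: ennreal_leI)
    also have "\<dots> = ennreal c" using fin by (simp add: c_def)
    finally show ?thesis by (simp add: c_def)
  qed
  then show ?thesis by blast
qed

end

lemma Z_adapted: "0 \<le> t \<Longrightarrow> Z t \<in> borel_measurable (F t)"
proof -
  assume t: "0 \<le> t"
  have [measurable]: "X t \<in> borel_measurable (F t)" "fst \<phi> t \<in> borel_measurable (F t)" "snd \<phi> t \<in> borel_measurable (F t)"
    using t by (auto intro: netput_adapted Y_adapted)
  show ?thesis unfolding Z_eq[abs_def] by measurable
qed

lemma Z_integrable: "0 \<le> t \<Longrightarrow> integrable M (Z t)"
  unfolding Z_eq[abs_def]
  by (intro Bochner_Integration.integrable_add Bochner_Integration.integrable_diff integrable_netput Y_integrable) auto

lemma Z_joint [measurable]: "(\<lambda>(t, \<omega>). Z (max 0 t) \<omega>) \<in> borel_measurable (lborel \<Otimes>\<^sub>M M)"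
proof (rule right_continuous_joint_measurable)
  show "random_variable borel (Z t)" if "0 \<le> t" for t using that F_measurable_M Z_adapted by blast
  show "continuous (at_right t) (\<lambda>s. Z s \<omega>)" if "\<omega> \<in> space M" "0 \<le> t" for t \<omega>
    unfolding Z_eq using Y_path[of "fst \<phi>", OF _ that(1)] Y_path[of "snd \<phi>", OF _ that(1)] that(2)
    by (intro continuous_add continuous_diff continuous_path_at_right[OF netput_path(1)] that)
       (auto simp: control_path_def)
qed

lemma gen_Z_joint [measurable]: "(\<lambda>(r, \<omega>). gen (Z (max 0 r) \<omega>)) \<in> borel_measurable (lborel \<Otimes>\<^sub>M M)"
proof -
  have "(\<lambda>z. gen ((\<lambda>(t, \<omega>). Z (max 0 t) \<omega>) z)) \<in> borel_measurable (lborel \<Otimes>\<^sub>M M)"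
    by measurable
  then show ?thesis by (simp add: case_prod_beta)
qed

lemmas gen_Z_time = Fubini_time[OF gen_Z_joint gen_bounded]

text \<open>Contribution of the adjustments to the increments of \<open>f (Z)\<close> over the grid intervals.\<close>

definition jump_sum :: "real \<Rightarrow> nat \<Rightarrow> 'a \<Rightarrow> real" where
  "jump_sum t m \<omega> = (\<Sum>i<m. f (Z (grid t m (Suc i)) \<omega>)
      - f (Z (grid t m i) \<omega> + (X (grid t m (Suc i)) \<omega> - X (grid t m i) \<omega>)))"

lemma integrable_f_Z: "0 \<le> t \<Longrightarrow> integrable M (\<lambda>\<omega>. f (Z t \<omega>))"
  by (intro integrable_f Z_integrable)

lemma integrable_f_step: "0 \<le> t \<Longrightarrow>
    integrable M (\<lambda>\<omega>. f (Z (grid t m i) \<omega> + (X (grid t m (Suc i)) \<omega> - X (grid t m i) \<omega>)))"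
  by (intro integrable_f Bochner_Integration.integrable_add Bochner_Integration.integrable_diff
        integrable_netput Z_integrable grid_nonneg)

lemma integrable_jump_sum: "0 \<le> t \<Longrightarrow> integrable M (jump_sum t m)"
  unfolding jump_sum_def[abs_def]
  by (intro Bochner_Integration.integrable_sum Bochner_Integration.integrable_diff integrable_f_Z integrable_f_step grid_nonneg)

text \<open>
  If neither control moves on a grid interval, then the path frozen at its left end and driven by the
  netput is \<open>Z\<close> itself; otherwise boundedness of the generator term gives a crude bound.
\<close>

lemma grid_step_error:
  fixes i :: nat
  assumes t: "0 < t" "m > 0" and \<omega>: "\<omega> \<in> space M"
  defines "a \<equiv> grid t m i" and "b \<equiv> grid t m (Suc i)"
  shows "\<bar>(LINT r:{a..b}|lborel. gen (Z a \<omega> + (X (max 0 r) \<omega> - X a \<omega>))) - (LINT r:{a..b}|lborel. gen (Z (max 0 r) \<omega>))\<bar>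
      \<le> 2 * gen_bound * (t / real m) * (of_bool (fst \<phi> a \<omega> \<noteq> fst \<phi> b \<omega>) + of_bool (snd \<phi> a \<omega> \<noteq> snd \<phi> b \<omega>))"
proof -
  have ab: "0 \<le> a" "a < b" "b - a = t / real m"
    using t grid_strict[OF t, of i] by (auto simp: a_def b_def grid_diff)
  have [measurable]: "Z a \<in> borel_measurable M" "X a \<in> borel_measurable M"
    using ab by (auto intro: F_measurable_M Z_adapted netput_adapted)
  show ?thesis
  proof (cases "fst \<phi> a \<omega> = fst \<phi> b \<omega> \<and> snd \<phi> a \<omega> = snd \<phi> b \<omega>")
    case True
    have const: "Y r \<omega> = Y a \<omega>" if "Y \<in> {fst \<phi>, snd \<phi>}" "Y a \<omega> = Y b \<omega>" "r \<in> {a..b}" for Y r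
    proof -
      have "0 \<le> r" "a \<le> r" "r \<le> b" using that(3) ab by auto
      then have "Y a \<omega> \<le> Y r \<omega>" "Y r \<omega> \<le> Y b \<omega>"
        using control_path_mono[OF Y_path[OF that(1) \<omega>]] ab by blast+
      then show ?thesis using that(2) by linarith
    qed
    have "(LINT r:{a..b}|lborel. gen (Z a \<omega> + (X (max 0 r) \<omega> - X a \<omega>))) = (LINT r:{a..b}|lborel. gen (Z (max 0 r) \<omega>))"
    proof (rule set_lebesgue_integral_cong)
      show "\<forall>r. r \<in> {a..b} \<longrightarrow> gen (Z a \<omega> + (X (max 0 r) \<omega> - X a \<omega>)) = gen (Z (max 0 r) \<omega>)"
      proof (intro allI impI)
        fix r assume r: "r \<in> {a..b}"
        have "fst \<phi> r \<omega> = fst \<phi> a \<omega>" "snd \<phi> r \<omega> = snd \<phi> a \<omega>"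
          using const[of "fst \<phi>" r] const[of "snd \<phi>" r] True r by blast+
        moreover have "max 0 r = r" using r ab by simp
        ultimately show "gen (Z a \<omega> + (X (max 0 r) \<omega> - X a \<omega>)) = gen (Z (max 0 r) \<omega>)"
          by (simp add: Z_eq algebra_simps)
      qed
    qed simp
    then show ?thesis using True by simp
  next
    case False
    have m1: "(\<lambda>(r, \<omega>). gen (Z a \<omega> + (X (max 0 r) \<omega> - X a \<omega>))) \<in> borel_measurable (lborel \<Otimes>\<^sub>M M)"
    proof -
      have "(\<lambda>z. gen (Z a (snd z) + ((\<lambda>(t, \<omega>). X (max 0 t) \<omega>) z - X a (snd z)))) \<in> borel_measurable (lborel \<Otimes>\<^sub>M M)"
        by measurable
      then show ?thesis by (simp add: case_prod_beta)
    qed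
    have "\<bar>LINT r:{a..b}|lborel. gen (Z a \<omega> + (X (max 0 r) \<omega> - X a \<omega>))\<bar> \<le> gen_bound * (b - a)"
      using ab by (intro abs_set_integral_le gen_bounded Fubini_time(3)[OF m1 gen_bounded \<omega>]) simp
    moreover have "\<bar>LINT r:{a..b}|lborel. gen (Z (max 0 r) \<omega>)\<bar> \<le> gen_bound * (b - a)"
      using ab by (intro abs_set_integral_le gen_bounded gen_Z_time(3) \<omega>) simp
    ultimately have "\<bar>(LINT r:{a..b}|lborel. gen (Z a \<omega> + (X (max 0 r) \<omega> - X a \<omega>))) - (LINT r:{a..b}|lborel. gen (Z (max 0 r) \<omega>))\<bar>
        \<le> 2 * gen_bound * (t / real m) * 1"
      unfolding ab(3) by linarith
    also have "\<dots> \<le> 2 * gen_bound * (t / real m) * (of_bool (fst \<phi> a \<omega> \<noteq> fst \<phi> b \<omega>) + of_bool (snd \<phi> a \<omega> \<noteq> snd \<phi> b \<omega>))"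
      using False t gen_bound_nonneg by (intro mult_left_mono) auto
    finally show ?thesis .
  qed
qed

text \<open>
  Substitute for Ito's formula. Summing \<open>dynkin_increment\<close> over the grid telescopes; the error of
  replacing the frozen paths by \<open>Z\<close> is at most \<open>C / m\<close>, because the expected number of grid intervals with an
  adjustment is bounded uniformly in \<open>m\<close>.
\<close>

lemma discrete_ito:
  assumes t: "0 < t"
  shows "(\<lambda>m. expectation (jump_sum t (Suc m))) \<longlonglongrightarrow>
     expectation (\<lambda>\<omega>. f (Z t \<omega>)) - expectation (\<lambda>\<omega>. f (Z 0 \<omega>))
       - expectation (\<lambda>\<omega>. LINT r:{0..t}|lborel. gen (Z (max 0 r) \<omega>))"
    (is "_ \<longlonglongrightarrow> ?L")
proof -
  obtain c1 c2 where c: "\<And>m. m > 0 \<Longrightarrow> expectation (\<lambda>\<omega>. grid_changes t m (\<lambda>s. fst \<phi> s \<omega>)) \<le> c1"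
      "\<And>m. m > 0 \<Longrightarrow> expectation (\<lambda>\<omega>. grid_changes t m (\<lambda>s. snd \<phi> s \<omega>)) \<le> c2"
    using expected_grid_changes[of "fst \<phi>", OF _ t] expected_grid_changes[of "snd \<phi>", OF _ t] by blast
  define C where "C = 2 * gen_bound * t * (c1 + c2)"
  have bound: "\<bar>expectation (jump_sum t m) - ?L\<bar> \<le> C / real m" if m: "m > 0" for m
  proof -
    let ?g = "grid t m"
    define I where "I i \<omega> = (LINT r:{?g i..?g (Suc i)}|lborel. gen (Z (?g i) \<omega> + (X (max 0 r) \<omega> - X (?g i) \<omega>)))" for i \<omega>
    define J where "J i \<omega> = (LINT r:{?g i..?g (Suc i)}|lborel. gen (Z (max 0 r) \<omega>))" for i \<omega>
    define h where "h i \<omega> = f (Z (?g i) \<omega> + (X (?g (Suc i)) \<omega> - X (?g i) \<omega>))" for i \<omega>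
    have g0: "0 \<le> ?g i" for i using t by simp
    have iI: "integrable M (I i)" for i
    proof -
      have [measurable]: "Z (?g i) \<in> borel_measurable M" "X (?g i) \<in> borel_measurable M"
        using g0 by (auto intro: F_measurable_M Z_adapted netput_adapted)
      have "(\<lambda>z. gen (Z (?g i) (snd z) + ((\<lambda>(t, \<omega>). X (max 0 t) \<omega>) z - X (?g i) (snd z)))) \<in> borel_measurable (lborel \<Otimes>\<^sub>M M)"
        by measurable
      then have "(\<lambda>(r, \<omega>). gen (Z (?g i) \<omega> + (X (max 0 r) \<omega> - X (?g i) \<omega>))) \<in> borel_measurable (lborel \<Otimes>\<^sub>M M)"
        by (simp add: case_prod_beta)
      from Fubini_time(1)[OF this gen_bounded] show ?thesis by (simp add: I_def[abs_def])
    qed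
    have iJ: "integrable M (J i)" for i
      using gen_Z_time(1) by (simp add: J_def[abs_def])
    have ih: "integrable M (h i)" for i
      unfolding h_def[abs_def] using t by (intro integrable_f_step) simp
    have step: "expectation (h i) - expectation (\<lambda>\<omega>. f (Z (?g i) \<omega>)) = expectation (I i)" for i
      unfolding h_def I_def[abs_def] using t
      by (intro dynkin_increment Z_adapted Z_integrable grid_mono) auto
    have "expectation (jump_sum t m) = (\<Sum>i<m. expectation (\<lambda>\<omega>. f (Z (?g (Suc i)) \<omega>)) - expectation (h i))"
      unfolding jump_sum_def h_def[symmetric] using ih integrable_f_Z[OF g0] by simp
    also have "\<dots> = (\<Sum>i<m. (expectation (\<lambda>\<omega>. f (Z (?g (Suc i)) \<omega>)) - expectation (\<lambda>\<omega>. f (Z (?g i) \<omega>))) - expectation (I i))"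
      by (intro sum.cong) (simp_all add: step[symmetric])
    also have "\<dots> = expectation (\<lambda>\<omega>. f (Z t \<omega>)) - expectation (\<lambda>\<omega>. f (Z 0 \<omega>)) - (\<Sum>i<m. expectation (I i))"
      using sum_lessThan_telescope[of "\<lambda>i. expectation (\<lambda>\<omega>. f (Z (?g i) \<omega>))" m] m by (simp add: sum_subtractf)
    finally have E: "expectation (jump_sum t m) = \<dots>" .
    have "expectation (\<lambda>\<omega>. LINT r:{0..t}|lborel. gen (Z (max 0 r) \<omega>)) = expectation (\<lambda>\<omega>. \<Sum>i<m. J i \<omega>)"
      unfolding J_def using t m gen_Z_time(3)
      by (intro Bochner_Integration.integral_cong set_integral_grid_split) auto
    also have "\<dots> = (\<Sum>i<m. expectation (J i))" using iJ by simp
    finally have "expectation (jump_sum t m) - ?L = (\<Sum>i<m. expectation (J i)) - (\<Sum>i<m. expectation (I i))"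
      using E by simp
    also have "\<dots> = - expectation (\<lambda>\<omega>. \<Sum>i<m. I i \<omega> - J i \<omega>)"
      using iI iJ by (simp add: sum_subtractf)
    finally have "\<bar>expectation (jump_sum t m) - ?L\<bar> = \<bar>expectation (\<lambda>\<omega>. \<Sum>i<m. I i \<omega> - J i \<omega>)\<bar>" by simp
    also have "\<dots> \<le> expectation (\<lambda>\<omega>. \<bar>\<Sum>i<m. I i \<omega> - J i \<omega>\<bar>)" by (rule integral_abs_bound)
    also have "\<dots> \<le> expectation (\<lambda>\<omega>. 2 * gen_bound * (t / real m) *
        (grid_changes t m (\<lambda>s. fst \<phi> s \<omega>) + grid_changes t m (\<lambda>s. snd \<phi> s \<omega>)))"
    proof (rule integral_mono)
      show "integrable M (\<lambda>\<omega>. \<bar>\<Sum>i<m. I i \<omega> - J i \<omega>\<bar>)" using iI iJ by auto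
      show "integrable M (\<lambda>\<omega>. 2 * gen_bound * (t / real m) *
        (grid_changes t m (\<lambda>s. fst \<phi> s \<omega>) + grid_changes t m (\<lambda>s. snd \<phi> s \<omega>)))"
        using t by (intro integrable_mult_right Bochner_Integration.integrable_add grid_changes_integrable) auto
      fix \<omega> assume \<omega>: "\<omega> \<in> space M"
      have "\<bar>\<Sum>i<m. I i \<omega> - J i \<omega>\<bar> \<le> (\<Sum>i<m. \<bar>I i \<omega> - J i \<omega>\<bar>)" by (rule sum_abs)
      also have "\<dots> \<le> (\<Sum>i<m. 2 * gen_bound * (t / real m) *
          (of_bool (fst \<phi> (?g i) \<omega> \<noteq> fst \<phi> (?g (Suc i)) \<omega>) + of_bool (snd \<phi> (?g i) \<omega> \<noteq> snd \<phi> (?g (Suc i)) \<omega>)))"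
        unfolding I_def J_def by (intro sum_mono grid_step_error t m \<omega>)
      also have "\<dots> = 2 * gen_bound * (t / real m) *
        (grid_changes t m (\<lambda>s. fst \<phi> s \<omega>) + grid_changes t m (\<lambda>s. snd \<phi> s \<omega>))"
        by (simp only: sum_distrib_left[symmetric] sum.distrib grid_changes_def)
      finally show "\<bar>\<Sum>i<m. I i \<omega> - J i \<omega>\<bar> \<le> 2 * gen_bound * (t / real m) *
        (grid_changes t m (\<lambda>s. fst \<phi> s \<omega>) + grid_changes t m (\<lambda>s. snd \<phi> s \<omega>))" .
    qed
    also have "\<dots> = 2 * gen_bound * (t / real m) *
        (expectation (\<lambda>\<omega>. grid_changes t m (\<lambda>s. fst \<phi> s \<omega>)) + expectation (\<lambda>\<omega>. grid_changes t m (\<lambda>s. snd \<phi> s \<omega>)))"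
      using t by (subst integral_mult_right_zero, subst Bochner_Integration.integral_add)
         (auto intro!: grid_changes_integrable)
    also have "\<dots> \<le> 2 * gen_bound * (t / real m) * (c1 + c2)"
      using c[OF m] gen_bound_nonneg t by (intro mult_left_mono add_mono) auto
    also have "\<dots> = C / real m" by (simp add: C_def)
    finally show ?thesis .
  qed
  have "(\<lambda>m. C / real (Suc m)) \<longlonglongrightarrow> 0"
    using LIMSEQ_Suc[OF lim_const_over_n[of C]] .
  moreover have "\<forall>\<^sub>F m in sequentially. norm (expectation (jump_sum t (Suc m)) - ?L) \<le> C / real (Suc m)"
    using bound[OF zero_less_Suc] by (intro always_eventually allI) (simp only: real_norm_def)
  ultimately have "(\<lambda>m. expectation (jump_sum t (Suc m)) - ?L) \<longlonglongrightarrow> 0"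
    by (rule Lim_null_comparison[rotated])
  then show ?thesis by (simp add: LIM_zero_iff)
qed

end

section \<open>Lower bound for the average cost\<close>

lemma ennreal_add_le: "ennreal (a + b) \<le> ennreal a + ennreal b"
  by (cases "0 \<le> a"; cases "0 \<le> b")
     (auto simp: ennreal_neg simp flip: ennreal_plus intro: ennreal_leI)

lemma ennreal_integral_le_nn_integral:
  fixes R :: "'b \<Rightarrow> real"
  assumes "integrable N R"
  shows "ennreal (integral\<^sup>L N R) \<le> (\<integral>\<^sup>+x. ennreal (R x) \<partial>N)"
proof -
  have "ennreal (integral\<^sup>L N R) \<le> ennreal (\<integral>x. max 0 (R x) \<partial>N)"
    using assms by (intro ennreal_leI integral_mono) auto
  also have "\<dots> = (\<integral>\<^sup>+x. ennreal (max 0 (R x)) \<partial>N)"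
    using assms by (intro nn_integral_eq_integral[symmetric]) auto
  also have "\<dots> = (\<integral>\<^sup>+x. ennreal (R x) \<partial>N)"
    by (intro nn_integral_cong) (auto simp: max_def ennreal_neg)
  finally show ?thesis .
qed

text \<open>The integrand of the average cost; \<open>Z\<close> takes the sample point first.\<close>

definition total_cost ::
  "('a \<Rightarrow> real \<Rightarrow> real) \<Rightarrow> (real \<Rightarrow> real) \<Rightarrow> real \<Rightarrow> real \<Rightarrow> real \<Rightarrow> real \<Rightarrow> 'a policy \<Rightarrow> real \<Rightarrow> 'a \<Rightarrow> ennreal" where
  "total_cost Z h K L k l \<phi> t \<omega> =
     (\<integral>\<^sup>+s\<in>{0..t}. ennreal (h (Z \<omega> s)) \<partial>lborel)
       + ennreal K * num_adjustments (\<lambda>s. fst \<phi> s \<omega>) t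
       + ennreal L * num_adjustments (\<lambda>s. snd \<phi> s \<omega>) t
       + ennreal (k * fst \<phi> t \<omega>) + ennreal (l * snd \<phi> t \<omega>)"

text \<open>
  The hypotheses of the verification argument: a candidate \<open>f\<close> with \<open>\<Gamma> f + h \<ge> \<gamma>\<close>, whose jumps never
  lower it by more than they cost, and which is at most affine in the holding cost rate.
\<close>

locale verified = controlled M F W \<mu> \<sigma> f p q P Q S \<phi> x
  for M :: "'a measure" and F W \<mu> \<sigma> f p q P Q S and \<phi> :: "'a policy" and x +
  fixes h :: "real \<Rightarrow> real" and K L k l \<gamma> :: real
  assumes h_nonneg: "\<And>z. 0 \<le> h z"
    and h_meas [measurable]: "h \<in> borel_measurable borel"
    and costs: "K > 0" "L > 0" "k > 0" "l > 0"
    and gen_ineq: "\<And>z. \<gamma> - generator \<mu> \<sigma> p q z \<le> h z"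
    and raise_ineq: "\<And>z \<xi>. 0 < \<xi> \<Longrightarrow> - (K + k * \<xi>) \<le> f (z + \<xi>) - f z"
    and lower_ineq: "\<And>z \<xi>. 0 < \<xi> \<Longrightarrow> - (L + l * \<xi>) \<le> f (z - \<xi>) - f z"
    and h_growth: "\<exists>c1 c2. c2 > 0 \<and> (\<forall>z. f z \<le> c1 + c2 * h z)"
begin

abbreviation "J t \<equiv> \<integral>\<^sup>+\<omega>. total_cost (\<lambda>\<omega> s. Z s \<omega>) h K L k l \<phi> t \<omega> \<partial>M"

text \<open>A raise and a reduction on the same grid interval are handled one after the other.\<close>

lemma jump_ineq:
  assumes "0 \<le> u" "0 \<le> v"
  shows "- (K * of_bool (u \<noteq> 0) + k * u + L * of_bool (v \<noteq> 0) + l * v) \<le> f (z + u - v) - f z"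
proof -
  have "- (K * of_bool (u \<noteq> 0) + k * u) \<le> f (z + u) - f z"
    using raise_ineq[of u z] assms by (cases "u = 0") auto
  moreover have "- (L * of_bool (v \<noteq> 0) + l * v) \<le> f (z + u - v) - f (z + u)"
    using lower_ineq[of v "z + u"] assms by (cases "v = 0") auto
  ultimately show ?thesis by linarith
qed

lemma jump_sum_ge:
  assumes \<omega>: "\<omega> \<in> space M" and t: "0 < t" "m > 0"
  defines "\<kappa> \<equiv> \<lambda>y. grid_changes t m y + of_bool (0 < y 0)"
  shows "- (K * \<kappa> (\<lambda>s. fst \<phi> s \<omega>) + L * \<kappa> (\<lambda>s. snd \<phi> s \<omega>) + k * fst \<phi> t \<omega> + l * snd \<phi> t \<omega>)
       \<le> jump_sum t m \<omega> + f (Z 0 \<omega>) - f x"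
proof -
  let ?g = "grid t m" and ?a = "\<lambda>s. fst \<phi> s \<omega>" and ?b = "\<lambda>s. snd \<phi> s \<omega>"
  have a: "control_path ?a" and b: "control_path ?b" using Y_path[OF _ \<omega>] by auto
  have mono: "y (?g i) \<le> y (?g (Suc i))" if "control_path y" for y i
    using t by (intro control_path_mono[OF that] grid_mono) auto
  have "(\<Sum>i<m. - (K * of_bool (?a (?g i) \<noteq> ?a (?g (Suc i))) + k * (?a (?g (Suc i)) - ?a (?g i))
       + L * of_bool (?b (?g i) \<noteq> ?b (?g (Suc i))) + l * (?b (?g (Suc i)) - ?b (?g i)))) \<le> jump_sum t m \<omega>"
    unfolding jump_sum_def
  proof (intro sum_mono)
    fix i
    let ?u = "?a (?g (Suc i)) - ?a (?g i)" and ?v = "?b (?g (Suc i)) - ?b (?g i)"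
      and ?z = "Z (?g i) \<omega> + (X (?g (Suc i)) \<omega> - X (?g i) \<omega>)"
    have 1: "(?a (?g i) \<noteq> ?a (?g (Suc i))) = (?u \<noteq> 0)" "(?b (?g i) \<noteq> ?b (?g (Suc i))) = (?v \<noteq> 0)" by auto
    have "Z (?g (Suc i)) \<omega> = ?z + ?u - ?v" by (simp add: Z_eq)
    with jump_ineq[of ?u ?v ?z] mono[OF a, of i] mono[OF b, of i]
    show "- (K * of_bool (?a (?g i) \<noteq> ?a (?g (Suc i))) + k * ?u
       + L * of_bool (?b (?g i) \<noteq> ?b (?g (Suc i))) + l * ?v) \<le> f (Z (?g (Suc i)) \<omega>) - f ?z"
      unfolding 1 by simp
  qed
  moreover have "(\<Sum>i<m. - (K * of_bool (?a (?g i) \<noteq> ?a (?g (Suc i))) + k * (?a (?g (Suc i)) - ?a (?g i))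
       + L * of_bool (?b (?g i) \<noteq> ?b (?g (Suc i))) + l * (?b (?g (Suc i)) - ?b (?g i))))
     = - (K * grid_changes t m ?a + k * (?a t - ?a 0) + L * grid_changes t m ?b + l * (?b t - ?b 0))"
    using sum_lessThan_telescope[of "\<lambda>i. ?a (?g i)" m] sum_lessThan_telescope[of "\<lambda>i. ?b (?g i)" m] t
    unfolding grid_changes_def
    by (simp only: sum_negf sum.distrib sum_distrib_left[symmetric] grid_end grid_0)
  moreover have "- (K * of_bool (0 < ?a 0) + k * ?a 0 + L * of_bool (0 < ?b 0) + l * ?b 0) \<le> f (Z 0 \<omega>) - f x"
  proof -
    have nn: "0 \<le> ?a 0" "0 \<le> ?b 0" using a b by (auto simp: control_path_def)
    then have 1: "(0 < ?a 0) = (?a 0 \<noteq> 0)" "(0 < ?b 0) = (?b 0 \<noteq> 0)" by auto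
    show ?thesis
      using jump_ineq[OF nn, of x] netput_path(2)[OF \<omega>] unfolding 1 by (simp add: Z_eq)
  qed
  ultimately show ?thesis unfolding \<kappa>_def by (simp add: algebra_simps)
qed

text \<open>
  For every grid the cost dominates a random variable whose expectation is known up to the grid error;
  the bound follows as the mesh tends to \<open>0\<close>. The number of increasing points need not be measurable, so
  the cost is compared pointwise with measurable minorants before integrating.
\<close>

lemma expected_cost_ge:
  assumes t: "0 < t"
  shows "ennreal (\<gamma> * t + f x - expectation (\<lambda>\<omega>. f (Z t \<omega>))) \<le> J t"
proof -
  define G where "G \<omega> = (LINT r:{0..t}|lborel. gen (Z (max 0 r) \<omega>))" for \<omega>
  have iG: "integrable M G" using gen_Z_time(1) by (simp add: G_def[abs_def])
  define R where "R m \<omega> = \<gamma> * t - G \<omega> - (jump_sum t (Suc m) \<omega> + f (Z 0 \<omega>) - f x)" for m \<omega>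
  have iR: "integrable M (R m)" for m
    unfolding R_def[abs_def] using iG integrable_jump_sum integrable_f_Z[of 0] t
    by (intro Bochner_Integration.integrable_add Bochner_Integration.integrable_diff) auto
  have ER: "expectation (R m) = \<gamma> * t - expectation G - (expectation (jump_sum t (Suc m)) + expectation (\<lambda>\<omega>. f (Z 0 \<omega>)) - f x)" for m
    unfolding R_def[abs_def] using iG integrable_jump_sum[of t "Suc m"] integrable_f_Z[of 0] t
    by (simp add: prob_space)
  have hold: "ennreal (\<gamma> * t - G \<omega>) \<le> (\<integral>\<^sup>+s\<in>{0..t}. ennreal (h (Z s \<omega>)) \<partial>lborel)" if \<omega>: "\<omega> \<in> space M" for \<omega>
  proof -
    have iG: "set_integrable lborel {0..t} (\<lambda>r. gen (Z (max 0 r) \<omega>))" by (rule gen_Z_time(3)[OF \<omega>])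
    have ic: "set_integrable lborel {0..t} (\<lambda>r. \<gamma>)"
      by (intro borel_integrable_atLeastAtMost' continuous_intros)
    have "(LINT r:{0..t}|lborel. \<gamma>) = \<gamma> * t" using t by (simp add: set_lebesgue_integral_def)
    then have "ennreal (\<gamma> * t - G \<omega>) = ennreal (LINT r:{0..t}|lborel. \<gamma> - gen (Z (max 0 r) \<omega>))"
      unfolding set_integral_diff(2)[OF ic iG] by (simp only: G_def)
    also have "\<dots> \<le> (\<integral>\<^sup>+r. ennreal (indicator {0..t} r *\<^sub>R (\<gamma> - gen (Z (max 0 r) \<omega>))) \<partial>lborel)"
      unfolding set_lebesgue_integral_def
      by (rule ennreal_integral_le_nn_integral, rule set_integral_diff(1)[OF ic iG, unfolded set_integrable_def])
    also have "\<dots> \<le> (\<integral>\<^sup>+s\<in>{0..t}. ennreal (h (Z s \<omega>)) \<partial>lborel)"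
    proof (rule nn_integral_mono)
      fix r
      show "ennreal (indicator {0..t} r *\<^sub>R (\<gamma> - gen (Z (max 0 r) \<omega>))) \<le> ennreal (h (Z r \<omega>)) * indicator {0..t} r"
        using gen_ineq[of "Z r \<omega>"] by (cases "r \<in> {0..t}") (simp_all add: ennreal_leI)
    qed
    finally show ?thesis .
  qed
  have point: "ennreal (R m \<omega>) \<le> total_cost (\<lambda>\<omega> s. Z s \<omega>) h K L k l \<phi> t \<omega>" if \<omega>: "\<omega> \<in> space M" for m \<omega>
  proof -
    let ?a = "\<lambda>s. fst \<phi> s \<omega>" and ?b = "\<lambda>s. snd \<phi> s \<omega>"
    define \<kappa> where "\<kappa> y = grid_changes t (Suc m) y + of_bool (0 < y 0)" for y
    have \<kappa>: "ennreal (C * \<kappa> y) \<le> ennreal C * num_adjustments y t" if "control_path y" "C > 0" for y C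
      using grid_changes_le_num_adjustments[OF that(1) t, of "Suc m"] that(2)
      unfolding \<kappa>_def[symmetric] by (subst ennreal_mult') (auto intro!: mult_left_mono)
    have "R m \<omega> \<le> (\<gamma> * t - G \<omega>) + K * \<kappa> ?a + L * \<kappa> ?b + k * ?a t + l * ?b t"
      using jump_sum_ge[OF \<omega> t, of "Suc m"] unfolding R_def \<kappa>_def by simp
    then have "ennreal (R m \<omega>) \<le> ennreal ((\<gamma> * t - G \<omega>) + K * \<kappa> ?a + L * \<kappa> ?b + k * ?a t + l * ?b t)"
      by (rule ennreal_leI)
    also have "\<dots> \<le> ennreal (\<gamma> * t - G \<omega>) + ennreal (K * \<kappa> ?a) + ennreal (L * \<kappa> ?b) + ennreal (k * ?a t) + ennreal (l * ?b t)"
      by (intro order_trans[OF ennreal_add_le] add_right_mono order_refl)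
    also have "\<dots> \<le> total_cost (\<lambda>\<omega> s. Z s \<omega>) h K L k l \<phi> t \<omega>"
      unfolding total_cost_def using costs Y_path[OF _ \<omega>]
      by (intro add_mono hold \<omega> \<kappa> order_refl) auto
    finally show ?thesis .
  qed
  have "(\<lambda>m. ennreal (expectation (R m))) \<longlonglongrightarrow> ennreal (\<gamma> * t + f x - expectation (\<lambda>\<omega>. f (Z t \<omega>)))"
  proof (rule tendsto_ennrealI)
    have "(\<lambda>m. expectation (R m)) \<longlonglongrightarrow> \<gamma> * t - expectation G -
       ((expectation (\<lambda>\<omega>. f (Z t \<omega>)) - expectation (\<lambda>\<omega>. f (Z 0 \<omega>)) - expectation G) + expectation (\<lambda>\<omega>. f (Z 0 \<omega>)) - f x)"
      unfolding ER G_def[abs_def] by (intro tendsto_intros discrete_ito t)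
    then show "(\<lambda>m. expectation (R m)) \<longlonglongrightarrow> \<gamma> * t + f x - expectation (\<lambda>\<omega>. f (Z t \<omega>))"
      by (simp add: algebra_simps)
  qed
  then show ?thesis
  proof (rule LIMSEQ_le_const2)
    have "ennreal (expectation (R m)) \<le> J t" for m
      using ennreal_integral_le_nn_integral[OF iR[of m]] nn_integral_mono[OF point]
      by (rule order_trans)
    then show "\<exists>N. \<forall>m\<ge>N. ennreal (expectation (R m)) \<le> J t" by blast
  qed
qed

text \<open>
  If the average cost is below \<open>\<gamma>' < \<gamma>\<close>, then \<open>E (f (Z s)) \<ge> (\<gamma> - \<gamma>') * s + f x\<close> for large \<open>s\<close>, so
  \<open>E (h (Z s))\<close> is at least of order \<open>T\<close> on \<open>[T / 2, T]\<close>. The holding cost up to \<open>T\<close> is then of order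
  \<open>T\<^sup>2\<close>, contradicting \<open>J T \<le> \<gamma>' * T\<close>.
\<close>

theorem average_cost_ge: "ennreal \<gamma> \<le> average_cost M W \<mu> \<sigma> h K L k l x \<phi>"
proof (rule ccontr)
  assume "\<not> ?thesis"
  then have less: "average_cost M W \<mu> \<sigma> h K L k l x \<phi> < ennreal \<gamma>" by simp
  have ac: "average_cost M W \<mu> \<sigma> h K L k l x \<phi> = Limsup at_top (\<lambda>t. J t / ennreal t)"
    by (simp add: average_cost_def total_cost_def)
  obtain e where e: "average_cost M W \<mu> \<sigma> h K L k l x \<phi> < e" "e < ennreal \<gamma>"
    using dense[OF less] by blast
  obtain \<gamma>' where \<gamma>': "e = ennreal \<gamma>'" "0 \<le> \<gamma>'" "\<gamma>' < \<gamma>"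
    using e(2) by (cases e) (auto simp: ennreal_less_iff)
  have "eventually (\<lambda>t. J t / ennreal t < ennreal \<gamma>') at_top"
    using e(1) unfolding ac \<gamma>'(1) by (rule Limsup_lessD)
  then obtain t0 where t0: "t0 > 0" "\<And>t. t \<ge> t0 \<Longrightarrow> J t / ennreal t < ennreal \<gamma>'"
  proof -
    obtain N where N: "\<And>t. t \<ge> N \<Longrightarrow> J t / ennreal t < ennreal \<gamma>'"
      using \<open>eventually _ at_top\<close> by (auto simp: eventually_at_top_linorder)
    show thesis by (rule that[of "max N 1"]) (auto intro: N)
  qed
  have J_le: "J t \<le> ennreal (\<gamma>' * t)" if "t \<ge> t0" for t
  proof -
    have t: "t > 0" using that t0 by simp
    have "J t = J t / ennreal t * ennreal t"
      using t by (simp add: ennreal_divide_times ennreal_mult_divide_eq)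
    also have "\<dots> \<le> ennreal \<gamma>' * ennreal t"
      using t0(2)[OF that] by (intro mult_right_mono) auto
    finally show ?thesis using \<gamma>' t by (simp add: ennreal_mult)
  qed
  have Ef: "(\<gamma> - \<gamma>') * t + f x \<le> expectation (\<lambda>\<omega>. f (Z t \<omega>))" if "t \<ge> t0" for t
  proof -
    have t: "t > 0" using that t0 by simp
    have "ennreal (\<gamma> * t + f x - expectation (\<lambda>\<omega>. f (Z t \<omega>))) \<le> ennreal (\<gamma>' * t)"
      using expected_cost_ge[OF t] J_le[OF that] by (rule order_trans)
    then show ?thesis using \<gamma>' t by (simp add: ennreal_le_iff algebra_simps)
  qed
  obtain c1 c2 where c: "c2 > 0" "\<And>z. f z \<le> c1 + c2 * h z" using h_growth by blast
  have Eh: "ennreal (((\<gamma> - \<gamma>') * T / 2 + f x - c1) / c2) \<le> (\<integral>\<^sup>+\<omega>. ennreal (h (Z (max 0 s) \<omega>)) \<partial>M)"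
    if "T / 2 \<le> s" "t0 \<le> T / 2" for s T
  proof -
    have s: "s \<ge> t0" "max 0 s = s" using that t0 by auto
    have i: "integrable M (\<lambda>\<omega>. f (Z s \<omega>))" using s by (intro integrable_f_Z) auto
    have "((\<gamma> - \<gamma>') * T / 2 + f x - c1) / c2 \<le> (expectation (\<lambda>\<omega>. f (Z s \<omega>)) - c1) / c2"
    proof (rule divide_right_mono)
      have "(\<gamma> - \<gamma>') * (T / 2) \<le> (\<gamma> - \<gamma>') * s"
        using \<gamma>' that by (intro mult_left_mono) auto
      then show "(\<gamma> - \<gamma>') * T / 2 + f x - c1 \<le> expectation (\<lambda>\<omega>. f (Z s \<omega>)) - c1"
        using Ef[OF s(1)] by simp
    qed (use c(1) in simp)
    also have "\<dots> = expectation (\<lambda>\<omega>. (f (Z s \<omega>) - c1) / c2)" using i by (simp add: prob_space)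
    finally have "ennreal (((\<gamma> - \<gamma>') * T / 2 + f x - c1) / c2) \<le> ennreal (expectation (\<lambda>\<omega>. (f (Z s \<omega>) - c1) / c2))"
      by (rule ennreal_leI)
    also have "\<dots> \<le> (\<integral>\<^sup>+\<omega>. ennreal ((f (Z s \<omega>) - c1) / c2) \<partial>M)"
      using i by (intro ennreal_integral_le_nn_integral) auto
    also have "\<dots> \<le> (\<integral>\<^sup>+\<omega>. ennreal (h (Z (max 0 s) \<omega>)) \<partial>M)"
      unfolding s(2) using c by (intro nn_integral_mono ennreal_leI) (simp add: divide_le_eq mult.commute add.commute diff_le_eq)
    finally show ?thesis .
  qed
  have contra: "((\<gamma> - \<gamma>') * T / 2 + f x - c1) / c2 \<le> 2 * \<gamma>'" if T: "t0 \<le> T / 2" for T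
  proof -
    define b where "b = ((\<gamma> - \<gamma>') * T / 2 + f x - c1) / c2"
    have T0: "T > 0" using T t0 by linarith
    interpret pair_sigma_finite lborel M ..
    have [measurable]: "(\<lambda>(s, \<omega>). ennreal (h (Z (max 0 s) \<omega>)) * indicator {0..T} s) \<in> borel_measurable (lborel \<Otimes>\<^sub>M M)"
    proof -
      have "(\<lambda>z. ennreal (h ((\<lambda>(t, \<omega>). Z (max 0 t) \<omega>) z)) * indicator {0..T} (fst z)) \<in> borel_measurable (lborel \<Otimes>\<^sub>M M)"
        by measurable
      then show ?thesis by (simp add: case_prod_beta)
    qed
    have "ennreal (b * (T / 2)) = (\<integral>\<^sup>+s. ennreal b * indicator {T/2..T} s \<partial>lborel)"
      using T0 ennreal_mult''[of "T / 2" b] by (subst nn_integral_cmult_indicator) simp_all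
    also have "\<dots> \<le> (\<integral>\<^sup>+s. (\<integral>\<^sup>+\<omega>. ennreal (h (Z (max 0 s) \<omega>)) * indicator {0..T} s \<partial>M) \<partial>lborel)"
    proof (rule nn_integral_mono)
      fix s
      show "ennreal b * indicator {T/2..T} s \<le> (\<integral>\<^sup>+\<omega>. ennreal (h (Z (max 0 s) \<omega>)) * indicator {0..T} s \<partial>M)"
        using Eh[OF _ T, of s] T0 by (auto simp: b_def indicator_def)
    qed
    also have "\<dots> = (\<integral>\<^sup>+\<omega>. (\<integral>\<^sup>+s. ennreal (h (Z (max 0 s) \<omega>)) * indicator {0..T} s \<partial>lborel) \<partial>M)"
      by (rule Fubini'[symmetric]) measurable
    also have "\<dots> \<le> J T"
    proof (rule nn_integral_mono)
      fix \<omega>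
      have "(\<integral>\<^sup>+s. ennreal (h (Z (max 0 s) \<omega>)) * indicator {0..T} s \<partial>lborel) = (\<integral>\<^sup>+s\<in>{0..T}. ennreal (h (Z s \<omega>)) \<partial>lborel)"
        by (intro nn_integral_cong) (auto simp: indicator_def)
      also have "\<dots> \<le> total_cost (\<lambda>\<omega> s. Z s \<omega>) h K L k l \<phi> T \<omega>"
        unfolding total_cost_def add.assoc by (rule add_increasing2) simp_all
      finally show "(\<integral>\<^sup>+s. ennreal (h (Z (max 0 s) \<omega>)) * indicator {0..T} s \<partial>lborel) \<le> total_cost (\<lambda>\<omega> s. Z s \<omega>) h K L k l \<phi> T \<omega>" .
    qed
    also have "\<dots> \<le> ennreal (\<gamma>' * T)" using J_le[of T] T T0 by simp
    finally have "b * (T / 2) \<le> \<gamma>' * T" using \<gamma>' T0 by (simp add: ennreal_le_iff)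
    then have "b \<le> 2 * \<gamma>'" using T0 by (simp add: field_simps)
    then show ?thesis by (simp add: b_def)
  qed
  have "filterlim (\<lambda>T. ((\<gamma> - \<gamma>') * T / 2 + f x - c1) / c2) at_top at_top"
    using \<gamma>'(3) c(1) by real_asymp
  then have "eventually (\<lambda>T. 2 * \<gamma>' < ((\<gamma> - \<gamma>') * T / 2 + f x - c1) / c2) at_top"
    by (auto simp: filterlim_at_top_dense)
  moreover have "eventually (\<lambda>T. 2 * t0 \<le> T) at_top" by (rule eventually_ge_at_top)
  ultimately have "eventually (\<lambda>T::real. False) at_top"
  proof eventually_elim
    case (elim T)
    then show False using contra[of T] by simp
  qed
  then show False by simp
qed

end

section \<open>The relative value function\<close>

lemma interval_integral_from_deriv:
  fixes \<psi> :: "real \<Rightarrow> real" and c x :: real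
  assumes cont: "continuous_on UNIV \<psi>"
  shows "((\<lambda>x. LBINT y=c..x. \<psi> y) has_real_derivative \<psi> x) (at x)"
proof -
  let ?l = "min c x - 1 :: real" and ?r = "max c x + 1 :: real"
  have "((\<lambda>u. LBINT y=c..u. \<psi> y) has_vector_derivative \<psi> x) (at x within {?l..?r})"
  proof (rule interval_integral_FTC2)
    show "continuous_on {?l..?r} \<psi>" by (rule continuous_on_subset[OF cont subset_UNIV])
  qed auto
  moreover have "at x within {?l..?r} = at x" by (rule at_within_interior) auto
  ultimately show ?thesis
    by (simp only: has_real_derivative_iff_has_vector_derivative)
qed

lemma interval_integral_eq_diff:
  fixes \<Psi> \<psi> :: "real \<Rightarrow> real"
  assumes "c \<le> e" "\<And>y. (\<Psi> has_real_derivative \<psi> y) (at y)" "continuous_on UNIV \<psi>"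
  shows "(LBINT y=c..e. \<psi> y) = \<Psi> e - \<Psi> c"
proof (rule interval_integral_FTC_finite)
  show "continuous_on {min c e..max c e} \<psi>"
    by (rule continuous_on_subset[OF assms(3)]) simp
  show "(\<Psi> has_vector_derivative \<psi> y) (at y within {min c e..max c e})" for y
    by (rule has_vector_derivative_at_within)
       (rule assms(2)[unfolded has_real_derivative_iff_has_vector_derivative])
qed

locale band_problem =
  fixes \<mu> \<sigma> K L k l a A B d D U u :: real and h g :: "real \<Rightarrow> real"
  assumes pos: "\<mu> > 0" "\<sigma> > 0" "K > 0" "L > 0" "k > 0" "l > 0"
    and holding: "holding_cost \<mu> \<sigma> h a"
    and order: "d < D" "D < U" "U < u"
    and g_def: "g = g_fun \<mu> \<sigma> h a A B"
    and shape: "\<exists>x\<^sub>1 x\<^sub>2. x\<^sub>1 < a \<and> a < x\<^sub>2 \<and> d < x\<^sub>1 \<and> x\<^sub>1 < D \<and> U < x\<^sub>2 \<and> x\<^sub>2 < u \<and>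
           antimono_on {..<x\<^sub>1} g \<and> mono_on {x\<^sub>1<..<x\<^sub>2} g \<and> antimono_on {x\<^sub>2<..} g"
    and areas: "(LBINT x=d..D. g x + k) = - K" "(LBINT x=U..u. g x - l) = L"
    and levels: "g d = - k" "g D = - k" "g U = l" "g u = l"
begin

abbreviation "lam \<equiv> 2 * \<mu> / \<sigma>\<^sup>2"

text \<open>The first-order equation \<open>\<sigma>\<^sup>2 / 2 * g' + \<mu> * g + h = \<mu> * A\<close> solved for the derivative.\<close>

definition g' :: "real \<Rightarrow> real" where
  "g' x = - lam * (g x - A) - lam / \<mu> * h x"

lemma h_cont: "continuous_on UNIV h" and h_nonneg: "0 \<le> h x" and h_a: "h a = 0"
  and h_convex: "convex_on UNIV h"
  using holding unfolding holding_cost_def by blast+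

lemma h_deriv: "x \<noteq> a \<Longrightarrow> (h has_real_derivative deriv h x) (at x)"
  using holding unfolding holding_cost_def DERIV_deriv_iff_real_differentiable by blast

lemma h_deriv_sign: "x < a \<Longrightarrow> deriv h x < 0" "x > a \<Longrightarrow> deriv h x > 0"
  using holding unfolding holding_cost_def by blast+

lemma g_deriv: "(g has_real_derivative g' x) (at x)"
proof -
  define \<psi> where "\<psi> y = h y * exp (lam * y)" for y
  have e: "exp (- c * (x - y)) = exp (- c * x) * exp (c * y)" for c x y :: real
  proof -
    have "- c * (x - y) = - c * x + c * y" by (simp add: algebra_simps)
    then show ?thesis by (simp only: exp_add)
  qed
  have cont: "continuous_on UNIV \<psi>"
    unfolding \<psi>_def by (rule continuous_on_mult[OF h_cont]) (intro continuous_intros)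
  have g: "g x = A - B * exp (- lam * (x - a)) - lam / \<mu> * (exp (- lam * x) * (LBINT y=a..x. \<psi> y))" for x
  proof -
    have "(LBINT y=a..x. h y * exp (- lam * (x - y))) = (LBINT y=a..x. exp (- lam * x) * \<psi> y)"
      unfolding \<psi>_def e by (intro interval_integral_cong mult.left_commute)
    then show ?thesis unfolding g_def g_fun_def Let_def
      by (simp only: interval_lebesgue_integral_mult_right)
  qed
  have exp1: "((\<lambda>x. exp (- c * (x - a))) has_real_derivative exp (- c * (x - a)) * (- c)) (at x)" for c
    by (auto intro!: derivative_eq_intros)
  have exp2: "((\<lambda>x. exp (- c * x)) has_real_derivative exp (- c * x) * (- c)) (at x)" for c :: real
    by (auto intro!: derivative_eq_intros)
  define G where "G = (\<lambda>x. A - B * exp (- lam * (x - a)) - lam / \<mu> * (exp (- lam * x) * (LBINT y=a..x. \<psi> y)))"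
  have "(G has_real_derivative
        0 - B * (exp (- lam * (x - a)) * (- lam))
          - lam / \<mu> * (exp (- lam * x) * (- lam) * (LBINT y=a..x. \<psi> y) + \<psi> x * exp (- lam * x))) (at x)"
    unfolding G_def
    by (rule DERIV_diff[OF DERIV_diff[OF DERIV_const DERIV_cmult[OF exp1]]
          DERIV_cmult[OF DERIV_mult[OF exp2 interval_integral_from_deriv[OF cont]]]])
  also have "0 - B * (exp (- lam * (x - a)) * (- lam))
          - lam / \<mu> * (exp (- lam * x) * (- lam) * (LBINT y=a..x. \<psi> y) + \<psi> x * exp (- lam * x)) = g' x"
  proof -
    have "\<psi> x * exp (- lam * x) = h x * (exp (lam * x) * exp (- (lam * x)))"
      by (simp only: \<psi>_def mult.assoc mult_minus_left)
    then have 1: "\<psi> x * exp (- lam * x) = h x" by (simp only: exp_minus_inverse mult_1_right)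
    have 2: "0 - B * (e1 * (- c)) - c2 * (e2 * (- c) * I + H) = - c * ((A - B * e1 - c2 * (e2 * I)) - A) - c2 * H"
      for e1 e2 c c2 I H :: real by (simp add: algebra_simps)
    show ?thesis unfolding g'_def g[of x] 1 by (rule 2)
  qed
  finally have D: "(G has_real_derivative g' x) (at x)" .
  have "G y = g y" for y unfolding G_def by (rule g[symmetric])
  then have "G = g" by (rule ext)
  with D show ?thesis by (rule back_subst[where P = "\<lambda>G. (G has_real_derivative g' x) (at x)"])
qed

lemma g_cont: "continuous_on UNIV g"
  by (intro continuous_at_imp_continuous_on ballI DERIV_isCont[OF g_deriv])

lemma g'_eq: "g' x = 2 / \<sigma>\<^sup>2 * (\<mu> * (A - g x) - h x)"
proof -
  define c where "c = 2 / \<sigma>\<^sup>2"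
  have c: "lam = c * \<mu>" "lam / \<mu> = c" using pos by (auto simp: c_def)
  show ?thesis unfolding g'_def c(2) c(1) c_def[symmetric] using pos by (simp add: algebra_simps)
qed

lemma g'_cont: "continuous_on UNIV g'"
  unfolding g'_def by (intro continuous_on_diff continuous_on_mult continuous_on_const g_cont h_cont)

lemma levels_differ: "- k < l" using pos by linarith

text \<open>
  The shape of \<open>g\<close> is given on open intervals; continuity closes the gaps at \<open>x\<^sub>1\<close> and \<open>x\<^sub>2\<close>. As \<open>d\<close> and \<open>u\<close>
  lie inside the intervals of decrease, \<open>g'\<close> is nonpositive there.
\<close>

lemma g_signs:
  shows "d \<le> x \<Longrightarrow> x \<le> D \<Longrightarrow> g x \<le> - k"
    and "D \<le> x \<Longrightarrow> x \<le> u \<Longrightarrow> - k \<le> g x"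
    and "d \<le> x \<Longrightarrow> x \<le> U \<Longrightarrow> g x \<le> l"
    and "U \<le> x \<Longrightarrow> x \<le> u \<Longrightarrow> l \<le> g x"
    and "g' d \<le> 0" "d < a" "g' u \<le> 0" "a < u"
proof -
  obtain x1 x2 where x: "x1 < a" "a < x2" "d < x1" "x1 < D" "U < x2" "x2 < u"
    and dec1: "antimono_on {..<x1} g" and inc: "mono_on {x1<..<x2} g" and dec2: "antimono_on {x2<..} g"
    using shape by blast
  show "d < a" "a < u" using x by auto
  have lim: "(g \<longlongrightarrow> g y) (at y within T)" for y T
    using g_cont by (metis UNIV_I continuous_on_def subset_UNIV tendsto_within_subset)
  have left: "g y \<le> - k" if "d \<le> y" "y < x1" for y
    using monotone_onD[OF dec1, of d y] that x levels by auto
  have mid: "g y \<le> g z" if "x1 < y" "y \<le> z" "z < x2" for y z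
    using monotone_onD[OF inc, of y z] that by auto
  have right: "l \<le> g y" if "x2 < y" "y \<le> u" for y
    using monotone_onD[OF dec2, of y u] that x levels by auto
  have at_x1: "g x1 \<le> - k"
  proof (rule tendsto_upperbound[OF lim])
    show "\<forall>\<^sub>F y in at_left x1. g y \<le> - k"
      by (rule eventually_at_leftI[of d]) (use left x in auto)
  qed simp
  have at_x2: "l \<le> g x2"
  proof (rule tendsto_lowerbound[OF lim])
    show "\<forall>\<^sub>F y in at_right x2. l \<le> g y"
      by (rule eventually_at_rightI[of _ u]) (use right x in auto)
  qed simp
  show low: "g x \<le> - k" if "d \<le> x" "x \<le> D" for x
    using left[of x] at_x1 mid[of x D] that x order levels
    by (cases x x1 rule: linorder_cases) auto
  show high: "l \<le> g x" if "U \<le> x" "x \<le> u" for x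
    using right[of x] at_x2 mid[of U x] that x order levels
    by (cases x x2 rule: linorder_cases) auto
  show "- k \<le> g x" if "D \<le> x" "x \<le> u" for x
    using high[of x] mid[of D x] that x order levels levels_differ by (cases "x < U") auto
  show "g x \<le> l" if "d \<le> x" "x \<le> U" for x
    using low[of x] mid[of x U] that x order levels levels_differ by (cases "x \<le> D") auto
  show "g' d \<le> 0"
  proof (rule ccontr)
    assume "\<not> g' d \<le> 0"
    then obtain e where e: "e > 0" "\<And>r. 0 < r \<Longrightarrow> r < e \<Longrightarrow> g d < g (d + r)"
      using DERIV_pos_inc_right[OF g_deriv, of d] by auto
    define r where "r = min e (x1 - d) / 2"
    have "0 < r" "r < e" "d + r < x1" using e(1) x by (auto simp: r_def min_def field_simps)
    then show False using e(2)[of r] left[of "d + r"] levels by auto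
  qed
  show "g' u \<le> 0"
  proof (rule ccontr)
    assume "\<not> g' u \<le> 0"
    then obtain e where e: "e > 0" "\<And>r. 0 < r \<Longrightarrow> r < e \<Longrightarrow> g (u - r) < g u"
      using DERIV_pos_inc_left[OF g_deriv, of u] by auto
    define r where "r = min e (u - x2) / 2"
    have "0 < r" "r < e" "x2 < u - r" using e(1) x by (auto simp: r_def min_def field_simps)
    then show False using e(2)[of r] right[of "u - r"] levels by auto
  qed
qed

text \<open>
  The marginal relative value: \<open>g\<close> inside the band, and outside it the marginal cost of an adjustment
  back to the band. The levels \<open>g d = - k\<close> and \<open>g u = l\<close> make \<open>p\<close> continuous.
\<close>

definition p :: "real \<Rightarrow> real" where
  "p x = (if x < d then - k else if x \<le> u then g x else l)"

text \<open>At the kinks \<open>d\<close> and \<open>u\<close> the one-sided value \<open>g'\<close> is chosen, so that \<open>generator_inside\<close> holds on the closed band.\<close>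

definition q :: "real \<Rightarrow> real" where
  "q x = (if d \<le> x \<and> x \<le> u then g' x else 0)"

definition f :: "real \<Rightarrow> real" where
  "f x = (LBINT y=d..x. p y)"

lemma p_cont: "continuous_on UNIV p"
proof -
  have "p = (\<lambda>x. g (max d (min u x)))"
    using levels order by (auto simp: p_def fun_eq_iff max_def min_def)
  moreover have "continuous_on UNIV (\<lambda>x. g (max d (min u x)))"
    by (rule continuous_on_compose2[OF g_cont]) (auto intro!: continuous_intros)
  ultimately show ?thesis by metis
qed

lemma f_deriv: "(f has_real_derivative p x) (at x)"
  unfolding f_def by (rule interval_integral_from_deriv[OF p_cont])

lemma bounds: "\<exists>P Q. (\<forall>x. \<bar>p x\<bar> \<le> P) \<and> (\<forall>x. \<bar>q x\<bar> \<le> Q)"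
proof -
  have "compact (g ` {d..u})" "compact (g' ` {d..u})"
    by (auto intro!: compact_continuous_image continuous_on_subset[OF g_cont] continuous_on_subset[OF g'_cont])
  then obtain G G' where "\<forall>y\<in>g ` {d..u}. norm y \<le> G" "\<forall>y\<in>g' ` {d..u}. norm y \<le> G'"
    using compact_imp_bounded[of "g ` {d..u}"] compact_imp_bounded[of "g' ` {d..u}"]
    unfolding bounded_iff by blast
  then have G: "\<And>x. x \<in> {d..u} \<Longrightarrow> \<bar>g x\<bar> \<le> G" "\<And>x. x \<in> {d..u} \<Longrightarrow> \<bar>g' x\<bar> \<le> G'"
    by auto
  have "\<bar>p x\<bar> \<le> max G (max k l)" for x
    using G(1)[of x] pos by (auto simp: p_def le_max_iff_disj)
  moreover have "\<bar>q x\<bar> \<le> max G' 0" for x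
    using G(2)[of x] by (auto simp: q_def le_max_iff_disj)
  ultimately show ?thesis by blast
qed

text \<open>Any bounds of \<open>p\<close> and \<open>q\<close>; only their existence matters.\<close>

definition "P = (SOME P. \<forall>x. \<bar>p x\<bar> \<le> P)"
definition "Q = (SOME Q. \<forall>x. \<bar>q x\<bar> \<le> Q)"

lemma test_function: "test_function f p q P Q {d, u}"
proof
  show "\<bar>p x\<bar> \<le> P" for x
    using someI_ex[of "\<lambda>P. \<forall>x. \<bar>p x\<bar> \<le> P"] bounds by (auto simp: P_def)
  show "\<bar>q x\<bar> \<le> Q" for x
    using someI_ex[of "\<lambda>Q. \<forall>x. \<bar>q x\<bar> \<le> Q"] bounds by (auto simp: Q_def)
  show "(p has_real_derivative q x) (at x)" if "x \<notin> {d, u}" for x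
  proof -
    have "x \<noteq> d" "x \<noteq> u" using that by auto
    then consider "x < d" | "d < x" "x < u" | "u < x" by linarith
    then show ?thesis
    proof cases
      case 1
      have "eventually (\<lambda>y. y \<in> {..<d}) (nhds x)" using 1 by (intro eventually_nhds_in_open) auto
      then have "eventually (\<lambda>y. p y = - k) (nhds x)" by eventually_elim (simp add: p_def)
      from DERIV_cong_ev[OF refl this refl] show ?thesis using 1 order by (simp add: q_def)
    next
      case 2
      have "eventually (\<lambda>y. y \<in> {d<..<u}) (nhds x)" using 2 by (intro eventually_nhds_in_open) auto
      then have "eventually (\<lambda>y. p y = g y) (nhds x)" by eventually_elim (simp add: p_def)
      from DERIV_cong_ev[OF refl this refl] show ?thesis using 2 g_deriv[of x] by (simp add: q_def)
    next
      case 3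
      have "eventually (\<lambda>y. y \<in> {u<..}) (nhds x)" using 3 by (intro eventually_nhds_in_open) auto
      then have "eventually (\<lambda>y. p y = l) (nhds x)" by eventually_elim (use order in \<open>simp add: p_def\<close>)
      from DERIV_cong_ev[OF refl this refl] show ?thesis using 3 order by (simp add: q_def)
    qed
  qed
  have [measurable]: "g' \<in> borel_measurable borel" by (rule borel_measurable_continuous_onI[OF g'_cont])
  show "q \<in> borel_measurable borel" unfolding q_def by measurable
  show "(f has_real_derivative p x) (at x)" for x by (rule f_deriv)
  show "continuous_on UNIV p" by (rule p_cont)
  show "finite {d, u}" by simp
qed

text \<open>
  The function \<open>f x + k * x\<close> is constant up to \<open>d\<close>, decreases from \<open>d\<close> to \<open>D\<close> and increases from \<open>D\<close> on.
  Its largest possible drop to the right is therefore the drop from \<open>d\<close> to \<open>D\<close>, which is \<open>K\<close> by the area condition.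
\<close>

lemma raise_costs:
  shows "f D - f d = - (K + k * (D - d))"
    and "0 < \<xi> \<Longrightarrow> - (K + k * \<xi>) \<le> f (z + \<xi>) - f z"
    and "x \<le> d \<Longrightarrow> f d \<le> f x"
proof -
  let ?G = "\<lambda>x. f x + k * x"
  have G: "(?G has_real_derivative p x + k) (at x)" for x
    by (auto intro!: derivative_eq_intros f_deriv)
  have "(LBINT x=d..D. p x + k) = ?G D - ?G d"
    by (rule interval_integral_eq_diff[OF _ G]) (use order in \<open>auto intro!: continuous_intros p_cont\<close>)
  moreover have "(LBINT x=d..D. p x + k) = (LBINT x=d..D. g x + k)"
    by (rule interval_integral_cong) (use order in \<open>auto simp: p_def einterval_def min_def max_def\<close>)
  ultimately have GD: "?G D - ?G d = - K" using areas by simp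
  then show "f D - f d = - (K + k * (D - d))" by (simp add: algebra_simps)
  have flat: "?G x = ?G d" if "x \<le> d" for x
  proof (rule antisym)
    have s: "p y + k = 0" if "y \<le> d" for y using that order levels by (auto simp: p_def)
    show "?G x \<le> ?G d" by (rule DERIV_nonneg_imp_nondecreasing[OF that]) (use G s in fastforce)
    show "?G d \<le> ?G x" by (rule DERIV_nonpos_imp_nonincreasing[OF that]) (use G s in fastforce)
  qed
  have down: "?G y \<le> ?G x" if "d \<le> x" "x \<le> y" "y \<le> D" for x y
  proof (rule DERIV_nonpos_imp_nonincreasing[OF that(2)])
    fix r assume r: "x \<le> r" "r \<le> y"
    have "p r + k \<le> 0" using g_signs(1)[of r] r that order by (auto simp: p_def)
    then show "\<exists>w. (?G has_real_derivative w) (at r) \<and> w \<le> 0" using G by blast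
  qed
  have up: "?G x \<le> ?G y" if "D \<le> x" "x \<le> y" for x y
  proof (rule DERIV_nonneg_imp_nondecreasing[OF that(2)])
    fix r assume r: "x \<le> r" "r \<le> y"
    have "0 \<le> p r + k" using g_signs(2)[of r] r that order pos by (auto simp: p_def)
    then show "\<exists>w. (?G has_real_derivative w) (at r) \<and> 0 \<le> w" using G by blast
  qed
  have lowest: "?G D \<le> ?G y" for y
    using flat[of y] down[of d D] down[of y D] up[of D y] order by (cases "y \<le> d"; cases "y \<le> D") auto
  have "- K \<le> ?G (z + \<xi>) - ?G z" if "0 < \<xi>"
  proof (cases "z \<le> D")
    case True
    then have "?G z \<le> ?G d" using flat[of z] down[of d z] by (cases "z \<le> d") auto
    then show ?thesis using lowest[of "z + \<xi>"] GD by linarith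
  next
    case False
    then show ?thesis using up[of z "z + \<xi>"] that pos by simp
  qed
  then show "- (K + k * \<xi>) \<le> f (z + \<xi>) - f z" if "0 < \<xi>" using that by (simp add: algebra_simps)
  show "f d \<le> f x" if "x \<le> d"
    using flat[OF that] mult_left_mono[OF that, of k] pos by linarith
qed

text \<open>The mirror image: \<open>f x - l * x\<close> decreases up to \<open>U\<close>, increases to \<open>u\<close>, and is constant from \<open>u\<close> on.\<close>

lemma lower_costs:
  shows "f U - f u = - (L + l * (u - U))"
    and "0 < \<xi> \<Longrightarrow> - (L + l * \<xi>) \<le> f (z - \<xi>) - f z"
    and "u \<le> x \<Longrightarrow> f u \<le> f x"
proof -
  let ?G = "\<lambda>x. f x - l * x"
  have G: "(?G has_real_derivative p x - l) (at x)" for x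
    by (auto intro!: derivative_eq_intros f_deriv)
  have "(LBINT x=U..u. p x - l) = ?G u - ?G U"
    by (rule interval_integral_eq_diff[OF _ G]) (use order in \<open>auto intro!: continuous_intros p_cont\<close>)
  moreover have "(LBINT x=U..u. p x - l) = (LBINT x=U..u. g x - l)"
    by (rule interval_integral_cong) (use order in \<open>auto simp: p_def einterval_def min_def max_def\<close>)
  ultimately have GU: "?G u - ?G U = L" using areas by simp
  then show "f U - f u = - (L + l * (u - U))" by (simp add: algebra_simps)
  have flat: "?G x = ?G u" if "u \<le> x" for x
  proof (rule antisym)
    have s: "p y - l = 0" if "u \<le> y" for y using that order levels by (cases "y = u") (auto simp: p_def)
    show "?G u \<le> ?G x" by (rule DERIV_nonneg_imp_nondecreasing[OF that]) (use G s in fastforce)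
    show "?G x \<le> ?G u" by (rule DERIV_nonpos_imp_nonincreasing[OF that]) (use G s in fastforce)
  qed
  have up: "?G x \<le> ?G y" if "U \<le> x" "x \<le> y" "y \<le> u" for x y
  proof (rule DERIV_nonneg_imp_nondecreasing[OF that(2)])
    fix r assume r: "x \<le> r" "r \<le> y"
    have "0 \<le> p r - l" using g_signs(4)[of r] r that order by (auto simp: p_def)
    then show "\<exists>w. (?G has_real_derivative w) (at r) \<and> 0 \<le> w" using G by blast
  qed
  have down: "?G y \<le> ?G x" if "x \<le> y" "y \<le> U" for x y
  proof (rule DERIV_nonpos_imp_nonincreasing[OF that(1)])
    fix r assume r: "x \<le> r" "r \<le> y"
    have "p r - l \<le> 0" using g_signs(3)[of r] r that order pos by (auto simp: p_def)
    then show "\<exists>w. (?G has_real_derivative w) (at r) \<and> w \<le> 0" using G by blast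
  qed
  have lowest: "?G U \<le> ?G y" for y
    using flat[of y] up[of U u] up[of U y] down[of y U] order by (cases "u \<le> y"; cases "U \<le> y") auto
  have "?G z - ?G (z - \<xi>) \<le> L" if "0 < \<xi>"
  proof (cases "U \<le> z")
    case True
    then have "?G z \<le> ?G u" using flat[of z] up[of z u] by (cases "u \<le> z") auto
    then show ?thesis using lowest[of "z - \<xi>"] GU by linarith
  next
    case False
    then show ?thesis using down[of "z - \<xi>" z] that pos by simp
  qed
  then show "- (L + l * \<xi>) \<le> f (z - \<xi>) - f z" if "0 < \<xi>" using that by (simp add: algebra_simps)
  show "f u \<le> f x" if "u \<le> x"
    using flat[OF that] mult_left_mono[OF that, of l] pos by linarith
qed

lemma f_bounded_below: "\<exists>b. \<forall>x. b \<le> f x"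
proof -
  have "continuous_on {d..u} f"
    by (intro continuous_at_imp_continuous_on ballI DERIV_isCont[OF f_deriv])
  moreover have "{d..u} \<noteq> {}" using order by simp
  ultimately obtain z where "\<forall>y\<in>{d..u}. f z \<le> f y"
    using continuous_attains_inf[of "{d..u}" f] by blast
  then obtain b where b: "\<And>x. x \<in> {d..u} \<Longrightarrow> b \<le> f x" by blast
  have "b \<le> f x" for x
    using b[of x] b[of d] b[of u] raise_costs(3)[of x] lower_costs(3)[of x] order
    by (cases "x < d"; cases "x \<le> u") auto
  then show ?thesis by blast
qed

lemma generator_inside: "d \<le> x \<Longrightarrow> x \<le> u \<Longrightarrow> \<mu> * A - generator \<mu> \<sigma> p q x = h x"
proof -
  assume x: "d \<le> x" "x \<le> u"
  have "\<sigma>\<^sup>2 / 2 * g' x = \<mu> * (A - g x) - h x" using pos by (simp add: g'_eq)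
  with x show ?thesis unfolding generator_def p_def q_def by (simp add: algebra_simps)
qed

lemma h_mono: "x \<le> y \<Longrightarrow> y < a \<Longrightarrow> h y \<le> h x" "a < x \<Longrightarrow> x \<le> y \<Longrightarrow> h x \<le> h y"
proof -
  show "h y \<le> h x" if "x \<le> y" "y < a"
  proof (rule DERIV_nonpos_imp_nonincreasing[OF that(1)])
    fix r assume "x \<le> r" "r \<le> y"
    then have "r < a" using that by simp
    then show "\<exists>w. (h has_real_derivative w) (at r) \<and> w \<le> 0"
      using h_deriv[of r] h_deriv_sign(1)[of r] by (intro exI[of _ "deriv h r"]) simp
  qed
  show "h x \<le> h y" if "a < x" "x \<le> y"
  proof (rule DERIV_nonneg_imp_nondecreasing[OF that(2)])
    fix r assume "x \<le> r" "r \<le> y"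
    then have "a < r" using that by simp
    then show "\<exists>w. (h has_real_derivative w) (at r) \<and> 0 \<le> w"
      using h_deriv[of r] h_deriv_sign(2)[of r] by (intro exI[of _ "deriv h r"]) simp
  qed
qed

text \<open>
  Outside the band \<open>\<Gamma> f\<close> is constant. At the end point \<open>d\<close> the inequality is \<open>g' d \<le> 0\<close>, and \<open>h\<close> is
  larger further out; likewise at \<open>u\<close>.
\<close>

lemma generator_ineq: "\<mu> * A - generator \<mu> \<sigma> p q x \<le> h x"
proof -
  consider "x < d" | "d \<le> x" "x \<le> u" | "u < x" by linarith
  then show ?thesis
  proof cases
    case 1
    have "\<mu> * (A + k) \<le> h d"
      using g_signs(5) pos by (simp add: g'_eq levels divide_le_0_iff)
    also have "\<dots> \<le> h x" using h_mono(1)[of x d] 1 g_signs(6) by simp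
    finally show ?thesis using 1 order by (simp add: generator_def p_def q_def algebra_simps)
  next
    case 2
    then show ?thesis using generator_inside by simp
  next
    case 3
    have "\<mu> * (A - l) \<le> h u"
      using g_signs(7) pos by (simp add: g'_eq levels divide_le_0_iff)
    also have "\<dots> \<le> h x" using h_mono(2)[of u x] 3 g_signs(8) by simp
    finally show ?thesis using 3 order by (simp add: generator_def p_def q_def algebra_simps)
  qed
qed

text \<open>Convexity on the segment from the minimizer \<open>a\<close>, compared with the value at distance \<open>1\<close>.\<close>

lemma h_linear_growth: "\<exists>c>0. \<forall>z. c * (\<bar>z - a\<bar> - 1) \<le> h z"
proof -
  have r: "h a < h (a + 1)"
  proof (rule DERIV_pos_imp_increasing_open[of a "a + 1" h])
    fix y assume "a < y"
    then show "\<exists>w. (h has_real_derivative w) (at y) \<and> 0 < w"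
      using h_deriv[of y] h_deriv_sign(2)[of y] by auto
  qed (auto intro!: continuous_on_subset[OF h_cont subset_UNIV])
  have l: "h a < h (a - 1)"
  proof (rule DERIV_neg_imp_decreasing_open[of "a - 1" a h])
    fix y assume "y < a"
    then show "\<exists>w. (h has_real_derivative w) (at y) \<and> w < 0"
      using h_deriv[of y] h_deriv_sign(1)[of y] by auto
  qed (auto intro!: continuous_on_subset[OF h_cont subset_UNIV])
  define c where "c = min (h (a - 1)) (h (a + 1))"
  have c: "c > 0" using r l h_a by (simp add: c_def)
  have "c * (\<bar>z - a\<bar> - 1) \<le> h z" for z
  proof (cases "\<bar>z - a\<bar> \<le> 1")
    case True
    then have "c * (\<bar>z - a\<bar> - 1) \<le> 0" using c by (simp add: mult_le_0_iff)
    then show ?thesis using h_nonneg[of z] by linarith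
  next
    case False
    define \<theta> where "\<theta> = 1 / \<bar>z - a\<bar>"
    have \<theta>: "0 < \<theta>" "\<theta> < 1" using False by (auto simp: \<theta>_def)
    have "h ((1 - \<theta>) *\<^sub>R a + \<theta> *\<^sub>R z) \<le> (1 - \<theta>) * h a + \<theta> * h z"
      using h_convex \<theta> by (intro convex_onD) auto
    moreover have "(1 - \<theta>) *\<^sub>R a + \<theta> *\<^sub>R z = a + (z - a) / \<bar>z - a\<bar>"
      by (simp add: \<theta>_def algebra_simps diff_divide_distrib)
    moreover have "c \<le> h (a + (z - a) / \<bar>z - a\<bar>)"
    proof (cases "z < a")
      case True
      then have "(z - a) / \<bar>z - a\<bar> = - 1" by (simp add: divide_eq_eq)
      then show ?thesis by (simp add: c_def)
    next
      case False
      with \<open>\<not> \<bar>z - a\<bar> \<le> 1\<close> have "(z - a) / \<bar>z - a\<bar> = 1" by simp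
      then show ?thesis by (simp add: c_def)
    qed
    ultimately have "c \<le> \<theta> * h z" using h_a by simp
    then have "c * \<bar>z - a\<bar> \<le> h z" using False by (simp add: \<theta>_def field_simps)
    then show ?thesis using c by (simp add: algebra_simps)
  qed
  then show ?thesis using c by blast
qed

lemma f_growth_h: "\<exists>c1 c2. c2 > 0 \<and> (\<forall>z. f z \<le> c1 + c2 * h z)"
proof -
  interpret test_function f p q P Q "{d, u}" by (rule test_function)
  obtain c where c: "c > 0" "\<And>z. c * (\<bar>z - a\<bar> - 1) \<le> h z" using h_linear_growth by blast
  (* P + 1 rather than P, to make the factor of h positive *)
  have "f z \<le> (f a + (P + 1)) + (P + 1) / c * h z" for z
  proof -
    have "f z \<le> f a + P * \<bar>z - a\<bar>" using f_lipschitz[of z a] by linarith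
    also have "\<dots> \<le> f a + (P + 1) * \<bar>z - a\<bar>" by (simp add: algebra_simps)
    also have "(P + 1) * \<bar>z - a\<bar> \<le> (P + 1) * (1 + h z / c)"
      using c(2)[of z] c(1) P_nonneg by (intro mult_left_mono) (auto simp: field_simps)
    finally show ?thesis by (simp add: algebra_simps add_divide_distrib)
  qed
  moreover have "(P + 1) / c > 0" using c P_nonneg by simp
  ultimately show ?thesis by blast
qed

end

section \<open>Paths of a control band policy\<close>

text \<open>
  A sum of nonnegative jumps at locally finitely many times is an admissible control path. Near a time \<open>t\<close>
  the set of jumps so far is constant on either side, and a point of increase must carry a positive jump.
\<close>

lemma step_process:
  fixes T :: "nat \<Rightarrow> ereal" and w :: "nat \<Rightarrow> real"
  assumes T_nonneg: "\<And>n. 0 \<le> T n" and w_nonneg: "\<And>n. 0 \<le> w n"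
    and fin: "\<And>t. finite {n. T n \<le> ereal t}"
  defines "y \<equiv> \<lambda>t. \<Sum>n | T n \<le> ereal t. w n"
  shows "control_path y"
    and "num_adjustments y t \<le> of_nat (card {n. T n \<le> ereal t \<and> 0 < w n})"
proof -
  have local: "\<exists>e>0. (\<forall>s. t < s \<and> s < t + e \<longrightarrow> {n. T n \<le> ereal s} = {n. T n \<le> ereal t}) \<and>
      (\<forall>s. t - e < s \<and> s < t \<longrightarrow> {n. T n \<le> ereal s} = {n. T n < ereal t})" for t
  proof -
    have "finite (real_of_ereal ` {n. T n \<le> ereal (t + 1)} )" using fin by simp
    then have "finite (real_of_ereal ` T ` {n. T n \<le> ereal (t + 1)})" using fin by simp
    then obtain e0 where e0: "e0 > 0" "\<And>x. x \<in> real_of_ereal ` T ` {n. T n \<le> ereal (t + 1)} \<Longrightarrow> x \<noteq> t \<Longrightarrow> e0 \<le> dist t x"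
      using finite_set_avoid[of "real_of_ereal ` T ` {n. T n \<le> ereal (t + 1)}" t] by blast
    have real: "\<exists>r. T n = ereal r \<and> (r = t \<or> e0 \<le> \<bar>t - r\<bar>)" if Ts: "T n \<le> ereal s" "s \<le> t + 1" for n s
    proof -
      obtain r where r: "T n = ereal r" using Ts T_nonneg[of n] by (cases "T n") auto
      then have "T n \<le> ereal (t + 1)" using Ts by simp
      then have "r \<in> real_of_ereal ` T ` {n. T n \<le> ereal (t + 1)}"
        using r by (metis (mono_tags) image_eqI mem_Collect_eq real_of_ereal.simps(1))
      then show ?thesis using e0(2)[of r] r by (auto simp: dist_real_def)
    qed
    (* e0 separates t from all other times up to t + 1, so steps beyond t + 1 must be excluded *)
    define e where "e = min e0 1"
    have e: "0 < e" "e \<le> e0" "e \<le> 1" using e0(1) by (auto simp: e_def)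
    have R: "{n. T n \<le> ereal s} = {n. T n \<le> ereal t}" if "t \<le> s" "s < t + e" for s
    proof (intro Collect_cong iffI)
      fix n assume "T n \<le> ereal s"
      with real[of n s] that e show "T n \<le> ereal t" by auto
    next
      fix n assume "T n \<le> ereal t"
      also have "ereal t \<le> ereal s" using that by simp
      finally show "T n \<le> ereal s" .
    qed
    have L: "{n. T n \<le> ereal s} = {n. T n < ereal t}" if "t - e < s" "s < t" for s
    proof (intro Collect_cong iffI)
      fix n assume "T n < ereal t"
      moreover from this have "T n \<le> ereal t" by simp
      ultimately obtain r where "T n = ereal r" "r < t" "e0 \<le> \<bar>t - r\<bar>"
        using real[of n t] by auto
      then show "T n \<le> ereal s" using that e by auto
    next
      fix n assume "T n \<le> ereal s"
      also have "ereal s < ereal t" using that by simp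
      finally show "T n < ereal t" .
    qed
    show ?thesis
      by (intro exI[of _ e] conjI allI impI e(1) R L) auto
  qed
  have right: "\<exists>e>0. \<forall>s. t < s \<and> s < t + e \<longrightarrow> y s = y t" for t
  proof -
    obtain e where "e > 0" "\<And>s. t < s \<and> s < t + e \<Longrightarrow> {n. T n \<le> ereal s} = {n. T n \<le> ereal t}"
      using local[of t] by blast
    then show ?thesis unfolding y_def by (intro exI[of _ e]) auto
  qed
  define l where "l t = (\<Sum>n | T n < ereal t. w n)" for t
  have left: "\<exists>e>0. \<forall>s. t - e < s \<and> s < t \<longrightarrow> y s = l t" for t
  proof -
    obtain e where "e > 0" "\<And>s. t - e < s \<and> s < t \<Longrightarrow> {n. T n \<le> ereal s} = {n. T n < ereal t}"
      using local[of t] by blast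
    then show ?thesis unfolding y_def l_def by (intro exI[of _ e]) auto
  qed
  have left_lim: "(y \<longlongrightarrow> l t) (at_left t)" for t
  proof (rule tendsto_eventually)
    obtain e where "e > 0" "\<And>s. t - e < s \<and> s < t \<Longrightarrow> y s = l t" using left by blast
    then show "\<forall>\<^sub>F s in at_left t. y s = l t"
      by (intro eventually_at_leftI[of "t - e"]) auto
  qed
  show "control_path y"
    unfolding control_path_def
  proof (intro conjI allI impI)
    show "0 \<le> y 0" unfolding y_def by (intro sum_nonneg w_nonneg)
    show "mono_on {0..} y"
      unfolding y_def
    proof (rule mono_onI)
      fix r s :: real assume "r \<le> s"
      then have "{n. T n \<le> ereal r} \<subseteq> {n. T n \<le> ereal s}"
        by (auto elim: order_trans)
      then show "(\<Sum>n | T n \<le> ereal r. w n) \<le> (\<Sum>n | T n \<le> ereal s. w n)"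
        by (intro sum_mono2 fin w_nonneg)
    qed
    show "continuous (at_right t) y" for t
      unfolding continuous_within
    proof (rule tendsto_eventually)
      obtain e where "e > 0" "\<And>s. t < s \<and> s < t + e \<Longrightarrow> y s = y t" using right by blast
      then show "\<forall>\<^sub>F s in at_right t. y s = y t"
        by (intro eventually_at_rightI[of _ "t + e"]) auto
    qed
    show "\<exists>l. (y \<longlongrightarrow> l) (at_left t)" for t using left_lim by blast
  qed
  have inc: "\<exists>n. T n = ereal s \<and> 0 < w n" if "increasing_point y s" for s
  proof (rule ccontr)
    assume no: "\<not> ?thesis"
    have s: "0 \<le> s" using that by (simp add: increasing_point_def)
    have "left_value y s = y s"
    proof (cases "s = 0")
      case True
      have "y 0 = 0"
        unfolding y_def
      proof (rule sum.neutral, safe)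
        fix n assume "T n \<le> ereal 0"
        then have "T n = ereal s"
          using T_nonneg[of n] True by (intro antisym) (simp_all flip: zero_ereal_def)
        then have "\<not> 0 < w n" using no by blast
        then show "w n = 0" using w_nonneg[of n] by linarith
      qed
      then show ?thesis using True by (simp add: left_value_def)
    next
      case False
      have "y s = l s"
        unfolding y_def l_def
      proof (rule sum.mono_neutral_right[OF fin])
        show "\<forall>n\<in>{n. T n \<le> ereal s} - {n. T n < ereal s}. w n = 0"
        proof
          fix n assume "n \<in> {n. T n \<le> ereal s} - {n. T n < ereal s}"
          then have "T n = ereal s" by (auto simp: not_less intro: antisym)
          then have "\<not> 0 < w n" using no by blast
          then show "w n = 0" using w_nonneg[of n] by linarith
        qed
      qed auto
      moreover have "left_value y s = l s"
        using False s tendsto_Lim[OF _ left_lim, of s] by (simp add: left_value_def)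
      ultimately show ?thesis by simp
    qed
    moreover obtain e where e: "e > 0" "\<And>r. s < r \<and> r < s + e \<Longrightarrow> y r = y s" using right by blast
    ultimately have "y (s + e / 2) - left_value y s = 0" by simp
    moreover have "y (s + e / 2) - left_value y s > 0"
      using that e(1) unfolding increasing_point_def by simp
    ultimately show False by simp
  qed
  let ?A = "{n. T n \<le> ereal t \<and> 0 < w n}"
  have finA: "finite ?A" by (rule finite_subset[OF _ fin[of t]]) auto
  have "{s \<in> {0..t}. increasing_point y s} \<subseteq> (real_of_ereal \<circ> T) ` ?A"
  proof
    fix s assume s: "s \<in> {s \<in> {0..t}. increasing_point y s}"
    then obtain n where "T n = ereal s" "0 < w n" using inc by blast
    then show "s \<in> (real_of_ereal \<circ> T) ` ?A" using s by (intro image_eqI[of _ _ n]) auto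
  qed
  then have "num_adjustments y t \<le> emeasure (count_space UNIV) ((real_of_ereal \<circ> T) ` ?A)"
    unfolding num_adjustments_def by (rule emeasure_mono) simp
  also have "\<dots> = of_nat (card ((real_of_ereal \<circ> T) ` ?A))"
    using finA by (simp add: emeasure_count_space_finite)
  also have "\<dots> \<le> of_nat (card ?A)"
    using card_image_le[OF finA, of "real_of_ereal \<circ> T"] by (rule of_nat_mono)
  finally show "num_adjustments y t \<le> of_nat (card ?A)" .
qed

locale band_path =
  fixes d D U u :: real and X :: "real \<Rightarrow> real"
  assumes order: "d < D" "D < U" "U < u" and cont: "continuous_on {0..} X"
begin

abbreviation "T \<equiv> band_time d D U u X"
abbreviation "\<xi> \<equiv> band_adjustment d D U u X"
definition "level n = snd (snd (band_seq d D U u X n))"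

lemma shifted_cont: "S \<subseteq> {0..} \<Longrightarrow> continuous_on S (\<lambda>s. X s + c)"
  by (rule continuous_on_add[OF continuous_on_subset[OF cont] continuous_on_const])

lemma band_0: "T 0 = 0" "\<xi> 0 = initial_adjustment d D U u (X 0)" "level 0 = initial_adjustment d D U u (X 0)"
  by (simp_all add: band_time_def band_adjustment_def level_def)

lemma band_Suc:
  shows "T (Suc n) = Inf {ereal t |t. T n < ereal t \<and> X t + level n \<in> {d, u}}"
    and "\<xi> (Suc n) = (if T (Suc n) = \<infinity> then 0 else
        if X (real_of_ereal (T (Suc n))) + level n = d then D - d else
        if X (real_of_ereal (T (Suc n))) + level n = u then U - u else 0)"
    and "level (Suc n) = level n + \<xi> (Suc n)"
  by (simp_all add: band_time_def band_adjustment_def level_def Let_def split_beta)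

text \<open>
  The hitting set is closed and does not contain the current time, so its infimum is attained and later than the
  current time; before it the path stays strictly inside the band by the intermediate value theorem.
\<close>

lemma next_time:
  assumes T: "T n = ereal t" "0 \<le> t" and inside: "d < X t + level n" "X t + level n < u"
  defines "hit \<equiv> {s. t \<le> s \<and> X s + level n \<in> {d, u}}"
  shows "hit = {} \<Longrightarrow> T (Suc n) = \<infinity>"
    and "hit \<noteq> {} \<Longrightarrow> T (Suc n) = ereal (Inf hit) \<and> Inf hit \<in> hit \<and> t < Inf hit"
    and "t \<le> r \<Longrightarrow> ereal r < T (Suc n) \<Longrightarrow> d < X r + level n \<and> X r + level n < u"
proof -
  have mem: "t < s \<and> X s + level n \<in> {d, u} \<longleftrightarrow> s \<in> hit" for s
    using inside by (cases "s = t") (auto simp: hit_def)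
  have set_eq: "{ereal s |s. T n < ereal s \<and> X s + level n \<in> {d, u}} = ereal ` hit"
  proof -
    have "{ereal s |s. T n < ereal s \<and> X s + level n \<in> {d, u}} = {ereal s |s. s \<in> hit}"
      unfolding mem[symmetric] T(1) less_ereal.simps ..
    then show ?thesis by blast
  qed
  show "T (Suc n) = \<infinity>" if "hit = {}"
    unfolding band_Suc(1) set_eq that by (simp add: top_ereal_def)
  have bdd: "bdd_below hit" by (rule bdd_belowI[of _ t]) (simp add: hit_def)
  have closed: "closed hit"
  proof -
    have "closed ({t..} \<inter> (\<lambda>s. X s + level n) -` {d, u})"
      using T(2) by (intro continuous_closed_preimage shifted_cont) auto
    moreover have "{t..} \<inter> (\<lambda>s. X s + level n) -` {d, u} = hit" by (auto simp: hit_def)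
    ultimately show ?thesis by simp
  qed
  have first: "T (Suc n) = ereal (Inf hit) \<and> Inf hit \<in> hit \<and> t < Inf hit" if ne: "hit \<noteq> {}"
  proof -
    have in_hit: "Inf hit \<in> hit" by (rule closed_contains_Inf[OF ne bdd closed])
    have "T (Suc n) = ereal (Inf hit)"
      unfolding band_Suc(1) set_eq using ereal_Inf'[OF bdd ne] by simp
    moreover have "t < Inf hit"
      using in_hit mem by blast
    ultimately show ?thesis using in_hit by blast
  qed
  then show "hit \<noteq> {} \<Longrightarrow> T (Suc n) = ereal (Inf hit) \<and> Inf hit \<in> hit \<and> t < Inf hit" .
  show "d < X r + level n \<and> X r + level n < u" if r: "t \<le> r" "ereal r < T (Suc n)"
  proof (rule ccontr)
    assume out: "\<not> ?thesis"
    have c: "continuous_on {t..r} (\<lambda>s. X s + level n)"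
      using T(2) by (intro shifted_cont) auto
    have "\<exists>s. t \<le> s \<and> s \<le> r \<and> X s + level n \<in> {d, u}"
    proof (cases "X r + level n \<le> d")
      case True
      then show ?thesis using IVT2'[OF True _ r(1) c] inside by auto
    next
      case False
      then show ?thesis using IVT'[OF _ _ r(1) c, of u] inside out by auto
    qed
    then obtain s where s: "s \<in> hit" "s \<le> r" by (auto simp: hit_def)
    then have "hit \<noteq> {}" by blast
    then have "T (Suc n) \<le> ereal s" using first cInf_lower[OF s(1) bdd] by simp
    also have "\<dots> \<le> ereal r" using s by simp
    finally show False using r(2) by simp
  qed
qed

lemma T_Suc_infinite: "T n = \<infinity> \<Longrightarrow> T (Suc n) = \<infinity>"
  by (simp add: band_Suc(1) top_ereal_def)

lemma band_invariant:
  "T n = \<infinity> \<or> (\<exists>t\<ge>0. T n = ereal t \<and> d < X t + level n \<and> X t + level n < u)"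
proof (induction n)
  case 0
  then show ?case
    using order by (auto simp: band_0 initial_adjustment_def zero_ereal_def)
next
  case (Suc n)
  show ?case
  proof (cases "T n = \<infinity>")
    case True
    then show ?thesis using T_Suc_infinite by simp
  next
    case False
    then obtain t where t: "T n = ereal t" "0 \<le> t" "d < X t + level n" "X t + level n < u" using Suc by auto
    show ?thesis
    proof (cases "{s. t \<le> s \<and> X s + level n \<in> {d, u}} = {}")
      case True
      then show ?thesis using next_time(1)[OF t] by simp
    next
      case False
      note N = next_time(2)[OF t False]
      define s where "s = Inf {s. t \<le> s \<and> X s + level n \<in> {d, u}}"
      have s: "T (Suc n) = ereal s" "X s + level n \<in> {d, u}" "t < s"
        using N unfolding s_def[symmetric] by auto
      then have "X s + level (Suc n) \<in> {D, U}"
        using order by (auto simp: band_Suc(2,3) add.assoc[symmetric])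
      then show ?thesis using s t(2) order by (intro disjI2 exI[of _ s]) auto
    qed
  qed
qed

lemma band_step:
  assumes "T (Suc n) = ereal s"
  obtains t where "T n = ereal t" "0 \<le> t" "t < s"
    and "(X s + level n = d \<and> \<xi> (Suc n) = D - d) \<or> (X s + level n = u \<and> \<xi> (Suc n) = U - u)"
proof -
  have "T n \<noteq> \<infinity>" using assms T_Suc_infinite by force
  then obtain t where t: "T n = ereal t" "0 \<le> t" "d < X t + level n" "X t + level n < u"
    using band_invariant[of n] by auto
  have ne: "{s. t \<le> s \<and> X s + level n \<in> {d, u}} \<noteq> {}"
    using next_time(1)[OF t] assms by force
  note N = next_time(2)[OF t ne]
  have s: "s = Inf {s. t \<le> s \<and> X s + level n \<in> {d, u}}" using N assms by simp
  have "X s + level n \<in> {d, u}" "t < s" using N unfolding s[symmetric] by auto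
  moreover from this have "(X s + level n = d \<and> \<xi> (Suc n) = D - d) \<or> (X s + level n = u \<and> \<xi> (Suc n) = U - u)"
    using assms order by (auto simp: band_Suc(2))
  ultimately show thesis using that[OF t(1,2)] by blast
qed

lemma T_nonneg: "0 \<le> T n"
  using band_invariant[of n] by auto

lemma T_mono_Suc: "T n \<le> T (Suc n)"
proof (cases "T (Suc n)")
  case (real s)
  then show ?thesis by (rule band_step) (use real in auto)
qed (use T_nonneg[of "Suc n"] in auto)

lemma T_mono: "m \<le> n \<Longrightarrow> T m \<le> T n"
  by (rule lift_Suc_mono_le[of T]) (auto intro: T_mono_Suc)

lemma T_strict: "T (Suc n) = ereal s \<Longrightarrow> T n < ereal s"
  by (erule band_step) simp

text \<open>
  Exits can be tested with inequalities in place of equalities; this form survives approximation by rational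
  times.
\<close>

lemma hits_before:
  assumes T: "T n = ereal t" and "t \<le> s"
  shows "T (Suc n) \<le> ereal s \<longleftrightarrow> (\<exists>r\<in>{t..s}. X r + level n \<le> d \<or> u \<le> X r + level n)"
proof
  have t: "0 \<le> t" "d < X t + level n" "X t + level n < u" using band_invariant[of n] T by auto
  assume "T (Suc n) \<le> ereal s"
  then obtain r where r: "T (Suc n) = ereal r" "r \<le> s"
    using T_nonneg[of "Suc n"] by (cases "T (Suc n)") auto
  from r(1) show "\<exists>r\<in>{t..s}. X r + level n \<le> d \<or> u \<le> X r + level n"
    by (rule band_step) (use r T in \<open>auto intro!: bexI[of _ r]\<close>)
next
  have t: "0 \<le> t" "d < X t + level n" "X t + level n < u" using band_invariant[of n] T by auto
  assume "\<exists>r\<in>{t..s}. X r + level n \<le> d \<or> u \<le> X r + level n"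
  then obtain r where r: "t \<le> r" "r \<le> s" "X r + level n \<le> d \<or> u \<le> X r + level n" by auto
  then have "\<not> ereal r < T (Suc n)" using next_time(3)[OF T t r(1)] by auto
  then have "T (Suc n) \<le> ereal r" by simp
  also have "\<dots> \<le> ereal s" using r by simp
  finally show "T (Suc n) \<le> ereal s" .
qed

text \<open>
  Between two adjustments the path travels from \<open>D\<close> or \<open>U\<close> to \<open>d\<close> or \<open>u\<close>. If the adjustment times converged,
  these moves of fixed size would contradict continuity at the limit.
\<close>

lemma finite_times: "finite {n. T n \<le> ereal B}"
proof (rule ccontr)
  assume inf: "infinite {n. T n \<le> ereal B}"
  have all: "T n \<le> ereal B" for n
  proof -
    obtain m where "n \<le> m" "T m \<le> ereal B"
      using inf unfolding infinite_nat_iff_unbounded_le by blast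
    then show ?thesis using T_mono[of n m] by (auto intro: order_trans)
  qed
  define \<tau> where "\<tau> n = real_of_ereal (T n)" for n
  have \<tau>: "T n = ereal (\<tau> n)" for n
    using all[of n] T_nonneg[of n] by (cases "T n") (auto simp: \<tau>_def)
  have "incseq \<tau>" using T_mono \<tau> by (auto simp: incseq_def)
  moreover have "\<tau> n \<le> B" for n using all[of n] \<tau>[of n] by simp
  ultimately obtain L where L: "\<tau> \<longlonglongrightarrow> L"
    using incseq_convergent[of \<tau> B] by blast
  have nn: "0 \<le> \<tau> n" for n using T_nonneg[of n] \<tau>[of n] by simp
  then have "0 \<le> L" by (intro LIMSEQ_le_const[OF L]) auto
  then have XL: "(\<lambda>n. X (\<tau> n)) \<longlonglongrightarrow> X L"
    by (intro continuous_on_tendsto_compose[OF cont L]) (auto simp: nn)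
  have "(\<lambda>n. \<bar>X (\<tau> (Suc (Suc n))) - X (\<tau> (Suc n))\<bar>) \<longlonglongrightarrow> \<bar>X L - X L\<bar>"
    by (intro tendsto_intros LIMSEQ_Suc XL)
  moreover define e where "e = min (D - d) (u - U)"
  moreover have "e > 0" using order by (simp add: e_def)
  ultimately have "eventually (\<lambda>n. \<bar>X (\<tau> (Suc (Suc n))) - X (\<tau> (Suc n))\<bar> < e) sequentially"
    by (intro order_tendstoD(2)) auto
  then obtain n where n: "\<bar>X (\<tau> (Suc (Suc n))) - X (\<tau> (Suc n))\<bar> < e"
    by (auto simp: eventually_sequentially)
  (* index Suc n, because the level after the initial adjustment may be anywhere in the band *)
  have "X (\<tau> (Suc n)) + level (Suc n) \<in> {D, U}"
    by (rule band_step[OF \<tau>[of "Suc n"]]) (auto simp: band_Suc(3))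
  moreover have "X (\<tau> (Suc (Suc n))) + level (Suc n) \<in> {d, u}"
    by (rule band_step[OF \<tau>[of "Suc (Suc n)"]]) auto
  ultimately show False using n order by (auto simp: e_def)
qed

lemma level_sum: "level n = (\<Sum>i\<le>n. \<xi> i)"
  by (induction n) (simp_all add: band_0 band_Suc(3))

lemma cumulative_in_band:
  assumes "0 \<le> t"
  shows "d < X t + (\<Sum>n | T n \<le> ereal t. \<xi> n)" "X t + (\<Sum>n | T n \<le> ereal t. \<xi> n) < u"
proof -
  let ?I = "{n. T n \<le> ereal t}"
  have ne: "?I \<noteq> {}" using band_0(1) assms by (auto intro!: exI[of _ 0])
  define N where "N = Max ?I"
  have N: "T N \<le> ereal t" using Max_in[OF finite_times ne] by (simp add: N_def)
  have "?I = {..N}"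
  proof
    show "?I \<subseteq> {..N}" using Max_ge[OF finite_times] by (auto simp: N_def)
    show "{..N} \<subseteq> ?I" using N T_mono by (auto intro: order_trans)
  qed
  then have sum: "(\<Sum>n | T n \<le> ereal t. \<xi> n) = level N" by (simp add: level_sum)
  have "Suc N \<notin> ?I" using \<open>?I = {..N}\<close> by simp
  then have lt: "ereal t < T (Suc N)" by simp
  obtain s where s: "T N = ereal s" "0 \<le> s" "d < X s + level N" "X s + level N < u"
    using band_invariant[of N] N by auto
  have "s \<le> t" using s N by simp
  then show "d < X t + (\<Sum>n | T n \<le> ereal t. \<xi> n)" "X t + (\<Sum>n | T n \<le> ereal t. \<xi> n) < u"
    using next_time(3)[OF s _ lt] unfolding sum by auto
qed

definition cumulative :: "nat \<Rightarrow> real \<Rightarrow> real" where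
  "cumulative N t = (\<Sum>n | n \<le> N \<and> T n \<le> ereal t. \<xi> n)"

lemma cumulative_0: "0 \<le> t \<Longrightarrow> cumulative 0 t = level 0"
proof -
  assume "0 \<le> t"
  then have "{n. n \<le> 0 \<and> T n \<le> ereal t} = {0}" using band_0(1) by auto
  then show ?thesis by (simp add: cumulative_def level_sum)
qed

lemma cumulative_Suc:
  "cumulative (Suc N) t = cumulative N t + (if T (Suc N) \<le> ereal t then \<xi> (Suc N) else 0)"
proof -
  have "{n. n \<le> Suc N \<and> T n \<le> ereal t} = {n. n \<le> N \<and> T n \<le> ereal t} \<union> (if T (Suc N) \<le> ereal t then {Suc N} else {})"
    by (auto simp: le_Suc_eq)
  then show ?thesis by (simp add: cumulative_def)
qed

lemma cumulative_full: "T N \<le> ereal t \<Longrightarrow> cumulative N t = level N"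
proof -
  assume "T N \<le> ereal t"
  then have "{n. n \<le> N \<and> T n \<le> ereal t} = {..N}" using T_mono by (auto intro: order_trans)
  then show ?thesis by (simp add: cumulative_def level_sum)
qed

text \<open>
  By induction on the number of adjustments: the \<open>N\<close>-th adjustment happens after all earlier ones, so it alters
  exactly one summand, the one of the grid interval containing its time. That interval shrinks to the time, and
  continuity of the path gives the limit.
\<close>

lemma grid_jump_sum_limit:
  fixes f :: "real \<Rightarrow> real"
  assumes f: "continuous_on UNIV f" and t: "0 < t"
  shows "(\<lambda>m. \<Sum>i<Suc m. f (X (grid t (Suc m) (Suc i)) + cumulative N (grid t (Suc m) (Suc i)))
                - f (X (grid t (Suc m) (Suc i)) + cumulative N (grid t (Suc m) i)))
     \<longlonglongrightarrow> (\<Sum>n | n < N \<and> T (Suc n) \<le> ereal t.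
            f (X (real_of_ereal (T (Suc n))) + level (Suc n)) - f (X (real_of_ereal (T (Suc n))) + level n))"
proof (induction N)
  case 0
  have "cumulative 0 (grid t m i) = level 0" for m i using t by (intro cumulative_0) simp
  then have "(\<Sum>i<Suc m. f (X (grid t (Suc m) (Suc i)) + cumulative 0 (grid t (Suc m) (Suc i)))
                - f (X (grid t (Suc m) (Suc i)) + cumulative 0 (grid t (Suc m) i))) = 0" for m
    by (simp only: diff_self sum.neutral_const)
  then show ?case by (simp del: sum.lessThan_Suc)
next
  case (Suc N)
  let ?g = "\<lambda>m. grid t (Suc m)"
  define J where "J N m = (\<Sum>i<Suc m. f (X (?g m (Suc i)) + cumulative N (?g m (Suc i)))
                - f (X (?g m (Suc i)) + cumulative N (?g m i)))" for N m
  define R where "R N = (\<Sum>n | n < N \<and> T (Suc n) \<le> ereal t.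
            f (X (real_of_ereal (T (Suc n))) + level (Suc n)) - f (X (real_of_ereal (T (Suc n))) + level n))" for N
  have IH: "J N \<longlonglongrightarrow> R N" using Suc by (simp add: J_def[abs_def] R_def)
  have "J (Suc N) \<longlonglongrightarrow> R (Suc N)"
  proof (cases "T (Suc N) \<le> ereal t")
    case False
    have "\<not> T (Suc N) \<le> ereal (?g m i)" if "i \<le> Suc m" for m i
    proof
      assume "T (Suc N) \<le> ereal (?g m i)"
      also have "?g m i \<le> ?g m (Suc m)" using t that by (intro grid_mono) auto
      also have "?g m (Suc m) = t" by simp
      finally show False using False by simp
    qed
    then have "J (Suc N) = J N"
      unfolding J_def by (intro ext sum.cong) (simp_all add: cumulative_Suc)
    moreover have "{n. n < Suc N \<and> T (Suc n) \<le> ereal t} = {n. n < N \<and> T (Suc n) \<le> ereal t}"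
      using False by (auto simp: less_Suc_eq)
    then have "R (Suc N) = R N" by (simp add: R_def)
    ultimately show ?thesis using IH by simp
  next
    case True
    then obtain \<tau> where \<tau>: "T (Suc N) = ereal \<tau>" "\<tau> \<le> t"
      using T_nonneg[of "Suc N"] by (cases "T (Suc N)") auto
    have \<tau>0: "0 < \<tau>" using T_strict[OF \<tau>(1)] T_nonneg[of N] by (cases "T N") auto
    (* the grid interval that contains the time of the new adjustment *)
    define i0 where "i0 m = (LEAST i. \<tau> \<le> ?g m (Suc i))" for m
    have ex: "\<tau> \<le> ?g m (Suc m)" for m using \<tau> by simp
    have i0: "\<tau> \<le> ?g m (Suc (i0 m))" "i0 m \<le> m" for m
      unfolding i0_def by (rule LeastI[of _ m, OF ex]) (rule Least_le[of _ m, OF ex])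
    have i0': "?g m (i0 m) < \<tau>" for m
    proof (cases "i0 m")
      case 0
      then show ?thesis using \<tau>0 by simp
    next
      case (Suc j)
      then have "\<not> \<tau> \<le> ?g m (Suc j)" unfolding i0_def by (intro not_less_Least) simp
      then show ?thesis using Suc by simp
    qed
    define \<rho> where "\<rho> m = ?g m (Suc (i0 m))" for m
    define V where "V m = f (X (\<rho> m) + level (Suc N)) - f (X (\<rho> m) + level N)" for m
    have JJ: "J (Suc N) m = J N m + V m" for m
    proof -
      define \<delta> where "\<delta> i = (f (X (?g m (Suc i)) + cumulative (Suc N) (?g m (Suc i)))
                - f (X (?g m (Suc i)) + cumulative (Suc N) (?g m i)))
           - (f (X (?g m (Suc i)) + cumulative N (?g m (Suc i)))
                - f (X (?g m (Suc i)) + cumulative N (?g m i)))" for i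
      have before: "cumulative (Suc N) s = cumulative N s" if "s < \<tau>" for s
        using that \<tau> by (simp add: cumulative_Suc)
      have after: "cumulative (Suc N) s = level (Suc N)" "cumulative N s = level N" if "\<tau> \<le> s" for s
        using that \<tau> T_mono_Suc[of N] by (auto intro!: cumulative_full intro: order_trans)
      have zero: "\<delta> i = 0" if "i \<noteq> i0 m" for i
      proof (cases "i < i0 m")
        case True
        then have "?g m (Suc i) \<le> ?g m (i0 m)" "?g m i \<le> ?g m (i0 m)" using t by (auto intro!: grid_mono)
        then show ?thesis using i0'[of m] by (simp add: \<delta>_def before)
      next
        case False
        with that have "i0 m < i" by simp
        then have "?g m (Suc (i0 m)) \<le> ?g m i" "?g m (Suc (i0 m)) \<le> ?g m (Suc i)" using t by (auto intro!: grid_mono)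
        then have "\<tau> \<le> ?g m i" "\<tau> \<le> ?g m (Suc i)" using i0(1)[of m] by auto
        then show ?thesis by (simp add: \<delta>_def after)
      qed
      have "J (Suc N) m - J N m = (\<Sum>i<Suc m. \<delta> i)"
        unfolding J_def \<delta>_def by (rule sum_subtractf[symmetric])
      also have "\<dots> = (\<Sum>i\<in>{i0 m}. \<delta> i)"
        using i0(2)[of m] by (intro sum.mono_neutral_right) (auto simp: zero)
      also have "\<dots> = V m"
        using before[OF i0'[of m]] after[OF i0(1)[of m]] by (simp add: \<delta>_def V_def \<rho>_def)
      finally show ?thesis by simp
    qed
    have "\<rho> \<longlonglongrightarrow> \<tau>"
    proof (rule tendsto_sandwich)
      show "\<forall>\<^sub>F m in sequentially. \<tau> \<le> \<rho> m" using i0(1) by (simp add: \<rho>_def)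
      have "\<rho> m \<le> \<tau> + t / real (Suc m)" for m
        using i0'[of m] grid_diff[of t "Suc m" "i0 m"] unfolding \<rho>_def by linarith
      then show "\<forall>\<^sub>F m in sequentially. \<rho> m \<le> \<tau> + t / real (Suc m)" by simp
      have "(\<lambda>m. \<tau> + t / real (Suc m)) \<longlonglongrightarrow> \<tau> + 0"
        by (intro tendsto_add tendsto_const LIMSEQ_Suc lim_const_over_n)
      then show "(\<lambda>m. \<tau> + t / real (Suc m)) \<longlonglongrightarrow> \<tau>" by simp
    qed simp
    then have X\<rho>: "(\<lambda>m. X (\<rho> m)) \<longlonglongrightarrow> X \<tau>"
      by (rule continuous_on_tendsto_compose[OF cont]) (use \<tau>0 t in \<open>auto simp: \<rho>_def\<close>)
    have f_lim: "(\<lambda>m. f (X (\<rho> m) + c)) \<longlonglongrightarrow> f (X \<tau> + c)" for c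
      by (rule continuous_on_tendsto_compose[OF f]) (auto intro!: tendsto_intros X\<rho>)
    have "(\<lambda>m. J N m + V m) \<longlonglongrightarrow> R N + (f (X \<tau> + level (Suc N)) - f (X \<tau> + level N))"
      unfolding V_def by (intro tendsto_intros IH f_lim)
    moreover have "{n. n < Suc N \<and> T (Suc n) \<le> ereal t} = insert N {n. n < N \<and> T (Suc n) \<le> ereal t}"
      using True by (auto simp: less_Suc_eq)
    then have "R (Suc N) = R N + (f (X \<tau> + level (Suc N)) - f (X \<tau> + level N))"
      using \<tau> by (simp add: R_def)
    moreover have "J (Suc N) = (\<lambda>m. J N m + V m)" using JJ by (rule ext)
    ultimately show ?thesis by (simp only:)
  qed
  then show ?case by (simp add: J_def[abs_def] R_def)
qed

definition hit_low :: "nat \<Rightarrow> real \<Rightarrow> bool" where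
  "hit_low n t \<longleftrightarrow> (\<exists>r. T n \<le> ereal r \<and> r \<le> t \<and> X r + level n \<le> d)"

definition hit_high :: "nat \<Rightarrow> real \<Rightarrow> bool" where
  "hit_high n t \<longleftrightarrow> (\<exists>r. T n \<le> ereal r \<and> r \<le> t \<and> u \<le> X r + level n)"

lemma next_time_le_iff: "T (Suc n) \<le> ereal t \<longleftrightarrow> hit_low n t \<or> hit_high n t"
proof (cases "T n \<le> ereal t")
  case True
  then obtain s where s: "T n = ereal s" "s \<le> t" using T_nonneg[of n] by (cases "T n") auto
  show ?thesis unfolding hits_before[OF s] hit_low_def hit_high_def using s by auto
next
  case False
  then have "\<not> T (Suc n) \<le> ereal t" using order_trans[OF T_mono_Suc[of n], of "ereal t"] by blast
  moreover have "\<not> T n \<le> ereal r" if "r \<le> t" for r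
    using False that order_trans[of "T n" "ereal r" "ereal t"] unfolding ereal_less_eq(3) by blast
  ultimately show ?thesis unfolding hit_low_def hit_high_def by blast
qed

text \<open>
  The next adjustment is a raise iff at some time \<open>q\<close> the lower boundary has been reached and the upper one
  has not. By continuity \<open>q\<close> may be taken rational or equal to \<open>t\<close>, so that only countably many events are involved.
\<close>

lemma adjustment_eq:
  assumes "T (Suc n) \<le> ereal t" "0 \<le> t"
  shows "\<xi> (Suc n) = (if \<exists>q\<in>{q \<in> \<rat>. 0 \<le> q \<and> q < t} \<union> {t}. hit_low n q \<and> \<not> hit_high n q then D - d else U - u)"
proof -
  obtain s where s: "T (Suc n) = ereal s" "s \<le> t"
    using assms T_nonneg[of "Suc n"] by (cases "T (Suc n)") auto
  from s(1) obtain \<tau> where \<tau>: "T n = ereal \<tau>" "0 \<le> \<tau>" "\<tau> < s"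
    and hit: "(X s + level n = d \<and> \<xi> (Suc n) = D - d) \<or> (X s + level n = u \<and> \<xi> (Suc n) = U - u)"
    by (rule band_step)
  have inside: "d < X r + level n \<and> X r + level n < u" if "\<tau> \<le> r" "r < s" for r
  proof (rule next_time(3)[OF \<tau>(1,2) _ _ that(1)])
    show "d < X \<tau> + level n" "X \<tau> + level n < u" using band_invariant[of n] \<tau> by auto
    show "ereal r < T (Suc n)" using s that by simp
  qed
  show ?thesis
  proof (cases "X s + level n = d")
    case True
    have "\<exists>q\<in>{q \<in> \<rat>. 0 \<le> q \<and> q < t} \<union> {t}. s \<le> q \<and> (\<forall>r. s \<le> r \<and> r \<le> q \<longrightarrow> X r + level n < u)"
    proof (cases "s = t")
      case True
      then show ?thesis using \<open>X s + level n = d\<close> order by (intro bexI[of _ t]) auto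
    next
      case False
      then have st: "s < t" using s by simp
      have "(X \<longlongrightarrow> X s) (at_right s)"
        using continuous_on_subset[OF cont, of "{s..}"] \<tau> by (auto simp: continuous_on_def intro: tendsto_within_subset[where S = "{s..}"])
      then have "((\<lambda>r. X r + level n) \<longlongrightarrow> d) (at_right s)"
        using True by (auto intro!: tendsto_eq_intros)
      then have "\<forall>\<^sub>F r in at_right s. X r + level n < u"
        by (rule order_tendstoD(2)) (use order in simp)
      then obtain e where e: "s < e" "\<And>r. s < r \<Longrightarrow> r < e \<Longrightarrow> X r + level n < u"
        by (auto simp: eventually_at_right_field)
      obtain q where q: "q \<in> \<rat>" "s < q" "q < min e t"
        using Rats_dense_in_real[of s "min e t"] e st by auto
      then show ?thesis
        using e(2) True order \<tau> by (intro bexI[of _ q]) (auto simp: le_less)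
    qed
    then obtain q where q: "q \<in> {q \<in> \<rat>. 0 \<le> q \<and> q < t} \<union> {t}" "s \<le> q" "\<And>r. s \<le> r \<Longrightarrow> r \<le> q \<Longrightarrow> X r + level n < u"
      by blast
    have "hit_low n q" unfolding hit_low_def using \<tau> q(2) True by (intro exI[of _ s]) auto
    moreover have "\<not> hit_high n q"
    proof
      assume "hit_high n q"
      then obtain r where r: "\<tau> \<le> r" "r \<le> q" "u \<le> X r + level n" by (auto simp: hit_high_def \<tau>)
      then show False using inside[of r] q(3)[of r] by (cases "r < s") auto
    qed
    ultimately show ?thesis using q(1) hit True order by auto
  next
    case False
    then have high: "X s + level n = u" "\<xi> (Suc n) = U - u" using hit by auto
    have "hit_high n q" if "hit_low n q" for q
    proof -
      have "T (Suc n) \<le> ereal q" using next_time_le_iff that by blast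
      then have "s \<le> q" using s by simp
      then show ?thesis unfolding hit_high_def using \<tau> high by (intro exI[of _ s]) auto
    qed
    then show ?thesis using high by auto
  qed
qed

lemma T_Suc_pos: "0 < T (Suc n)"
proof (cases "T (Suc n)")
  case (real s)
  then show ?thesis by (rule band_step) (use real in auto)
qed (use T_nonneg[of "Suc n"] in auto)

lemma cumulative_at_0: "cumulative N 0 = level 0"
proof -
  have "T n \<le> ereal 0 \<longleftrightarrow> n = 0" for n
  proof (cases n)
    case 0
    then show ?thesis using band_0(1) by simp
  next
    case (Suc m)
    then show ?thesis using T_Suc_pos[of m] by (simp add: not_le flip: zero_ereal_def)
  qed
  then have "{n. n \<le> N \<and> T n \<le> ereal 0} = {0}" by auto
  then show ?thesis by (simp add: cumulative_def level_sum)
qed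

lemma adjustment_bound: "\<bar>\<xi> n\<bar> \<le> \<bar>initial_adjustment d D U u (X 0)\<bar> + (D - d) + (u - U)"
proof (cases n)
  case 0
  then show ?thesis using order by (simp add: band_0)
next
  case (Suc m)
  have "\<xi> n \<in> {0, D - d, U - u}" unfolding Suc band_Suc(2) by simp
  then show ?thesis using order by auto
qed

end

section \<open>Measurability and truncation of the control band policy\<close>

text \<open>The time \<open>t\<close> itself is included because a path may reach the boundary exactly at \<open>t\<close>.\<close>

definition rational_times :: "real \<Rightarrow> real set" where
  "rational_times t = {q \<in> \<rat>. 0 \<le> q \<and> q < t} \<union> {t}"

lemma countable_rational_times: "countable (rational_times t)"
  unfolding rational_times_def by (auto intro: countable_subset[OF _ countable_rat])

context netput_space begin

lemma sets_F_intro: "s \<le> t \<Longrightarrow> A \<in> sets (F s) \<Longrightarrow> A \<in> sets (F t)"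
  using sets_F_mono by blast

text \<open>
  Reaching a closed half-line after \<open>T\<close> and up to \<open>t\<close> is, by continuity and compactness, the same as coming
  arbitrarily close to it at times that are rational or equal to \<open>t\<close>. The factor \<open>sg\<close>, used
  with the values \<open>1\<close> and \<open>- 1\<close>, covers both boundaries.
\<close>

lemma hitting_event:
  fixes T :: "'a \<Rightarrow> ereal" and c :: "'a \<Rightarrow> real" and sg b x :: real
  assumes T: "\<And>t. 0 \<le> t \<Longrightarrow> {\<omega> \<in> space M. T \<omega> \<le> ereal t} \<in> sets (F t)" "\<And>\<omega>. 0 \<le> T \<omega>"
    and c: "\<And>t. 0 \<le> t \<Longrightarrow> (\<lambda>\<omega>. if T \<omega> \<le> ereal t then c \<omega> else 0) \<in> borel_measurable (F t)"
    and t: "0 \<le> t"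
  defines "X \<equiv> netput \<mu> \<sigma> W x"
  shows "{\<omega> \<in> space M. \<exists>r. T \<omega> \<le> ereal r \<and> r \<le> t \<and> sg * (X r \<omega> + c \<omega>) \<le> b} \<in> sets (F t)"
proof -
  (* close to the half-line at time q; the strict inequality lets q be moved to a rational *)
  define E where "E m q = {\<omega> \<in> space M. T \<omega> \<le> ereal q \<and> sg * (X q \<omega> + c \<omega>) < b + 1 / real (Suc m)}" for m q
  have q: "0 \<le> q" "q \<le> t" if "q \<in> rational_times t" for q using that t by (auto simp: rational_times_def)
  have E: "E m q \<in> sets (F t)" if "q \<in> rational_times t" for m q
  proof (rule sets_F_intro[OF q(2)[OF that]])
    note q0 = q(1)[OF that]
    have [measurable]: "X q \<in> borel_measurable (F q)" "(\<lambda>\<omega>. if T \<omega> \<le> ereal q then c \<omega> else 0) \<in> borel_measurable (F q)"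
      using q0 by (auto simp: X_def intro: netput_adapted c)
    have "{\<omega> \<in> space (F q). sg * (X q \<omega> + (if T \<omega> \<le> ereal q then c \<omega> else 0)) < b + 1 / real (Suc m)} \<in> sets (F q)"
      by measurable
    then have "{\<omega> \<in> space M. T \<omega> \<le> ereal q} \<inter> {\<omega> \<in> space (F q). sg * (X q \<omega> + (if T \<omega> \<le> ereal q then c \<omega> else 0)) < b + 1 / real (Suc m)} \<in> sets (F q)"
      using T(1)[OF q0] by (intro sets.Int)
    also have "{\<omega> \<in> space M. T \<omega> \<le> ereal q} \<inter> {\<omega> \<in> space (F q). sg * (X q \<omega> + (if T \<omega> \<le> ereal q then c \<omega> else 0)) < b + 1 / real (Suc m)} = E m q"
      by (auto simp: E_def)
    finally show "E m q \<in> sets (F q)" .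
  qed
  have "{\<omega> \<in> space M. \<exists>r. T \<omega> \<le> ereal r \<and> r \<le> t \<and> sg * (X r \<omega> + c \<omega>) \<le> b} = (\<Inter>m. \<Union>q\<in>rational_times t. E m q)"
    (is "?H = ?R")
  proof (intro set_eqI iffI)
    fix \<omega> assume "\<omega> \<in> ?H"
    then obtain r where \<omega>: "\<omega> \<in> space M" and r: "T \<omega> \<le> ereal r" "r \<le> t" "sg * (X r \<omega> + c \<omega>) \<le> b" by auto
    have "0 \<le> ereal r" using order_trans[OF T(2) r(1)] .
    then have r0: "0 \<le> r" by simp
    have "\<exists>q\<in>rational_times t. \<omega> \<in> E m q" for m
    proof (cases "r = t")
      case True
      then show ?thesis using r \<omega> by (intro bexI[of _ t]) (auto simp: E_def rational_times_def intro: le_less_trans)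
    next
      case False
      have "continuous (at_right r) (\<lambda>s. X s \<omega>)"
        unfolding X_def using continuous_path_at_right[OF netput_path(1)[OF \<omega>] r0] .
      then have "((\<lambda>s. sg * (X s \<omega> + c \<omega>)) \<longlongrightarrow> sg * (X r \<omega> + c \<omega>)) (at_right r)"
        by (intro tendsto_intros) (simp add: continuous_within)
      then have "\<forall>\<^sub>F s in at_right r. sg * (X s \<omega> + c \<omega>) < b + 1 / real (Suc m)"
        by (rule order_tendstoD(2)) (use r(3) in \<open>simp add: le_less_trans\<close>)
      then obtain e where e: "r < e" "\<And>s. r < s \<Longrightarrow> s < e \<Longrightarrow> sg * (X s \<omega> + c \<omega>) < b + 1 / real (Suc m)"
        by (auto simp: eventually_at_right_field)
      obtain q where qq: "q \<in> \<rat>" "r < q" "q < min e t"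
        using Rats_dense_in_real[of r "min e t"] e False r(2) by auto
      have "T \<omega> \<le> ereal q" using r(1) qq by (auto intro: order_trans)
      then have "\<omega> \<in> E m q" using e(2)[of q] qq \<omega> by (auto simp: E_def)
      then show ?thesis using qq r0 by (intro bexI[of _ q]) (auto simp: rational_times_def)
    qed
    then show "\<omega> \<in> ?R" by blast
  next
    fix \<omega> assume R: "\<omega> \<in> ?R"
    then obtain q0 where q0: "q0 \<in> rational_times t" "\<omega> \<in> E 0 q0" by blast
    then have \<omega>: "\<omega> \<in> space M" by (auto simp: E_def)
    obtain \<tau> where \<tau>: "T \<omega> = ereal \<tau>" "0 \<le> \<tau>" "\<tau> \<le> t"
      using q0 q(2)[OF q0(1)] T(2)[of \<omega>] by (cases "T \<omega>") (auto simp: E_def)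
    have "continuous_on {\<tau>..t} (\<lambda>s. sg * (X s \<omega> + c \<omega>))"
      unfolding X_def using \<tau>
      by (intro continuous_on_mult continuous_on_add continuous_on_const continuous_on_subset[OF netput_path(1)[OF \<omega>]]) auto
    then obtain r where r: "r \<in> {\<tau>..t}" "\<And>s. s \<in> {\<tau>..t} \<Longrightarrow> sg * (X r \<omega> + c \<omega>) \<le> sg * (X s \<omega> + c \<omega>)"
      using continuous_attains_inf[of "{\<tau>..t}" "\<lambda>s. sg * (X s \<omega> + c \<omega>)"] \<tau> by auto
    have "sg * (X r \<omega> + c \<omega>) \<le> b + 1 / real (Suc m)" for m
    proof -
      obtain q' where q': "q' \<in> rational_times t" "\<omega> \<in> E m q'" using R by blast
      then have "q' \<in> {\<tau>..t}" using q(2)[OF q'(1)] \<tau> by (auto simp: E_def)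
      from r(2)[OF this] q'(2) show ?thesis by (simp add: E_def)
    qed
    moreover have "(\<lambda>m. b + 1 / real (Suc m)) \<longlonglongrightarrow> b + 0"
      by (intro tendsto_add tendsto_const LIMSEQ_Suc lim_1_over_n)
    ultimately have "sg * (X r \<omega> + c \<omega>) \<le> b + 0" by (intro LIMSEQ_le_const) auto
    then show "\<omega> \<in> ?H" using \<omega> \<tau> r(1) by auto
  qed
  then show ?thesis
    using E countable_rational_times by (simp only:) (intro sets.countable_INT' sets.countable_UN', auto)
qed

end

locale band_control = netput_space M F W \<mu> \<sigma>
  for M :: "'a measure" and F W \<mu> \<sigma> +
  fixes d D U u x :: real
  assumes band_order: "d < D" "D < U" "U < u"
begin

abbreviation "traj \<omega> \<equiv> \<lambda>s. netput \<mu> \<sigma> W x s \<omega>"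
abbreviation "\<tau> n \<omega> \<equiv> band_time d D U u (traj \<omega>) n"
abbreviation "\<xi> n \<omega> \<equiv> band_adjustment d D U u (traj \<omega>) n"
abbreviation "lev n \<omega> \<equiv> band_path.level d D U u (traj \<omega>) n"
abbreviation "\<xi>0 \<equiv> initial_adjustment d D U u x"

lemma band_path: "\<omega> \<in> space M \<Longrightarrow> band_path d D U u (traj \<omega>)"
  by (intro band_path.intro band_order netput_path)

lemma \<tau>_nonneg: "\<omega> \<in> space M \<Longrightarrow> 0 \<le> \<tau> n \<omega>"
  by (rule band_path.T_nonneg[OF band_path])

text \<open>
  The times are stopping times and the adjustments are known when they are made. Values are multiplied by the
  indicator of \<open>\<tau> n \<le> t\<close>, since they need not be known at \<open>t\<close> otherwise.
\<close>

lemma band_measurable: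
  assumes "0 \<le> t"
  shows "{\<omega> \<in> space M. \<tau> n \<omega> \<le> ereal t} \<in> sets (F t) \<and>
    (\<lambda>\<omega>. if \<tau> n \<omega> \<le> ereal t then lev n \<omega> else 0) \<in> borel_measurable (F t) \<and>
    (\<lambda>\<omega>. if \<tau> n \<omega> \<le> ereal t then \<xi> n \<omega> else 0) \<in> borel_measurable (F t)"
  using assms
proof (induction n arbitrary: t)
  case 0
  have [simp]: "\<tau> 0 \<omega> \<le> ereal t" if "\<omega> \<in> space M" for \<omega>
    using band_path.band_0(1)[OF band_path[OF that]] 0 by simp
  have "(\<lambda>\<omega>. if \<tau> 0 \<omega> \<le> ereal t then lev 0 \<omega> else 0) \<in> borel_measurable (F t) \<longleftrightarrow> (\<lambda>\<omega>. \<xi>0) \<in> borel_measurable (F t)"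
    by (rule measurable_cong) (simp add: band_path.band_0(3)[OF band_path] netput_path(2))
  moreover have "(\<lambda>\<omega>. if \<tau> 0 \<omega> \<le> ereal t then \<xi> 0 \<omega> else 0) \<in> borel_measurable (F t) \<longleftrightarrow> (\<lambda>\<omega>. \<xi>0) \<in> borel_measurable (F t)"
    by (rule measurable_cong) (simp add: band_path.band_0(2)[OF band_path] netput_path(2))
  moreover have "{\<omega> \<in> space M. \<tau> 0 \<omega> \<le> ereal t} = space (F t)" by auto
  ultimately show ?case using sets.top[of "F t"] by simp
next
  case (Suc n)
  (* outside the sample space the path may be arbitrary, so nonnegativity is enforced there *)
  define T where "T \<omega> = max 0 (\<tau> n \<omega>)" for \<omega>
  have T: "T \<omega> = \<tau> n \<omega>" if "\<omega> \<in> space M" for \<omega> using \<tau>_nonneg[OF that] by (simp add: T_def max_def)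
  have T1: "{\<omega> \<in> space M. T \<omega> \<le> ereal t} \<in> sets (F t)" if "0 \<le> t" for t
  proof -
    have "{\<omega> \<in> space M. T \<omega> \<le> ereal t} = {\<omega> \<in> space M. \<tau> n \<omega> \<le> ereal t}" using T by auto
    then show ?thesis using Suc.IH[OF that] by simp
  qed
  have T2: "(\<lambda>\<omega>. if T \<omega> \<le> ereal t then lev n \<omega> else 0) \<in> borel_measurable (F t)" if "0 \<le> t" for t
  proof -
    have "(\<lambda>\<omega>. if T \<omega> \<le> ereal t then lev n \<omega> else 0) \<in> borel_measurable (F t) \<longleftrightarrow>
        (\<lambda>\<omega>. if \<tau> n \<omega> \<le> ereal t then lev n \<omega> else 0) \<in> borel_measurable (F t)"
      by (rule measurable_cong) (simp add: T)
    then show ?thesis using Suc.IH[OF that] by simp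
  qed
  have T0: "0 \<le> T \<omega>" for \<omega> by (simp add: T_def)
  define Lo where "Lo t = {\<omega> \<in> space M. band_path.hit_low d D U u (traj \<omega>) n t}" for t
  define Hi where "Hi t = {\<omega> \<in> space M. band_path.hit_high d D U u (traj \<omega>) n t}" for t
  have Lo: "Lo t \<in> sets (F t)" if "0 \<le> t" for t
  proof -
    have "Lo t = {\<omega> \<in> space M. \<exists>r. T \<omega> \<le> ereal r \<and> r \<le> t \<and> 1 * (netput \<mu> \<sigma> W x r \<omega> + lev n \<omega>) \<le> d}"
      unfolding Lo_def by (intro Collect_cong) (auto simp: band_path.hit_low_def[OF band_path] T)
    then show ?thesis using hitting_event[OF T1 T0 T2 that] by (simp only:)
  qed
  have Hi: "Hi t \<in> sets (F t)" if "0 \<le> t" for t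
  proof -
    have "Hi t = {\<omega> \<in> space M. \<exists>r. T \<omega> \<le> ereal r \<and> r \<le> t \<and> (-1) * (netput \<mu> \<sigma> W x r \<omega> + lev n \<omega>) \<le> - u}"
    proof -
      have neg: "(-1) * y \<le> - u \<longleftrightarrow> u \<le> y" for y :: real by simp
      show ?thesis
        unfolding Hi_def neg by (intro Collect_cong) (auto simp: band_path.hit_high_def[OF band_path] T)
    qed
    then show ?thesis using hitting_event[OF T1 T0 T2 that] by (simp only:)
  qed
  have \<tau>_eq: "{\<omega> \<in> space M. \<tau> (Suc n) \<omega> \<le> ereal t} = Lo t \<union> Hi t"
    by (auto simp: Lo_def Hi_def band_path.next_time_le_iff[OF band_path])
  define B where "B = (\<Union>q\<in>rational_times t. Lo q - Hi q)"
  have B: "B \<in> sets (F t)"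
    unfolding B_def
  proof (rule sets.countable_UN'[OF countable_rational_times], rule image_subsetI)
    fix q assume "q \<in> rational_times t"
    then have "0 \<le> q" "q \<le> t" using Suc.prems by (auto simp: rational_times_def)
    then show "Lo q - Hi q \<in> sets (F t)" using Lo Hi by (intro sets_F_intro[of q t] sets.Diff)
  qed
  have LH: "Lo t \<union> Hi t \<in> sets (F t)" using Lo Hi Suc.prems by auto
  have inter: "B \<inter> space M \<in> sets (F t)" "(Lo t \<union> Hi t) \<inter> space M \<in> sets (F t)"
    using sets.Int[OF B sets.top] sets.Int[OF LH sets.top] by simp_all
  have 3: "(\<lambda>\<omega>. if \<tau> (Suc n) \<omega> \<le> ereal t then \<xi> (Suc n) \<omega> else 0) \<in> borel_measurable (F t)"
  proof -
    have "(\<lambda>\<omega>. if \<tau> (Suc n) \<omega> \<le> ereal t then \<xi> (Suc n) \<omega> else 0) \<in> borel_measurable (F t) \<longleftrightarrow>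
      (\<lambda>\<omega>. if \<omega> \<in> Lo t \<union> Hi t then (if \<omega> \<in> B then D - d else U - u) else 0) \<in> borel_measurable (F t)"
    proof (rule measurable_cong)
      fix \<omega> assume "\<omega> \<in> space (F t)"
      then have \<omega>: "\<omega> \<in> space M" by simp
      have 1: "\<omega> \<in> Lo t \<union> Hi t \<longleftrightarrow> \<tau> (Suc n) \<omega> \<le> ereal t" using \<tau>_eq \<omega> by blast
      have 2: "\<omega> \<in> B \<longleftrightarrow> (\<exists>q\<in>rational_times t. band_path.hit_low d D U u (traj \<omega>) n q \<and> \<not> band_path.hit_high d D U u (traj \<omega>) n q)"
        using \<omega> by (auto simp: B_def Lo_def Hi_def)
      show "(if \<tau> (Suc n) \<omega> \<le> ereal t then \<xi> (Suc n) \<omega> else 0) = (if \<omega> \<in> Lo t \<union> Hi t then (if \<omega> \<in> B then D - d else U - u) else 0)"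
        unfolding 1 2 rational_times_def using band_path.adjustment_eq[OF band_path[OF \<omega>] _ Suc.prems, of n] by simp
    qed
    moreover have "(\<lambda>\<omega>. if \<omega> \<in> Lo t \<union> Hi t then (if \<omega> \<in> B then D - d else U - u) else 0) \<in> borel_measurable (F t)"
      using inter by (intro measurable_If_set measurable_const) auto
    ultimately show ?thesis by (simp only:)
  qed
  have "(\<lambda>\<omega>. if \<tau> (Suc n) \<omega> \<le> ereal t then lev (Suc n) \<omega> else 0) \<in> borel_measurable (F t) \<longleftrightarrow>
     (\<lambda>\<omega>. if \<omega> \<in> Lo t \<union> Hi t then (if \<tau> n \<omega> \<le> ereal t then lev n \<omega> else 0) + (if \<tau> (Suc n) \<omega> \<le> ereal t then \<xi> (Suc n) \<omega> else 0) else 0) \<in> borel_measurable (F t)"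
  proof (rule measurable_cong)
    fix \<omega> assume "\<omega> \<in> space (F t)"
    then have \<omega>: "\<omega> \<in> space M" by simp
    have 1: "\<omega> \<in> Lo t \<union> Hi t \<longleftrightarrow> \<tau> (Suc n) \<omega> \<le> ereal t" using \<tau>_eq \<omega> by blast
    have 2: "\<tau> (Suc n) \<omega> \<le> ereal t \<Longrightarrow> \<tau> n \<omega> \<le> ereal t"
      using band_path.T_mono_Suc[OF band_path[OF \<omega>], of n] order_trans by blast
    show "(if \<tau> (Suc n) \<omega> \<le> ereal t then lev (Suc n) \<omega> else 0) =
      (if \<omega> \<in> Lo t \<union> Hi t then (if \<tau> n \<omega> \<le> ereal t then lev n \<omega> else 0) + (if \<tau> (Suc n) \<omega> \<le> ereal t then \<xi> (Suc n) \<omega> else 0) else 0)"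
      unfolding 1 using 2 band_path.band_Suc(3)[OF band_path[OF \<omega>], of n] by simp
  qed
  moreover have "(\<lambda>\<omega>. if \<omega> \<in> Lo t \<union> Hi t then (if \<tau> n \<omega> \<le> ereal t then lev n \<omega> else 0) + (if \<tau> (Suc n) \<omega> \<le> ereal t then \<xi> (Suc n) \<omega> else 0) else 0) \<in> borel_measurable (F t)"
    using inter 3 Suc.IH[OF Suc.prems] by (intro measurable_If_set borel_measurable_add) auto
  ultimately show ?case using 3 LH \<tau>_eq by simp
qed

text \<open>
  The control that makes only the adjustments with index in \<open>I\<close>; \<open>\<psi>\<close> selects the positive or the negative
  part. The set \<open>I = UNIV\<close> gives the band policy and \<open>I = {..N}\<close> its truncation.
\<close>

definition part :: "(real \<Rightarrow> real) \<Rightarrow> nat set \<Rightarrow> real \<Rightarrow> 'a \<Rightarrow> real" where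
  "part \<psi> I t \<omega> = (\<Sum>n | \<tau> n \<omega> \<le> ereal t. if n \<in> I then \<psi> (\<xi> n \<omega>) else 0)"

definition policy :: "nat set \<Rightarrow> 'a policy" where
  "policy I = (part (max 0) I, part (\<lambda>y. max 0 (- y)) I)"

lemma policy_UNIV: "policy UNIV = control_band_policy \<mu> \<sigma> W d D U u x"
  by (simp add: policy_def part_def[abs_def] control_band_policy_def Let_def)

lemma part_properties:
  assumes \<psi>: "\<And>y. 0 \<le> \<psi> y" "\<psi> 0 = 0" and [measurable]: "\<psi> \<in> borel_measurable borel"
  shows "control_process M F (part \<psi> I)"
    and "\<omega> \<in> space M \<Longrightarrow> num_adjustments (\<lambda>s. part \<psi> I s \<omega>) t
        \<le> of_nat (card {n. \<tau> n \<omega> \<le> ereal t \<and> 0 < (if n \<in> I then \<psi> (\<xi> n \<omega>) else 0)})"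
proof -
  have step: "control_path (\<lambda>s. part \<psi> I s \<omega>)"
    "num_adjustments (\<lambda>s. part \<psi> I s \<omega>) t \<le> of_nat (card {n. \<tau> n \<omega> \<le> ereal t \<and> 0 < (if n \<in> I then \<psi> (\<xi> n \<omega>) else 0)})"
    if \<omega>: "\<omega> \<in> space M" for \<omega> t
    using step_process[of "\<lambda>n. \<tau> n \<omega>" "\<lambda>n. if n \<in> I then \<psi> (\<xi> n \<omega>) else 0"]
      \<tau>_nonneg[OF \<omega>] band_path.finite_times[OF band_path[OF \<omega>]] \<psi>(1)
    by (auto simp: part_def[abs_def])
  show "num_adjustments (\<lambda>s. part \<psi> I s \<omega>) t
        \<le> of_nat (card {n. \<tau> n \<omega> \<le> ereal t \<and> 0 < (if n \<in> I then \<psi> (\<xi> n \<omega>) else 0)})" if "\<omega> \<in> space M"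
    using step(2)[OF that] .
  have "part \<psi> I t \<in> borel_measurable (F t)" if t: "0 \<le> t" for t
  proof -
    have [measurable]: "(\<lambda>\<omega>. if \<tau> n \<omega> \<le> ereal t then \<xi> n \<omega> else 0) \<in> borel_measurable (F t)" for n
      using band_measurable[OF t] by blast
    have "part \<psi> I t \<in> borel_measurable (F t) \<longleftrightarrow>
        (\<lambda>\<omega>. \<Sum>n. if n \<in> I then \<psi> (if \<tau> n \<omega> \<le> ereal t then \<xi> n \<omega> else 0) else 0) \<in> borel_measurable (F t)"
    proof (rule measurable_cong)
      fix \<omega> assume "\<omega> \<in> space (F t)"
      then have \<omega>: "\<omega> \<in> space M" by simp
      have "(\<Sum>n. if n \<in> I then \<psi> (if \<tau> n \<omega> \<le> ereal t then \<xi> n \<omega> else 0) else 0) =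
          (\<Sum>n | \<tau> n \<omega> \<le> ereal t. if n \<in> I then \<psi> (if \<tau> n \<omega> \<le> ereal t then \<xi> n \<omega> else 0) else 0)"
        by (rule suminf_finite) (use band_path.finite_times[OF band_path[OF \<omega>]] \<psi>(2) in auto)
      also have "\<dots> = part \<psi> I t \<omega>" unfolding part_def by (intro sum.cong) auto
      finally show "part \<psi> I t \<omega> = (\<Sum>n. if n \<in> I then \<psi> (if \<tau> n \<omega> \<le> ereal t then \<xi> n \<omega> else 0) else 0)" ..
    qed
    moreover have "(\<lambda>\<omega>. \<Sum>n. if n \<in> I then \<psi> (if \<tau> n \<omega> \<le> ereal t then \<xi> n \<omega> else 0) else 0) \<in> borel_measurable (F t)"
      by measurable
    ultimately show ?thesis by simp
  qed
  then show "control_process M F (part \<psi> I)"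
    using step(1) by (auto simp: control_process_def adapted_def control_path_def)
qed

lemma signed_parts: "(\<lambda>y::real. max 0 y) \<in> borel_measurable borel" "(\<lambda>y::real. max 0 (- y)) \<in> borel_measurable borel"
  by measurable

text \<open>Makes the truncated policy trivially feasible and dominates its grid sums.\<close>

lemma part_truncated_bounds:
  assumes \<psi>: "\<And>y. 0 \<le> \<psi> y" "\<And>y. \<psi> y \<le> \<bar>y\<bar>" and \<omega>: "\<omega> \<in> space M"
  shows "part \<psi> {..N} t \<omega> \<le> real (Suc N) * (\<bar>\<xi>0\<bar> + (D - d) + (u - U))"
    and "card {n. \<tau> n \<omega> \<le> ereal t \<and> 0 < (if n \<in> {..N} then \<psi> (\<xi> n \<omega>) else 0)} \<le> Suc N"
proof -
  have b: "\<psi> (\<xi> n \<omega>) \<le> \<bar>\<xi>0\<bar> + (D - d) + (u - U)" for n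
    using \<psi>(2)[of "\<xi> n \<omega>"] band_path.adjustment_bound[OF band_path[OF \<omega>], of n] netput_path(2)[OF \<omega>] by simp
  have "part \<psi> {..N} t \<omega> = (\<Sum>n \<in> {n. \<tau> n \<omega> \<le> ereal t} \<inter> {..N}. \<psi> (\<xi> n \<omega>))"
    unfolding part_def by (rule sum.inter_restrict[symmetric, OF band_path.finite_times[OF band_path[OF \<omega>]]])
  also have "\<dots> \<le> (\<Sum>n\<le>N. \<psi> (\<xi> n \<omega>))" by (intro sum_mono2) (auto intro: \<psi>(1))
  also have "\<dots> \<le> (\<Sum>n\<le>N. \<bar>\<xi>0\<bar> + (D - d) + (u - U))" by (intro sum_mono b)
  finally show "part \<psi> {..N} t \<omega> \<le> real (Suc N) * (\<bar>\<xi>0\<bar> + (D - d) + (u - U))" by simp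
  have "card {n. \<tau> n \<omega> \<le> ereal t \<and> 0 < (if n \<in> {..N} then \<psi> (\<xi> n \<omega>) else 0)} \<le> card {..N}"
    by (intro card_mono) auto
  then show "card {n. \<tau> n \<omega> \<le> ereal t \<and> 0 < (if n \<in> {..N} then \<psi> (\<xi> n \<omega>) else 0)} \<le> Suc N" by simp
qed

lemma feasible_truncated: "feasible M F (policy {..N})"
proof -
  have "control_process M F (part \<psi> {..N}) \<and> (\<forall>t\<ge>0. (\<integral>\<^sup>+\<omega>. ennreal (part \<psi> {..N} t \<omega>) \<partial>M) < \<infinity> \<and>
      (\<integral>\<^sup>+\<omega>. num_adjustments (\<lambda>s. part \<psi> {..N} s \<omega>) t \<partial>M) < \<infinity>)"
    if \<psi>: "\<And>y. 0 \<le> \<psi> y" "\<And>y. \<psi> y \<le> \<bar>y\<bar>" "\<psi> \<in> borel_measurable borel" for \<psi> :: "real \<Rightarrow> real"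
  proof (intro conjI allI impI)
    have \<psi>0: "\<psi> 0 = 0" using \<psi>(1,2)[of 0] by simp
    show "control_process M F (part \<psi> {..N})" by (rule part_properties(1)[OF \<psi>(1) \<psi>0 \<psi>(3)])
    fix t
    have "(\<integral>\<^sup>+\<omega>. ennreal (part \<psi> {..N} t \<omega>) \<partial>M) \<le> (\<integral>\<^sup>+\<omega>. ennreal (real (Suc N) * (\<bar>\<xi>0\<bar> + (D - d) + (u - U))) \<partial>M)"
      by (intro nn_integral_mono ennreal_leI part_truncated_bounds(1) \<psi>)
    also have "\<dots> < \<infinity>" by (simp add: emeasure_space_1)
    finally show "(\<integral>\<^sup>+\<omega>. ennreal (part \<psi> {..N} t \<omega>) \<partial>M) < \<infinity>" .
    have "(\<integral>\<^sup>+\<omega>. num_adjustments (\<lambda>s. part \<psi> {..N} s \<omega>) t \<partial>M) \<le> (\<integral>\<^sup>+\<omega>. of_nat (Suc N) \<partial>M)"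
      by (intro nn_integral_mono order_trans[OF part_properties(2)[OF \<psi>(1) \<psi>0 \<psi>(3)]] of_nat_mono part_truncated_bounds(2) \<psi>(1,2))
    also have "\<dots> < \<infinity>" by (simp add: emeasure_space_1 ennreal_of_nat_eq_real_of_nat del: of_nat_Suc)
    finally show "(\<integral>\<^sup>+\<omega>. num_adjustments (\<lambda>s. part \<psi> {..N} s \<omega>) t \<partial>M) < \<infinity>" .
  qed
  from this[OF _ _ signed_parts(1)] this[OF _ _ signed_parts(2)] show ?thesis
    by (auto simp: feasible_def policy_def)
qed

lemma inventory_policy:
  "inventory \<mu> \<sigma> W x (policy I) t \<omega> = traj \<omega> t + (\<Sum>n | \<tau> n \<omega> \<le> ereal t. if n \<in> I then \<xi> n \<omega> else 0)"
proof -
  have "(\<Sum>n | \<tau> n \<omega> \<le> ereal t. if n \<in> I then \<xi> n \<omega> else 0) =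
      (\<Sum>n | \<tau> n \<omega> \<le> ereal t. (if n \<in> I then max 0 (\<xi> n \<omega>) else 0) - (if n \<in> I then max 0 (- \<xi> n \<omega>) else 0))"
    by (intro sum.cong) auto
  then show ?thesis by (simp add: inventory_def policy_def part_def sum_subtractf)
qed

lemma inventory_truncated:
  assumes \<omega>: "\<omega> \<in> space M"
  shows "inventory \<mu> \<sigma> W x (policy {..N}) t \<omega> = traj \<omega> t + band_path.cumulative d D U u (traj \<omega>) N t"
proof -
  have "(\<Sum>n | \<tau> n \<omega> \<le> ereal t. if n \<in> {..N} then \<xi> n \<omega> else 0) = (\<Sum>n \<in> {n. \<tau> n \<omega> \<le> ereal t} \<inter> {..N}. \<xi> n \<omega>)"
    by (rule sum.inter_restrict[symmetric, OF band_path.finite_times[OF band_path[OF \<omega>]]])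
  also have "{n. \<tau> n \<omega> \<le> ereal t} \<inter> {..N} = {n. n \<le> N \<and> \<tau> n \<omega> \<le> ereal t}" by auto
  finally show ?thesis
    by (simp add: inventory_policy band_path.cumulative_def[OF band_path[OF \<omega>]])
qed

text \<open>A path makes finitely many adjustments up to time \<open>t\<close>.\<close>

lemma inventory_eventually_truncated:
  assumes \<omega>: "\<omega> \<in> space M"
  shows "\<exists>N0. \<forall>N\<ge>N0. \<forall>s\<le>t. inventory \<mu> \<sigma> W x (policy {..N}) s \<omega> = inventory \<mu> \<sigma> W x (policy UNIV) s \<omega>"
proof -
  obtain N0 where N0: "\<And>n. \<tau> n \<omega> \<le> ereal t \<Longrightarrow> n \<le> N0"
    using band_path.finite_times[OF band_path[OF \<omega>], of t] unfolding finite_nat_set_iff_bounded_le by auto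
  have "inventory \<mu> \<sigma> W x (policy {..N}) s \<omega> = inventory \<mu> \<sigma> W x (policy UNIV) s \<omega>" if "N0 \<le> N" "s \<le> t" for N s
  proof -
    have "n \<le> N" if "\<tau> n \<omega> \<le> ereal s" for n
      using N0[of n] that \<open>N0 \<le> N\<close> \<open>s \<le> t\<close> order_trans[of "\<tau> n \<omega>" "ereal s" "ereal t"] by simp
    then show ?thesis unfolding inventory_policy by (intro arg_cong2[where f = "(+)"] sum.cong) auto
  qed
  then show ?thesis by blast
qed

lemma inventory_in_band:
  assumes \<omega>: "\<omega> \<in> space M" and "0 \<le> t"
  shows "d < inventory \<mu> \<sigma> W x (policy UNIV) t \<omega>" "inventory \<mu> \<sigma> W x (policy UNIV) t \<omega> < u"
  using band_path.cumulative_in_band[OF band_path[OF \<omega>] assms(2)] by (simp_all add: inventory_policy)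

end

section \<open>Cost of the control band policy\<close>

locale optimal_band = netput_space M F W \<mu> \<sigma> + band_problem \<mu> \<sigma> K L k l a A B d D U u h g
  for M :: "'a measure" and F W \<mu> \<sigma> K L k l a A B d D U u h g +
  fixes x :: real

sublocale optimal_band \<subseteq> band_control M F W \<mu> \<sigma> d D U u x
  by unfold_locales (fact order)+

sublocale optimal_band \<subseteq> netput_test M F W \<mu> \<sigma> f p q P Q "{d, u}"
  by (intro netput_test.intro test_function netput_space_axioms)

context optimal_band begin

definition adjustment_cost :: "real \<Rightarrow> real" where
  "adjustment_cost y = (if 0 < y then K + k * y else if y < 0 then L - l * y else 0)"

lemma adjustment_cost_nonneg: "0 \<le> adjustment_cost y"
  using pos mult_pos_pos[of k y] mult_pos_neg[of l y] by (auto simp: adjustment_cost_def)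

lemma adjustment_cost_meas [measurable]: "adjustment_cost \<in> borel_measurable borel"
  unfolding adjustment_cost_def[abs_def] by measurable

text \<open>
  Cost of the adjustment with index \<open>Suc n\<close> if it is made up to time \<open>t\<close>. The initial adjustment is not of the
  form \<open>d \<rightarrow> D\<close> or \<open>u \<rightarrow> U\<close> and is accounted for separately.
\<close>

definition stage_cost :: "nat \<Rightarrow> real \<Rightarrow> 'a \<Rightarrow> real" where
  "stage_cost n t \<omega> = (if \<tau> (Suc n) \<omega> \<le> ereal t then adjustment_cost (\<xi> (Suc n) \<omega>) else 0)"

lemma stage_cost_nonneg: "0 \<le> stage_cost n t \<omega>"
  by (simp add: stage_cost_def adjustment_cost_nonneg)

lemma stage_cost_meas: "0 \<le> t \<Longrightarrow> stage_cost n t \<in> borel_measurable M"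
proof -
  assume t: "0 \<le> t"
  have [measurable]: "(\<lambda>\<omega>. if \<tau> (Suc n) \<omega> \<le> ereal t then \<xi> (Suc n) \<omega> else 0) \<in> borel_measurable M"
    using band_measurable[OF t] F_measurable_M by blast
  have "stage_cost n t = (\<lambda>\<omega>. adjustment_cost (if \<tau> (Suc n) \<omega> \<le> ereal t then \<xi> (Suc n) \<omega> else 0))"
    by (auto simp: stage_cost_def adjustment_cost_def fun_eq_iff)
  then show ?thesis by simp
qed

text \<open>The area conditions enter here with equality: at these adjustments \<open>f\<close> drops by exactly their cost.\<close>

lemma jump_value:
  assumes \<omega>: "\<omega> \<in> space M" and "\<tau> (Suc n) \<omega> \<le> ereal t"
  shows "f (traj \<omega> (real_of_ereal (\<tau> (Suc n) \<omega>)) + lev (Suc n) \<omega>) - f (traj \<omega> (real_of_ereal (\<tau> (Suc n) \<omega>)) + lev n \<omega>)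
     = - stage_cost n t \<omega>"
proof -
  obtain s where s: "\<tau> (Suc n) \<omega> = ereal s"
    using assms(2) \<tau>_nonneg[OF \<omega>, of "Suc n"] by (cases "\<tau> (Suc n) \<omega>") auto
  have lev: "lev (Suc n) \<omega> = lev n \<omega> + \<xi> (Suc n) \<omega>" by (rule band_path.band_Suc(3)[OF band_path[OF \<omega>]])
  have "(traj \<omega> s + lev n \<omega> = d \<and> \<xi> (Suc n) \<omega> = D - d) \<or> (traj \<omega> s + lev n \<omega> = u \<and> \<xi> (Suc n) \<omega> = U - u)"
    by (rule band_path.band_step[OF band_path[OF \<omega>] s])
  then show ?thesis
  proof
    assume low: "traj \<omega> s + lev n \<omega> = d \<and> \<xi> (Suc n) \<omega> = D - d"
    then have "traj \<omega> s + lev (Suc n) \<omega> = D" using lev by simp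
    then show ?thesis
      using low raise_costs(1) order assms(2) s by (simp add: stage_cost_def adjustment_cost_def)
  next
    assume high: "traj \<omega> s + lev n \<omega> = u \<and> \<xi> (Suc n) \<omega> = U - u"
    then have "traj \<omega> s + lev (Suc n) \<omega> = U" using lev by simp
    moreover have "stage_cost n t \<omega> = L - l * (U - u)"
      using high order assms(2) by (simp add: stage_cost_def adjustment_cost_def)
    ultimately show ?thesis
      using high lower_costs(1) s by (simp add: right_diff_distrib)
  qed
qed

abbreviation "Zt N \<equiv> inventory \<mu> \<sigma> W x (policy {..N})"
abbreviation "Zb \<equiv> inventory \<mu> \<sigma> W x (policy UNIV)"

lemma truncated_controlled: "controlled M F W \<sigma> f p q P Q {d, u} (policy {..N})"
  by (intro controlled.intro controlled_axioms.intro feasible_truncated netput_test_axioms)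

text \<open>
  For the truncated policy the grid sums converge pathwise to the sum of the jump values. They are bounded,
  because \<open>f\<close> is Lipschitz and the total adjustment of at most \<open>Suc N\<close> jumps is bounded. So \<open>discrete_ito\<close>
  identifies the expected cost.
\<close>

lemma truncated_balance:
  assumes t: "0 < t"
  shows "integrable M (\<lambda>\<omega>. \<Sum>n<N. stage_cost n t \<omega>)"
    and "expectation (\<lambda>\<omega>. \<Sum>n<N. stage_cost n t \<omega>) = f (x + \<xi>0) - expectation (\<lambda>\<omega>. f (Zt N t \<omega>))
       + expectation (\<lambda>\<omega>. LINT r:{0..t}|lborel. gen (Zt N (max 0 r) \<omega>))"
proof -
  interpret C: controlled M F W \<mu> \<sigma> f p q P Q "{d, u}" "policy {..N}" x
    by (rule truncated_controlled)
  define b where "b = \<bar>\<xi>0\<bar> + (D - d) + (u - U)"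
  define S where "S \<omega> = (\<Sum>n<N. stage_cost n t \<omega>)" for \<omega>
  have [measurable]: "S \<in> borel_measurable M"
    using stage_cost_meas[of t] t unfolding S_def[abs_def] by (intro borel_measurable_sum) auto
  have lim: "(\<lambda>m. C.jump_sum t (Suc m) \<omega>) \<longlonglongrightarrow> - S \<omega>" if \<omega>: "\<omega> \<in> space M" for \<omega>
  proof -
    interpret B: band_path d D U u "traj \<omega>" by (rule band_path[OF \<omega>])
    have "C.jump_sum t (Suc m) \<omega> = (\<Sum>i<Suc m. f (traj \<omega> (grid t (Suc m) (Suc i)) + B.cumulative N (grid t (Suc m) (Suc i)))
                - f (traj \<omega> (grid t (Suc m) (Suc i)) + B.cumulative N (grid t (Suc m) i)))" for m
      unfolding C.jump_sum_def inventory_truncated[OF \<omega>]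
      by (intro sum.cong refl arg_cong2[where f = "(-)"] arg_cong[where f = f]) simp
    moreover have "(\<Sum>n | n < N \<and> \<tau> (Suc n) \<omega> \<le> ereal t.
            f (traj \<omega> (real_of_ereal (\<tau> (Suc n) \<omega>)) + lev (Suc n) \<omega>) - f (traj \<omega> (real_of_ereal (\<tau> (Suc n) \<omega>)) + lev n \<omega>)) = - S \<omega>"
    proof -
      have "(\<Sum>n | n < N \<and> \<tau> (Suc n) \<omega> \<le> ereal t.
            f (traj \<omega> (real_of_ereal (\<tau> (Suc n) \<omega>)) + lev (Suc n) \<omega>) - f (traj \<omega> (real_of_ereal (\<tau> (Suc n) \<omega>)) + lev n \<omega>))
          = (\<Sum>n | n < N \<and> \<tau> (Suc n) \<omega> \<le> ereal t. - stage_cost n t \<omega>)"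
        by (intro sum.cong) (auto intro: jump_value[OF \<omega>])
      also have "\<dots> = (\<Sum>n<N. - stage_cost n t \<omega>)"
        by (intro sum.mono_neutral_left) (auto simp: stage_cost_def)
      finally show ?thesis by (simp add: S_def sum_negf)
    qed
    ultimately show ?thesis using B.grid_jump_sum_limit[OF f_cont t, of N] by simp
  qed
  have bound: "\<bar>C.jump_sum t (Suc m) \<omega>\<bar> \<le> P * (2 * (real (Suc N) * b))" if \<omega>: "\<omega> \<in> space M" for m \<omega>
  proof -
    let ?g = "grid t (Suc m)" and ?a = "\<lambda>s. fst (policy {..N}) s \<omega>" and ?c = "\<lambda>s. snd (policy {..N}) s \<omega>"
    have a: "control_path ?a" and c: "control_path ?c" using C.Y_path[OF _ \<omega>] by auto
    have mono: "y (?g i) \<le> y (?g (Suc i))" if "control_path y" for y i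
      using t by (intro control_path_mono[OF that] grid_mono) auto
    have "\<bar>C.jump_sum t (Suc m) \<omega>\<bar> \<le> (\<Sum>i<Suc m. P * ((?a (?g (Suc i)) - ?a (?g i)) + (?c (?g (Suc i)) - ?c (?g i))))"
      unfolding C.jump_sum_def
    proof (rule order_trans[OF sum_abs sum_mono])
      fix i
      have "\<bar>Zt N (?g (Suc i)) \<omega> - (Zt N (?g i) \<omega> + (traj \<omega> (?g (Suc i)) - traj \<omega> (?g i)))\<bar>
          \<le> (?a (?g (Suc i)) - ?a (?g i)) + (?c (?g (Suc i)) - ?c (?g i))"
        using mono[OF a, of i] mono[OF c, of i] by (simp add: C.Z_eq)
      then show "\<bar>f (Zt N (?g (Suc i)) \<omega>) - f (Zt N (?g i) \<omega> + (traj \<omega> (?g (Suc i)) - traj \<omega> (?g i)))\<bar>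
          \<le> P * ((?a (?g (Suc i)) - ?a (?g i)) + (?c (?g (Suc i)) - ?c (?g i)))"
        using P_nonneg by (intro order_trans[OF f_lipschitz] mult_left_mono)
    qed
    also have "\<dots> = P * ((?a t - ?a 0) + (?c t - ?c 0))"
      using sum_lessThan_telescope[of "\<lambda>i. ?a (?g i)" "Suc m"] sum_lessThan_telescope[of "\<lambda>i. ?c (?g i)" "Suc m"]
      by (simp only: sum_distrib_left[symmetric] sum.distrib grid_0 grid_end[OF zero_less_Suc])
    also have "\<dots> \<le> P * (2 * (real (Suc N) * b))"
    proof (rule mult_left_mono[OF _ P_nonneg])
      have "0 \<le> ?a 0" "0 \<le> ?c 0" using a c by (auto simp: control_path_def)
      moreover have "?a t \<le> real (Suc N) * b" "?c t \<le> real (Suc N) * b"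
        unfolding policy_def b_def fst_conv snd_conv by (intro part_truncated_bounds(1) \<omega>; simp)+
      ultimately show "(?a t - ?a 0) + (?c t - ?c 0) \<le> 2 * (real (Suc N) * b)" by linarith
    qed
    finally show ?thesis .
  qed
  have jm: "random_variable borel (C.jump_sum t (Suc m))" for m
    using C.integrable_jump_sum[of t "Suc m"] t by auto
  note dc = integral_dominated_convergence[where M = M and f = "\<lambda>\<omega>. - S \<omega>" and s = "\<lambda>m. C.jump_sum t (Suc m)"
      and w = "\<lambda>_. P * (2 * (real (Suc N) * b))"]
    integrable_dominated_convergence[where M = M and f = "\<lambda>\<omega>. - S \<omega>" and s = "\<lambda>m. C.jump_sum t (Suc m)"
      and w = "\<lambda>_. P * (2 * (real (Suc N) * b))"]
  have "integrable M (\<lambda>\<omega>. - S \<omega>)"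
    by (rule dc(2)) (use lim bound jm in \<open>auto intro!: AE_I2\<close>)
  then have iS: "integrable M S" by simp
  then show "integrable M (\<lambda>\<omega>. \<Sum>n<N. stage_cost n t \<omega>)" by (simp add: S_def[abs_def])
  have "(\<lambda>m. expectation (C.jump_sum t (Suc m))) \<longlonglongrightarrow> expectation (\<lambda>\<omega>. - S \<omega>)"
    by (rule dc(1)) (use lim bound jm in \<open>auto intro!: AE_I2\<close>)
  from LIMSEQ_unique[OF this C.discrete_ito[OF t]]
  have "- expectation S = expectation (\<lambda>\<omega>. f (Zt N t \<omega>)) - expectation (\<lambda>\<omega>. f (Zt N 0 \<omega>))
       - expectation (\<lambda>\<omega>. LINT r:{0..t}|lborel. gen (Zt N (max 0 r) \<omega>))" by simp
  moreover have "expectation (\<lambda>\<omega>. f (Zt N 0 \<omega>)) = expectation (\<lambda>\<omega>. f (x + \<xi>0))"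
  proof (rule Bochner_Integration.integral_cong[OF refl])
    fix \<omega> assume \<omega>: "\<omega> \<in> space M"
    show "f (Zt N 0 \<omega>) = f (x + \<xi>0)"
      unfolding inventory_truncated[OF \<omega>] band_path.cumulative_at_0[OF band_path[OF \<omega>]]
        band_path.band_0(3)[OF band_path[OF \<omega>]] netput_path(2)[OF \<omega>] ..
  qed
  ultimately show "expectation (\<lambda>\<omega>. \<Sum>n<N. stage_cost n t \<omega>) = f (x + \<xi>0) - expectation (\<lambda>\<omega>. f (Zt N t \<omega>))
       + expectation (\<lambda>\<omega>. LINT r:{0..t}|lborel. gen (Zt N (max 0 r) \<omega>))"
    by (simp add: S_def[abs_def] prob_space)
qed

definition G :: "real \<Rightarrow> 'a \<Rightarrow> real" where
  "G t \<omega> = (LINT r:{0..t}|lborel. gen (Zb (max 0 r) \<omega>))"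

text \<open>Every path is left unchanged up to time \<open>t\<close> once \<open>N\<close> exceeds its number of adjustments.\<close>

lemma G_limit:
  assumes t: "0 < t"
  shows "integrable M (G t)"
    and "(\<lambda>N. expectation (\<lambda>\<omega>. LINT r:{0..t}|lborel. gen (Zt N (max 0 r) \<omega>))) \<longlonglongrightarrow> expectation (G t)"
    and "\<omega> \<in> space M \<Longrightarrow> set_integrable lborel {0..t} (\<lambda>r. gen (Zb (max 0 r) \<omega>))"
proof -
  (* the same integral along the truncated inventory *)
  define GN where "GN N \<omega> = (LINT r:{0..t}|lborel. gen (Zt N (max 0 r) \<omega>))" for N \<omega>
  have GN: "integrable M (GN N)" "\<omega> \<in> space M \<Longrightarrow> set_integrable lborel {0..t} (\<lambda>r. gen (Zt N (max 0 r) \<omega>))" for N \<omega>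
  proof -
    interpret C: controlled M F W \<mu> \<sigma> f p q P Q "{d, u}" "policy {..N}" x
      by (rule truncated_controlled)
    show "integrable M (GN N)" using C.gen_Z_time(1) by (simp add: GN_def[abs_def])
    show "\<omega> \<in> space M \<Longrightarrow> set_integrable lborel {0..t} (\<lambda>r. gen (Zt N (max 0 r) \<omega>))"
      by (rule C.gen_Z_time(3))
  qed
  have ev: "\<exists>N0. \<forall>N\<ge>N0. \<forall>r\<in>{0..t}. gen (Zb (max 0 r) \<omega>) = gen (Zt N (max 0 r) \<omega>)" if \<omega>: "\<omega> \<in> space M" for \<omega>
  proof -
    obtain N0 where N0: "\<And>N s. N0 \<le> N \<Longrightarrow> s \<le> t \<Longrightarrow> Zt N s \<omega> = Zb s \<omega>"
      using inventory_eventually_truncated[OF \<omega>, of t] by blast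
    show ?thesis by (intro exI[of _ N0] allI impI ballI) (simp add: N0)
  qed
  show int: "set_integrable lborel {0..t} (\<lambda>r. gen (Zb (max 0 r) \<omega>))" if \<omega>: "\<omega> \<in> space M" for \<omega>
  proof -
    obtain N where N: "\<And>r. r \<in> {0..t} \<Longrightarrow> gen (Zb (max 0 r) \<omega>) = gen (Zt N (max 0 r) \<omega>)" using ev[OF \<omega>] by blast
    show ?thesis
      by (rule set_integrable_cong[THEN iffD2, OF refl refl _ GN(2)[OF \<omega>]]) (rule N)
  qed
  have GN_lim: "(\<lambda>N. GN N \<omega>) \<longlonglongrightarrow> G t \<omega>" if \<omega>: "\<omega> \<in> space M" for \<omega>
  proof (rule tendsto_eventually)
    obtain N0 where N0: "\<And>N r. N0 \<le> N \<Longrightarrow> r \<in> {0..t} \<Longrightarrow> gen (Zb (max 0 r) \<omega>) = gen (Zt N (max 0 r) \<omega>)"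
      using ev[OF \<omega>] by blast
    have "GN N \<omega> = G t \<omega>" if "N0 \<le> N" for N
      unfolding GN_def G_def
      by (rule set_lebesgue_integral_cong, simp) (intro allI impI N0[OF that, symmetric])
    then show "\<forall>\<^sub>F N in sequentially. GN N \<omega> = G t \<omega>"
      unfolding eventually_sequentially by blast
  qed
  have GN_bound: "\<bar>GN N \<omega>\<bar> \<le> gen_bound * (t - 0)" if "\<omega> \<in> space M" for N \<omega>
    unfolding GN_def using t by (intro abs_set_integral_le GN(2) that gen_bounded) simp
  have Gm: "G t \<in> borel_measurable M"
    by (rule borel_measurable_LIMSEQ_real[OF GN_lim]) (use GN(1) in auto)
  have GNm: "GN N \<in> borel_measurable M" for N using GN(1)[of N] by auto
  show "integrable M (G t)"
    by (rule integrable_dominated_convergence[where s = GN and w = "\<lambda>_. gen_bound * (t - 0)"])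
       (use Gm GNm GN_lim GN_bound in \<open>auto intro!: AE_I2\<close>)
  have "(\<lambda>N. expectation (GN N)) \<longlonglongrightarrow> expectation (G t)"
    by (rule integral_dominated_convergence[where s = GN and w = "\<lambda>_. gen_bound * (t - 0)"])
       (use Gm GNm GN_lim GN_bound in \<open>auto intro!: AE_I2\<close>)
  then show "(\<lambda>N. expectation (\<lambda>\<omega>. LINT r:{0..t}|lborel. gen (Zt N (max 0 r) \<omega>))) \<longlonglongrightarrow> expectation (G t)"
    by (simp add: GN_def[abs_def])
qed

definition all_stages :: "real \<Rightarrow> 'a \<Rightarrow> ennreal" where
  "all_stages t \<omega> = (\<Sum>n. ennreal (stage_cost n t \<omega>))"

text \<open>
  The balance for the truncated policy with \<open>E (f (Z t))\<close> replaced by a lower bound \<open>b\<close> of \<open>f\<close>. This avoids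
  any control of the truncated inventory at time \<open>t\<close>, which may have left the band.
\<close>

lemma all_stages_bound:
  assumes t: "0 < t" and b: "\<And>z. b \<le> f z"
  shows "(\<integral>\<^sup>+\<omega>. all_stages t \<omega> \<partial>M) \<le> ennreal (f (x + \<xi>0) - b + expectation (G t))"
    and "0 \<le> f (x + \<xi>0) - b + expectation (G t)"
proof -
  define R where "R N = f (x + \<xi>0) - b + expectation (\<lambda>\<omega>. LINT r:{0..t}|lborel. gen (Zt N (max 0 r) \<omega>))" for N
  have R: "R \<longlonglongrightarrow> f (x + \<xi>0) - b + expectation (G t)"
    unfolding R_def by (intro tendsto_intros G_limit(2) t)
  have le: "expectation (\<lambda>\<omega>. \<Sum>n<N. stage_cost n t \<omega>) \<le> R N" for N
  proof -
    interpret C: controlled M F W \<mu> \<sigma> f p q P Q "{d, u}" "policy {..N}" x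
      by (rule truncated_controlled)
    have "expectation (\<lambda>\<omega>. b) \<le> expectation (\<lambda>\<omega>. f (Zt N t \<omega>))"
      using t by (intro integral_mono b C.integrable_f_Z) auto
    then show ?thesis unfolding truncated_balance(2)[OF t] R_def by (simp add: prob_space)
  qed
  have nn: "0 \<le> expectation (\<lambda>\<omega>. \<Sum>n<N. stage_cost n t \<omega>)" for N
    by (intro integral_nonneg_AE AE_I2 sum_nonneg stage_cost_nonneg)
  show "0 \<le> f (x + \<xi>0) - b + expectation (G t)"
    by (rule LIMSEQ_le_const[OF R]) (use order_trans[OF nn le] in blast)
  have "(\<integral>\<^sup>+\<omega>. all_stages t \<omega> \<partial>M) = (\<Sum>n. \<integral>\<^sup>+\<omega>. ennreal (stage_cost n t \<omega>) \<partial>M)"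
    unfolding all_stages_def using stage_cost_meas t by (intro nn_integral_suminf) auto
  also have "\<dots> \<le> ennreal (f (x + \<xi>0) - b + expectation (G t))"
  proof (rule LIMSEQ_le[OF summable_LIMSEQ tendsto_ennrealI[OF R]])
    show "\<exists>N. \<forall>n\<ge>N. (\<Sum>i<n. \<integral>\<^sup>+\<omega>. ennreal (stage_cost i t \<omega>) \<partial>M) \<le> ennreal (R n)"
    proof (intro exI allI impI)
      fix N
      have "(\<Sum>i<N. \<integral>\<^sup>+\<omega>. ennreal (stage_cost i t \<omega>) \<partial>M) = (\<integral>\<^sup>+\<omega>. (\<Sum>i<N. ennreal (stage_cost i t \<omega>)) \<partial>M)"
        using stage_cost_meas t by (intro nn_integral_sum[symmetric]) auto
      also have "\<dots> = (\<integral>\<^sup>+\<omega>. ennreal (\<Sum>i<N. stage_cost i t \<omega>) \<partial>M)"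
        by (intro nn_integral_cong sum_ennreal stage_cost_nonneg)
      also have "\<dots> = ennreal (expectation (\<lambda>\<omega>. \<Sum>n<N. stage_cost n t \<omega>))"
        by (intro nn_integral_eq_integral truncated_balance(1) t AE_I2 sum_nonneg stage_cost_nonneg)
      also have "\<dots> \<le> ennreal (R N)" by (rule ennreal_leI[OF le])
      finally show "(\<Sum>i<N. \<integral>\<^sup>+\<omega>. ennreal (stage_cost i t \<omega>) \<partial>M) \<le> ennreal (R N)" .
    qed
  qed simp
  finally show "(\<integral>\<^sup>+\<omega>. all_stages t \<omega> \<partial>M) \<le> ennreal (f (x + \<xi>0) - b + expectation (G t))" .
qed

text \<open>Bounds the cost of the initial adjustment, whichever direction it has.\<close>

definition initial_cost :: real where
  "initial_cost = K + L + k * \<bar>\<xi>0\<bar> + l * \<bar>\<xi>0\<bar>"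

lemma adjustment_costs_le:
  assumes \<omega>: "\<omega> \<in> space M" and t: "0 < t"
  shows "ennreal K * num_adjustments (\<lambda>s. fst (policy UNIV) s \<omega>) t
       + ennreal L * num_adjustments (\<lambda>s. snd (policy UNIV) s \<omega>) t
       + ennreal (k * fst (policy UNIV) t \<omega>) + ennreal (l * snd (policy UNIV) t \<omega>)
     \<le> ennreal initial_cost + all_stages t \<omega>"
proof -
  interpret B: band_path d D U u "traj \<omega>" by (rule band_path[OF \<omega>])
  define I where "I = {n. \<tau> n \<omega> \<le> ereal t}"
  have fin: "finite I" unfolding I_def by (rule B.finite_times)
  define up where "up y = max 0 y" for y :: real
  define dn where "dn y = max 0 (- y)" for y :: real
  have parts: "fst (policy UNIV) = part up UNIV" "snd (policy UNIV) = part dn UNIV"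
    by (simp_all add: policy_def up_def[abs_def] dn_def[abs_def])
  have ind: "ennreal C * num_adjustments (\<lambda>s. part \<psi> UNIV s \<omega>) t \<le> ennreal (\<Sum>n\<in>I. C * of_bool (0 < \<psi> (\<xi> n \<omega>)))"
    if "0 < C" "\<And>y. 0 \<le> \<psi> y" "\<psi> 0 = 0" "\<psi> \<in> borel_measurable borel" for C \<psi>
  proof -
    have "num_adjustments (\<lambda>s. part \<psi> UNIV s \<omega>) t \<le> of_nat (card {n. \<tau> n \<omega> \<le> ereal t \<and> 0 < \<psi> (\<xi> n \<omega>)})"
      using part_properties(2)[OF that(2-4) \<omega>, of UNIV t] by simp
    also have "{n. \<tau> n \<omega> \<le> ereal t \<and> 0 < \<psi> (\<xi> n \<omega>)} = I \<inter> {n. 0 < \<psi> (\<xi> n \<omega>)}" by (auto simp: I_def)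
    also have "of_nat (card (I \<inter> {n. 0 < \<psi> (\<xi> n \<omega>)})) = ennreal (\<Sum>n\<in>I. of_bool (0 < \<psi> (\<xi> n \<omega>)))"
      using fin by (simp add: sum_of_bool_eq ennreal_of_nat_eq_real_of_nat)
    finally have "ennreal C * num_adjustments (\<lambda>s. part \<psi> UNIV s \<omega>) t \<le> ennreal C * ennreal (\<Sum>n\<in>I. of_bool (0 < \<psi> (\<xi> n \<omega>)))"
      by (rule mult_left_mono) simp
    also have "\<dots> = ennreal (\<Sum>n\<in>I. C * of_bool (0 < \<psi> (\<xi> n \<omega>)))"
      using that(1) by (simp add: ennreal_mult'[symmetric] sum_distrib_left)
    finally show ?thesis .
  qed
  have amount: "C * part \<psi> UNIV t \<omega> = (\<Sum>n\<in>I. C * \<psi> (\<xi> n \<omega>))" for C \<psi>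
    by (simp add: part_def I_def sum_distrib_left)
  have m: "up \<in> borel_measurable borel" "dn \<in> borel_measurable borel"
    using signed_parts by (simp_all add: up_def[abs_def] dn_def[abs_def])
  have "ennreal K * num_adjustments (\<lambda>s. fst (policy UNIV) s \<omega>) t
       + ennreal L * num_adjustments (\<lambda>s. snd (policy UNIV) s \<omega>) t
       + ennreal (k * fst (policy UNIV) t \<omega>) + ennreal (l * snd (policy UNIV) t \<omega>)
     \<le> ennreal (\<Sum>n\<in>I. K * of_bool (0 < up (\<xi> n \<omega>))) + ennreal (\<Sum>n\<in>I. L * of_bool (0 < dn (\<xi> n \<omega>)))
       + ennreal (\<Sum>n\<in>I. k * up (\<xi> n \<omega>)) + ennreal (\<Sum>n\<in>I. l * dn (\<xi> n \<omega>))"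
    unfolding parts amount using pos m by (intro add_mono ind order_refl) (auto simp: up_def dn_def)
  also have "\<dots> = ennreal (\<Sum>n\<in>I. adjustment_cost (\<xi> n \<omega>))"
  proof -
    have cost: "adjustment_cost y = K * of_bool (0 < up y) + L * of_bool (0 < dn y) + k * up y + l * dn y" for y
      by (auto simp: adjustment_cost_def up_def dn_def)
    have nn: "0 \<le> (\<Sum>n\<in>I. K * of_bool (0 < up (\<xi> n \<omega>)))" "0 \<le> (\<Sum>n\<in>I. L * of_bool (0 < dn (\<xi> n \<omega>)))"
        "0 \<le> (\<Sum>n\<in>I. k * up (\<xi> n \<omega>))" "0 \<le> (\<Sum>n\<in>I. l * dn (\<xi> n \<omega>))"
      using pos by (auto intro!: sum_nonneg mult_nonneg_nonneg simp: up_def dn_def)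
    show ?thesis unfolding cost sum.distrib using nn by (simp add: ennreal_plus add_nonneg_nonneg)
  qed
  also have "\<dots> \<le> ennreal (initial_cost + (\<Sum>n | \<tau> (Suc n) \<omega> \<le> ereal t. stage_cost n t \<omega>))"
  proof (rule ennreal_leI)
    define I' where "I' = {n. \<tau> (Suc n) \<omega> \<le> ereal t}"
    have "I = insert 0 (Suc ` I')"
      using B.band_0(1) t unfolding I_def I'_def by (auto simp: image_iff) (metis not0_implies_Suc)
    moreover have fin': "finite I'"
      using finite_vimageI[OF fin, of Suc] by (simp add: I_def I'_def vimage_def)
    ultimately have "(\<Sum>n\<in>I. adjustment_cost (\<xi> n \<omega>)) = adjustment_cost (\<xi> 0 \<omega>) + (\<Sum>n\<in>I'. adjustment_cost (\<xi> (Suc n) \<omega>))"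
      by (simp add: sum.reindex)
    also have "(\<Sum>n\<in>I'. adjustment_cost (\<xi> (Suc n) \<omega>)) = (\<Sum>n\<in>I'. stage_cost n t \<omega>)"
      by (intro sum.cong) (auto simp: stage_cost_def I'_def)
    also have "adjustment_cost (\<xi> 0 \<omega>) \<le> initial_cost"
    proof -
      have "\<xi> 0 \<omega> = \<xi>0" using B.band_0(2) netput_path(2)[OF \<omega>] by simp
      moreover have "0 \<le> k * \<bar>\<xi>0\<bar>" "0 \<le> l * \<bar>\<xi>0\<bar>" using pos by auto
      ultimately show ?thesis
        using pos mult_pos_neg[of k \<xi>0] mult_pos_pos[of l \<xi>0]
        by (auto simp: adjustment_cost_def initial_cost_def abs_if)
    qed
    finally show "(\<Sum>n\<in>I. adjustment_cost (\<xi> n \<omega>)) \<le> initial_cost + (\<Sum>n | \<tau> (Suc n) \<omega> \<le> ereal t. stage_cost n t \<omega>)"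
      by (simp add: I'_def)
  qed
  also have "\<dots> = ennreal initial_cost + ennreal (\<Sum>n | \<tau> (Suc n) \<omega> \<le> ereal t. stage_cost n t \<omega>)"
    using pos by (intro ennreal_plus sum_nonneg stage_cost_nonneg) (auto simp: initial_cost_def intro!: add_nonneg_nonneg mult_nonneg_nonneg)
  also have "ennreal (\<Sum>n | \<tau> (Suc n) \<omega> \<le> ereal t. stage_cost n t \<omega>) \<le> all_stages t \<omega>"
  proof -
    have fin': "finite {n. \<tau> (Suc n) \<omega> \<le> ereal t}"
      using finite_vimageI[OF fin, of Suc] by (simp add: I_def vimage_def)
    have "ennreal (\<Sum>n | \<tau> (Suc n) \<omega> \<le> ereal t. stage_cost n t \<omega>) = (\<Sum>n | \<tau> (Suc n) \<omega> \<le> ereal t. ennreal (stage_cost n t \<omega>))"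
      by (rule sum_ennreal[symmetric]) (rule stage_cost_nonneg)
    also have "\<dots> \<le> all_stages t \<omega>"
      unfolding all_stages_def by (rule sum_le_suminf[OF _ fin']) auto
    finally show ?thesis .
  qed
  finally show ?thesis by (simp add: add_left_mono)
qed

lemma initial_cost_nonneg: "0 \<le> initial_cost"
  using pos by (auto simp: initial_cost_def intro!: add_nonneg_nonneg mult_nonneg_nonneg)

lemma all_stages_meas: "0 < t \<Longrightarrow> all_stages t \<in> borel_measurable M"
  unfolding all_stages_def[abs_def] using stage_cost_meas by (intro borel_measurable_suminf_order measurable_compose[OF _ measurable_ennreal]) auto

lemma adjustment_integral_finite:
  assumes t: "0 < t"
  shows "(\<integral>\<^sup>+\<omega>. ennreal initial_cost + all_stages t \<omega> \<partial>M) < \<infinity>"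
proof -
  obtain b where "\<And>z. b \<le> f z" using f_bounded_below by blast
  note all_stages_bound(1)[OF t this]
  moreover have "(\<integral>\<^sup>+\<omega>. ennreal initial_cost + all_stages t \<omega> \<partial>M) = ennreal initial_cost + (\<integral>\<^sup>+\<omega>. all_stages t \<omega> \<partial>M)"
    using all_stages_meas[OF t] by (subst nn_integral_add) (auto simp: emeasure_space_1)
  ultimately show ?thesis by (auto simp: ennreal_add_less_top intro: le_less_trans)
qed

lemma feasible_band: "feasible M F (policy UNIV)"
proof -
  let ?H = "\<lambda>t \<omega>. ennreal initial_cost + all_stages t \<omega>"
  (* each component of the adjustment cost has a positive price, so it inherits the finite bound *)
  have scaled: "(\<integral>\<^sup>+\<omega>. V \<omega> \<partial>M) < \<infinity>" if t: "0 < t" and C: "0 < C" and le: "\<And>\<omega>. \<omega> \<in> space M \<Longrightarrow> ennreal C * V \<omega> \<le> ?H t \<omega>" for C t V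
  proof -
    have "V \<omega> \<le> ennreal (1 / C) * ?H t \<omega>" if "\<omega> \<in> space M" for \<omega>
    proof -
      have "V \<omega> = ennreal (1 / C) * (ennreal C * V \<omega>)"
        using C by (simp add: mult.assoc[symmetric] ennreal_mult'[symmetric])
      also have "\<dots> \<le> ennreal (1 / C) * ?H t \<omega>" by (rule mult_left_mono[OF le[OF that]]) simp
      finally show ?thesis .
    qed
    then have "(\<integral>\<^sup>+\<omega>. V \<omega> \<partial>M) \<le> (\<integral>\<^sup>+\<omega>. ennreal (1 / C) * ?H t \<omega> \<partial>M)" by (rule nn_integral_mono)
    also have "\<dots> = ennreal (1 / C) * (\<integral>\<^sup>+\<omega>. ?H t \<omega> \<partial>M)"
      using all_stages_meas[OF t] by (intro nn_integral_cmult) auto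
    also have "\<dots> < \<infinity>" using adjustment_integral_finite[OF t] by (simp add: ennreal_mult_less_top)
    finally show ?thesis .
  qed
  have le: "ennreal K * num_adjustments (\<lambda>s. fst (policy UNIV) s \<omega>) t \<le> ?H t \<omega>"
      "ennreal L * num_adjustments (\<lambda>s. snd (policy UNIV) s \<omega>) t \<le> ?H t \<omega>"
      "ennreal k * ennreal (fst (policy UNIV) t \<omega>) \<le> ?H t \<omega>"
      "ennreal l * ennreal (snd (policy UNIV) t \<omega>) \<le> ?H t \<omega>" if "0 < t" "\<omega> \<in> space M" for t \<omega>
  proof -
    have s: "a1 \<le> a1 + a2 + a3 + a4" "a2 \<le> a1 + a2 + a3 + a4" "a3 \<le> a1 + a2 + a3 + a4" "a4 \<le> a1 + a2 + a3 + a4"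
      for a1 a2 a3 a4 :: ennreal
      by (simp_all add: add_increasing add_increasing2)
    note b = adjustment_costs_le[OF that(2,1)]
    show "ennreal K * num_adjustments (\<lambda>s. fst (policy UNIV) s \<omega>) t \<le> ?H t \<omega>"
      by (rule order_trans[OF s(1) b])
    show "ennreal L * num_adjustments (\<lambda>s. snd (policy UNIV) s \<omega>) t \<le> ?H t \<omega>"
      by (rule order_trans[OF s(2) b])
    show "ennreal k * ennreal (fst (policy UNIV) t \<omega>) \<le> ?H t \<omega>"
      using order_trans[OF s(3) b] pos by (simp add: ennreal_mult')
    show "ennreal l * ennreal (snd (policy UNIV) t \<omega>) \<le> ?H t \<omega>"
      using order_trans[OF s(4) b] pos by (simp add: ennreal_mult')
  qed
  have process: "control_process M F (fst (policy UNIV))" "control_process M F (snd (policy UNIV))"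
    unfolding policy_def fst_conv snd_conv by (intro part_properties(1) signed_parts; simp)+
  have fin1: "(\<integral>\<^sup>+\<omega>. ennreal (Y t \<omega>) \<partial>M) < \<infinity> \<and> (\<integral>\<^sup>+\<omega>. num_adjustments (\<lambda>s. Y s \<omega>) t \<partial>M) < \<infinity>"
    if t: "0 < t" and Y: "Y \<in> {fst (policy UNIV), snd (policy UNIV)}" for t Y
    using Y scaled[OF t, of k "\<lambda>\<omega>. ennreal (fst (policy UNIV) t \<omega>)"] scaled[OF t, of l "\<lambda>\<omega>. ennreal (snd (policy UNIV) t \<omega>)"]
      scaled[OF t, of K "\<lambda>\<omega>. num_adjustments (\<lambda>s. fst (policy UNIV) s \<omega>) t"]
      scaled[OF t, of L "\<lambda>\<omega>. num_adjustments (\<lambda>s. snd (policy UNIV) s \<omega>) t"] le[OF t] pos by blast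
  have "(\<integral>\<^sup>+\<omega>. ennreal (Y t \<omega>) \<partial>M) < \<infinity> \<and> (\<integral>\<^sup>+\<omega>. num_adjustments (\<lambda>s. Y s \<omega>) t \<partial>M) < \<infinity>"
    if t: "0 \<le> t" and Y: "Y \<in> {fst (policy UNIV), snd (policy UNIV)}" for t Y
  proof -
    have cp: "control_process M F Y" using Y process by blast
    (* the cost bounds hold at positive times only; both quantities increase with time *)
    have "(\<integral>\<^sup>+\<omega>. ennreal (Y t \<omega>) \<partial>M) \<le> (\<integral>\<^sup>+\<omega>. ennreal (Y (t + 1) \<omega>) \<partial>M)"
      using cp t by (intro nn_integral_mono ennreal_leI) (auto simp: control_process_def mono_on_def)
    moreover have "(\<integral>\<^sup>+\<omega>. num_adjustments (\<lambda>s. Y s \<omega>) t \<partial>M) \<le> (\<integral>\<^sup>+\<omega>. num_adjustments (\<lambda>s. Y s \<omega>) (t + 1) \<partial>M)"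
      unfolding num_adjustments_def by (intro nn_integral_mono emeasure_mono) auto
    ultimately show ?thesis using fin1[OF _ Y, of "t + 1"] t by (auto intro: le_less_trans)
  qed
  then show ?thesis unfolding feasible_def using process by blast
qed

text \<open>
  On the band \<open>h = \<mu> * A - \<Gamma> f\<close>, so the holding cost is \<open>\<mu> * A * t - G t\<close>, and the expectation of \<open>G t\<close>
  cancels against the one in \<open>all_stages_bound\<close>.
\<close>

lemma band_cost_le:
  assumes t: "0 < t" and b: "\<And>z. b \<le> f z"
  shows "(\<integral>\<^sup>+\<omega>. total_cost (\<lambda>\<omega> s. Zb s \<omega>) h K L k l (policy UNIV) t \<omega> \<partial>M)
     \<le> ennreal (\<mu> * A * t + (f (x + \<xi>0) - b + initial_cost))"
proof -
  have hold: "(\<integral>\<^sup>+s\<in>{0..t}. ennreal (h (Zb s \<omega>)) \<partial>lborel) = ennreal (\<mu> * A * t - G t \<omega>)" "0 \<le> \<mu> * A * t - G t \<omega>"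
    if \<omega>: "\<omega> \<in> space M" for \<omega>
  proof -
    have iG: "set_integrable lborel {0..t} (\<lambda>r. gen (Zb (max 0 r) \<omega>))" by (rule G_limit(3)[OF t \<omega>])
    have ic: "set_integrable lborel {0..t} (\<lambda>r. \<mu> * A)"
      by (intro borel_integrable_atLeastAtMost' continuous_intros)
    have "(LINT r:{0..t}|lborel. \<mu> * A) = \<mu> * A * t" using t by (simp add: set_lebesgue_integral_def)
    then have eq: "\<mu> * A * t - G t \<omega> = (LINT r:{0..t}|lborel. \<mu> * A - gen (Zb (max 0 r) \<omega>))"
      unfolding set_integral_diff(2)[OF ic iG] by (simp only: G_def)
    have h: "\<mu> * A - gen (Zb (max 0 r) \<omega>) = h (Zb r \<omega>)" if "r \<in> {0..t}" for r
      using generator_inside[of "Zb r \<omega>"] inventory_in_band[OF \<omega>, of r] that by simp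
    have nn: "0 \<le> indicator {0..t} r *\<^sub>R (\<mu> * A - gen (Zb (max 0 r) \<omega>))" for r
      using h[of r] h_nonneg by (cases "r \<in> {0..t}") auto
    have "ennreal (\<mu> * A * t - G t \<omega>) = (\<integral>\<^sup>+r. ennreal (indicator {0..t} r *\<^sub>R (\<mu> * A - gen (Zb (max 0 r) \<omega>))) \<partial>lborel)"
      unfolding eq set_lebesgue_integral_def
      by (rule nn_integral_eq_integral[symmetric], rule set_integral_diff(1)[OF ic iG, unfolded set_integrable_def])
         (rule AE_I2, rule nn)
    also have "\<dots> = (\<integral>\<^sup>+s\<in>{0..t}. ennreal (h (Zb s \<omega>)) \<partial>lborel)"
    proof (rule nn_integral_cong)
      fix r
      show "ennreal (indicator {0..t} r *\<^sub>R (\<mu> * A - gen (Zb (max 0 r) \<omega>))) = ennreal (h (Zb r \<omega>)) * indicator {0..t} r"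
        using h[of r] by (cases "r \<in> {0..t}") simp_all
    qed
    finally show "(\<integral>\<^sup>+s\<in>{0..t}. ennreal (h (Zb s \<omega>)) \<partial>lborel) = ennreal (\<mu> * A * t - G t \<omega>)" ..
    show "0 \<le> \<mu> * A * t - G t \<omega>"
      unfolding eq set_lebesgue_integral_def by (intro integral_nonneg_AE AE_I2 nn)
  qed
  have iG: "integrable M (\<lambda>\<omega>. \<mu> * A * t - G t \<omega>)" using G_limit(1)[OF t] by auto
  have EG: "expectation (\<lambda>\<omega>. \<mu> * A * t - G t \<omega>) = \<mu> * A * t - expectation (G t)"
    using G_limit(1)[OF t] by (simp add: prob_space)
  have EG0: "0 \<le> \<mu> * A * t - expectation (G t)"
    unfolding EG[symmetric] by (intro integral_nonneg_AE AE_I2 hold(2))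
  have "(\<integral>\<^sup>+\<omega>. total_cost (\<lambda>\<omega> s. Zb s \<omega>) h K L k l (policy UNIV) t \<omega> \<partial>M)
     \<le> (\<integral>\<^sup>+\<omega>. ennreal (\<mu> * A * t - G t \<omega>) + (ennreal initial_cost + all_stages t \<omega>) \<partial>M)"
  proof (rule nn_integral_mono)
    fix \<omega> assume \<omega>: "\<omega> \<in> space M"
    show "total_cost (\<lambda>\<omega> s. Zb s \<omega>) h K L k l (policy UNIV) t \<omega> \<le> ennreal (\<mu> * A * t - G t \<omega>) + (ennreal initial_cost + all_stages t \<omega>)"
      using add_left_mono[OF adjustment_costs_le[OF \<omega> t], of "ennreal (\<mu> * A * t - G t \<omega>)"]
      unfolding total_cost_def hold(1)[OF \<omega>] by (simp only: add.assoc)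
  qed
  also have "\<dots> = (\<integral>\<^sup>+\<omega>. ennreal (\<mu> * A * t - G t \<omega>) \<partial>M) + (ennreal initial_cost + (\<integral>\<^sup>+\<omega>. all_stages t \<omega> \<partial>M))"
    using all_stages_meas[OF t] iG by (subst nn_integral_add, (simp; fail), (simp; fail), subst nn_integral_add) (auto simp: emeasure_space_1)
  also have "(\<integral>\<^sup>+\<omega>. ennreal (\<mu> * A * t - G t \<omega>) \<partial>M) = ennreal (\<mu> * A * t - expectation (G t))"
    unfolding EG[symmetric] by (intro nn_integral_eq_integral iG AE_I2 hold(2))
  also have "ennreal (\<mu> * A * t - expectation (G t)) + (ennreal initial_cost + (\<integral>\<^sup>+\<omega>. all_stages t \<omega> \<partial>M))
      \<le> ennreal (\<mu> * A * t - expectation (G t)) + (ennreal initial_cost + ennreal (f (x + \<xi>0) - b + expectation (G t)))"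
    by (intro add_left_mono all_stages_bound(1) t b)
  also have "\<dots> = ennreal (\<mu> * A * t + (f (x + \<xi>0) - b + initial_cost))"
    using EG0 initial_cost_nonneg all_stages_bound(2)[OF t b] by (simp add: algebra_simps flip: ennreal_plus)
  finally show ?thesis .
qed

lemma average_cost_band_le: "average_cost M W \<mu> \<sigma> h K L k l x (policy UNIV) \<le> ennreal (\<mu> * A)"
proof -
  obtain b where b: "\<And>z. b \<le> f z" using f_bounded_below by blast
  define c where "c = f (x + \<xi>0) - b + initial_cost"
  let ?J = "\<lambda>t. \<integral>\<^sup>+\<omega>. total_cost (\<lambda>\<omega> s. Zb s \<omega>) h K L k l (policy UNIV) t \<omega> \<partial>M"
  have c0: "0 \<le> c" using b initial_cost_nonneg by (simp add: c_def)
  have "average_cost M W \<mu> \<sigma> h K L k l x (policy UNIV) = Limsup at_top (\<lambda>t. ?J t / ennreal t)"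
    by (simp add: average_cost_def total_cost_def)
  also have "\<dots> \<le> Limsup at_top (\<lambda>t. ennreal (\<mu> * A + c / t))"
  proof (rule Limsup_mono)
    show "\<forall>\<^sub>F t in at_top. ?J t / ennreal t \<le> ennreal (\<mu> * A + c / t)"
      using eventually_gt_at_top[of 0]
    proof eventually_elim
      case (elim t)
      have "?J t / ennreal t \<le> ennreal (\<mu> * A * t + c) / ennreal t"
        unfolding c_def by (intro divide_right_mono_ennreal band_cost_le elim b)
      also have "\<dots> = ennreal (\<mu> * A + c / t)"
      proof (cases "0 \<le> \<mu> * A * t + c")
        case True
        then show ?thesis using elim by (simp add: divide_ennreal add_divide_distrib)
      next
        case False
        then have "\<mu> * A + c / t < 0" using elim by (simp add: field_simps)
        then show ?thesis using False by (simp add: ennreal_neg)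
      qed
      finally show ?case .
    qed
  qed
  also have "\<dots> = ennreal (\<mu> * A)"
  proof (rule lim_imp_Limsup)
    have "((\<lambda>t. \<mu> * A + c / t) \<longlongrightarrow> \<mu> * A) at_top" by real_asymp
    then show "((\<lambda>t. ennreal (\<mu> * A + c / t)) \<longlongrightarrow> ennreal (\<mu> * A)) at_top" by (rule tendsto_ennrealI)
  qed simp
  finally show ?thesis .
qed

lemma average_cost_ge_band:
  assumes "feasible M F \<phi>"
  shows "ennreal (\<mu> * A) \<le> average_cost M W \<mu> \<sigma> h K L k l x \<phi>"
proof -
  interpret V: verified M F W \<mu> \<sigma> f p q P Q "{d, u}" \<phi> x h K L k l "\<mu> * A"
    by unfold_locales
       (use assms pos h_nonneg generator_ineq raise_costs(2) lower_costs(2) f_growth_h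
          borel_measurable_continuous_onI[OF h_cont] in auto)
  show ?thesis by (rule V.average_cost_ge)
qed

end

theorem theorem5p3:
  fixes M :: "'a measure" and F :: "real \<Rightarrow> 'a measure" and W :: "real \<Rightarrow> 'a \<Rightarrow> real"
    and \<mu> \<sigma> K L k l a A B d D U u :: real and h g :: "real \<Rightarrow> real"
  assumes "filtered_prob_space M F" and "standard_brownian_motion M F W"
    and "\<mu> > 0" and "\<sigma> > 0" and "K > 0" and "L > 0" and "k > 0" and "l > 0"
    and "holding_cost \<mu> \<sigma> h a"
    and "d < D" and "D < U" and "U < u"
    and "g = g_fun \<mu> \<sigma> h a A B"
    and "\<exists>x\<^sub>1 x\<^sub>2. x\<^sub>1 < a \<and> a < x\<^sub>2 \<and> d < x\<^sub>1 \<and> x\<^sub>1 < D \<and> U < x\<^sub>2 \<and> x\<^sub>2 < u \<and>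
           antimono_on {..<x\<^sub>1} g \<and> mono_on {x\<^sub>1<..<x\<^sub>2} g \<and> antimono_on {x\<^sub>2<..} g"
    and "(LBINT x=d..D. g x + k) = - K" and "(LBINT x=U..u. g x - l) = L"
    and "g d = - k" and "g D = - k" and "g U = l" and "g u = l"
  shows "\<forall>x. feasible M F (control_band_policy \<mu> \<sigma> W d D U u x) \<and>
           (\<forall>\<phi>. feasible M F \<phi> \<longrightarrow>
              average_cost M W \<mu> \<sigma> h K L k l x (control_band_policy \<mu> \<sigma> W d D U u x)
                \<le> average_cost M W \<mu> \<sigma> h K L k l x \<phi>)"
proof (intro allI conjI impI)
  fix x
  have "band_problem \<mu> \<sigma> K L k l a A B d D U u h g"
    by (rule band_problem.intro) (fact assms)+
  moreover have "netput_space M F W \<sigma>"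
    by (rule netput_space.intro) (fact assms)+
  ultimately interpret optimal_band M F W \<mu> \<sigma> K L k l a A B d D U u h g x
    by (rule optimal_band.intro[rotated])
  show "feasible M F (control_band_policy \<mu> \<sigma> W d D U u x)"
    using feasible_band by (simp add: policy_UNIV)
  show "average_cost M W \<mu> \<sigma> h K L k l x (control_band_policy \<mu> \<sigma> W d D U u x)
      \<le> average_cost M W \<mu> \<sigma> h K L k l x \<phi>" if "feasible M F \<phi>" for \<phi>
    using average_cost_band_le average_cost_ge_band[OF that] unfolding policy_UNIV by (rule order_trans)
qed

end
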